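(* Let $A$ be a short local algebra of Hilbert type $(e,a)$ which is not self-injective. Assume that $M$ is an indecomposable, reflexive and non-projective $A$-module with $\operatorname{Ext}^i_A(M,A)=0$ for $i=1,2$. Then $2\le a=e-1$. If $t=t(M)$, then $\operatorname{\mathbf{dim}} X=(t,at)$ for every $X\in\{\Omega^2M,\ \Omega M,\ M,\ \mho M\}$.
   Context: Let $k$ be a field. All algebras $A$ are finite-dimensional local (not necessarily commutative) $k$-algebras with radical $J$ such that $A/J=k$. $A$ is short if $J^3=0$. $|M|$ denotes the length of a module $M$. Put $e=|J/J^2|$ and $a=|J^2|$; $(e,a)$ is the Hilbert type of the short local algebra $A$. Modules are left $A$-modules of finite length. $A$ is self-injective if ${}_AA$ is injective. For a module $M$: $t(M)=|M/JM|$; $\Omega M$ is the kernel of a projective cover $PM\to M$, and $\Omega^iM$ is the $i$-fold iterate. If $M$ has Loewy length at most $2$, its dimension vector is $\operatorname{\mathbf{dim}}M=(t(M),|JM|)$ (so the assertion $\operatorname{\mathbf{dim}}X=(t,at)$ includes that $X$ has Loewy length at most $2$). $M^*=\operatorname{Hom}_A(M,{}_AA)$, and $M$ is reflexive if the canonical map $M\to M^{**}$ is bijective. $\mho M$ is the cokernel of a minimal left $\operatorname{add}A$-approximation of $M$, i.e. of a left minimal map $u\colon M\to P$ with $P$ projective such that every map from $M$ to a projective module factors through $u$. *)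

theory Defs
  imports "HOL-Algebra.Module" "HOL-Algebra.QuotRing" "HOL-Algebra.Ideal_Product"
    "HOL-Algebra.Elementary_Groups" "HOL-Library.Extended_Nat"
begin

(* HOL-Algebra's locale "module" requires a commutative ring of scalars; the record
   type "module" and the locale "submodule" do not, and they are reused here.
   Of a record describing a left module only the fields carrier, zero, add and smult
   are relevant. *)
locale left_module = R?: ring R + M?: abelian_group M
    for R :: "('a, 'r) ring_scheme" (structure) and M :: "('a, 'm) module" (structure) +
  assumes smult_closed:
      "\<lbrakk>a \<in> carrier R; x \<in> carrier M\<rbrakk> \<Longrightarrow> a \<odot>\<^bsub>M\<^esub> x \<in> carrier M"
    and smult_l_distr:
      "\<lbrakk>a \<in> carrier R; b \<in> carrier R; x \<in> carrier M\<rbrakk> \<Longrightarrow>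
        (a \<oplus> b) \<odot>\<^bsub>M\<^esub> x = (a \<odot>\<^bsub>M\<^esub> x) \<oplus>\<^bsub>M\<^esub> (b \<odot>\<^bsub>M\<^esub> x)"
    and smult_r_distr:
      "\<lbrakk>a \<in> carrier R; x \<in> carrier M; y \<in> carrier M\<rbrakk> \<Longrightarrow>
        a \<odot>\<^bsub>M\<^esub> (x \<oplus>\<^bsub>M\<^esub> y) = (a \<odot>\<^bsub>M\<^esub> x) \<oplus>\<^bsub>M\<^esub> (a \<odot>\<^bsub>M\<^esub> y)"
    and smult_assoc:
      "\<lbrakk>a \<in> carrier R; b \<in> carrier R; x \<in> carrier M\<rbrakk> \<Longrightarrow>
        (a \<otimes> b) \<odot>\<^bsub>M\<^esub> x = a \<odot>\<^bsub>M\<^esub> (b \<odot>\<^bsub>M\<^esub> x)"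
    and smult_one: "x \<in> carrier M \<Longrightarrow> \<one> \<odot>\<^bsub>M\<^esub> x = x"

definition reg_mod :: "('a, 'r) ring_scheme \<Rightarrow> ('a, 'a) module" where
  "reg_mod A = \<lparr>carrier = carrier A, monoid.mult = monoid.mult A, one = one A,
                ring.zero = ring.zero A, add = add A, smult = monoid.mult A\<rparr>"

definition sub_mod :: "('a, 'm) module \<Rightarrow> 'm set \<Rightarrow> ('a, 'm) module" where
  "sub_mod M N = M\<lparr>carrier := N\<rparr>"

definition quot_mod :: "('a, 'm) module \<Rightarrow> 'm set \<Rightarrow> ('a, 'm set) module" where
  "quot_mod M N = \<lparr>carrier = a_rcosets\<^bsub>M\<^esub> N, monoid.mult = undefined, one = undefined,
                   ring.zero = N, add = set_add M,
                   smult = (\<lambda>a Z. \<Union>x\<in>Z. N +>\<^bsub>M\<^esub> (a \<odot>\<^bsub>M\<^esub> x))\<rparr>"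

definition mod_length :: "('a, 'r) ring_scheme \<Rightarrow> ('a, 'm) module \<Rightarrow> enat" where
  "mod_length A M = Sup {enat n | n. \<exists>U :: nat \<Rightarrow> 'm set.
      (\<forall>i\<le>n. submodule (U i) A M) \<and> (\<forall>i<n. U i \<subset> U (Suc i))}"

definition fl_module :: "('a, 'r) ring_scheme \<Rightarrow> ('a, 'm) module \<Rightarrow> bool" where
  "fl_module A M \<longleftrightarrow> left_module A M \<and> mod_length A M \<noteq> \<infinity>"

(* Homomorphisms are taken to be undefined outside the carrier, so that equal maps
   are equal as functions. *)
definition lhom ::
  "('a, 'r) ring_scheme \<Rightarrow> ('a, 'm) module \<Rightarrow> ('a, 'n) module \<Rightarrow> ('m \<Rightarrow> 'n) set" where
  "lhom A M N = {f \<in> carrier M \<rightarrow>\<^sub>E carrier N.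
      (\<forall>x\<in>carrier M. \<forall>y\<in>carrier M. f (x \<oplus>\<^bsub>M\<^esub> y) = f x \<oplus>\<^bsub>N\<^esub> f y) \<and>
      (\<forall>a\<in>carrier A. \<forall>x\<in>carrier M. f (a \<odot>\<^bsub>M\<^esub> x) = a \<odot>\<^bsub>N\<^esub> f x)}"


section \<open>Short local algebras\<close>

definition maximal_left_ideal :: "('a, 'r) ring_scheme \<Rightarrow> 'a set \<Rightarrow> bool" where
  "maximal_left_ideal A L \<longleftrightarrow>
     submodule L A (reg_mod A) \<and> L \<noteq> carrier A \<and>
     (\<forall>L'. submodule L' A (reg_mod A) \<and> L \<subseteq> L' \<and> L' \<noteq> carrier A \<longrightarrow> L' = L)"

definition jrad :: "('a, 'r) ring_scheme \<Rightarrow> 'a set" where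
  "jrad A = {x \<in> carrier A. \<forall>L. maximal_left_ideal A L \<longrightarrow> x \<in> L}"

definition fd_algebra :: "'k ring \<Rightarrow> ('k, 'a) module \<Rightarrow> bool" where
  "fd_algebra K A \<longleftrightarrow> field K \<and> ring A \<and> Module.module K A \<and>
     (\<forall>c\<in>carrier K. \<forall>x\<in>carrier A. \<forall>y\<in>carrier A.
        (c \<odot>\<^bsub>A\<^esub> x) \<otimes>\<^bsub>A\<^esub> y = c \<odot>\<^bsub>A\<^esub> (x \<otimes>\<^bsub>A\<^esub> y) \<and>
        x \<otimes>\<^bsub>A\<^esub> (c \<odot>\<^bsub>A\<^esub> y) = c \<odot>\<^bsub>A\<^esub> (x \<otimes>\<^bsub>A\<^esub> y)) \<and>
     (\<exists>B. finite B \<and> B \<subseteq> carrier A \<and>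
        (\<forall>x\<in>carrier A. \<exists>c \<in> B \<rightarrow> carrier K. x = (\<Oplus>\<^bsub>A\<^esub>b\<in>B. c b \<odot>\<^bsub>A\<^esub> b)))"

(* The last conjunct is A/J = k: the structure map from k to A/J is an isomorphism. *)
definition local_algebra :: "'k ring \<Rightarrow> ('k, 'a) module \<Rightarrow> bool" where
  "local_algebra K A \<longleftrightarrow> fd_algebra K A \<and> (\<exists>!L. maximal_left_ideal A L) \<and>
     (\<lambda>c. jrad A +>\<^bsub>A\<^esub> (c \<odot>\<^bsub>A\<^esub> \<one>\<^bsub>A\<^esub>)) \<in> ring_iso K (A Quot jrad A)"

definition short_local_algebra :: "'k ring \<Rightarrow> ('k, 'a) module \<Rightarrow> bool" where
  "short_local_algebra K A \<longleftrightarrow> local_algebra K A \<and>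
     ideal_prod A (jrad A) (ideal_prod A (jrad A) (jrad A)) = {\<zero>\<^bsub>A\<^esub>}"

definition hilbert_type :: "('a, 'r) ring_scheme \<Rightarrow> nat \<Rightarrow> nat \<Rightarrow> bool" where
  "hilbert_type A e a \<longleftrightarrow>
     (let J = jrad A; J2 = ideal_prod A J J in
        mod_length A (quot_mod (sub_mod (reg_mod A) J) J2) = enat e \<and>
        mod_length A (sub_mod (reg_mod A) J2) = enat a)"


section \<open>Top, radical and dimension vector\<close>

inductive_set ideal_smult :: "('a, 'm) module \<Rightarrow> 'a set \<Rightarrow> 'm set \<Rightarrow> 'm set"
  for M and I and N where
    smult: "\<lbrakk>a \<in> I; x \<in> N\<rbrakk> \<Longrightarrow> a \<odot>\<^bsub>M\<^esub> x \<in> ideal_smult M I N"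
  | add: "\<lbrakk>x \<in> ideal_smult M I N; y \<in> ideal_smult M I N\<rbrakk> \<Longrightarrow> x \<oplus>\<^bsub>M\<^esub> y \<in> ideal_smult M I N"

definition rad_mod :: "('a, 'r) ring_scheme \<Rightarrow> ('a, 'm) module \<Rightarrow> 'm set" where
  "rad_mod A M = ideal_smult M (jrad A) (carrier M)"

definition top_length :: "('a, 'r) ring_scheme \<Rightarrow> ('a, 'm) module \<Rightarrow> enat" where
  "top_length A M = mod_length A (quot_mod M (rad_mod A M))"

definition loewy_length_le2 :: "('a, 'r) ring_scheme \<Rightarrow> ('a, 'm) module \<Rightarrow> bool" where
  "loewy_length_le2 A M \<longleftrightarrow> ideal_smult M (jrad A) (rad_mod A M) = {\<zero>\<^bsub>M\<^esub>}"

definition has_dim_vector ::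
  "('a, 'r) ring_scheme \<Rightarrow> ('a, 'm) module \<Rightarrow> enat \<times> enat \<Rightarrow> bool" where
  "has_dim_vector A M v \<longleftrightarrow> loewy_length_le2 A M \<and>
     v = (top_length A M, mod_length A (sub_mod M (rad_mod A M)))"


section \<open>Projective and injective modules\<close>

(* HOL cannot quantify over all types inside a definition, so "all finite length
   modules" is rendered as "all finite length modules with elements in nat => 'a".
   Nothing is lost: a finite length module is a quotient of some A^n, hence has at most
   as many elements as nat => 'a and is isomorphic to a module living on that type. *)

definition projective :: "('a, 'r) ring_scheme \<Rightarrow> ('a, 'm) module \<Rightarrow> bool" where
  "projective A P \<longleftrightarrow> fl_module A P \<and>
     (\<forall>(Z :: ('a, nat \<Rightarrow> 'a) module) (Y :: ('a, nat \<Rightarrow> 'a) module) g f.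
        fl_module A Z \<and> fl_module A Y \<and> g \<in> lhom A Z Y \<and> g ` carrier Z = carrier Y \<and>
        f \<in> lhom A P Y \<longrightarrow> (\<exists>h\<in>lhom A P Z. compose (carrier P) g h = f))"

definition injective :: "('a, 'r) ring_scheme \<Rightarrow> ('a, 'm) module \<Rightarrow> bool" where
  "injective A E \<longleftrightarrow> fl_module A E \<and>
     (\<forall>(Z :: ('a, nat \<Rightarrow> 'a) module) (Y :: ('a, nat \<Rightarrow> 'a) module) i f.
        fl_module A Z \<and> fl_module A Y \<and> i \<in> lhom A Z Y \<and> inj_on i (carrier Z) \<and>
        f \<in> lhom A Z E \<longrightarrow> (\<exists>h\<in>lhom A Y E. compose (carrier Z) h i = f))"

definition self_injective :: "('a, 'r) ring_scheme \<Rightarrow> bool" where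
  "self_injective A \<longleftrightarrow> injective A (reg_mod A)"

definition indecomposable :: "('a, 'r) ring_scheme \<Rightarrow> ('a, 'm) module \<Rightarrow> bool" where
  "indecomposable A M \<longleftrightarrow> carrier M \<noteq> {\<zero>\<^bsub>M\<^esub>} \<and>
     (\<forall>U V. submodule U A M \<and> submodule V A M \<and>
        U \<inter> V = {\<zero>\<^bsub>M\<^esub>} \<and> U <+>\<^bsub>M\<^esub> V = carrier M \<longrightarrow>
        U = {\<zero>\<^bsub>M\<^esub>} \<or> V = {\<zero>\<^bsub>M\<^esub>})"


section \<open>Syzygies and cosyzygies\<close>

definition projective_cover ::
  "('a, 'r) ring_scheme \<Rightarrow> ('a, 'm) module \<Rightarrow> ('a, 'p) module \<Rightarrow> ('p \<Rightarrow> 'm) \<Rightarrow> bool" where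
  "projective_cover A M P p \<longleftrightarrow>
     projective A P \<and> p \<in> lhom A P M \<and> p ` carrier P = carrier M \<and>
     (\<forall>U. submodule U A P \<and> U <+>\<^bsub>P\<^esub> a_kernel P M p = carrier P \<longrightarrow> U = carrier P)"

(* Projective covers and minimal approximations exist and are unique up to isomorphism
   for finite length modules, and they can be found on the type nat => 'a; Omega and
   mho are formed from an arbitrary choice. *)
definition Omega :: "('a, 'r) ring_scheme \<Rightarrow> ('a, 'm) module \<Rightarrow> ('a, nat \<Rightarrow> 'a) module" where
  "Omega A M =
     (let (P, p) = (SOME (P, p). projective_cover A M P p) in sub_mod P (a_kernel P M p))"

definition minimal_left_approx ::
  "('a, 'r) ring_scheme \<Rightarrow> ('a, 'm) module \<Rightarrow> ('a, 'p) module \<Rightarrow> ('m \<Rightarrow> 'p) \<Rightarrow> bool" where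
  "minimal_left_approx A M P u \<longleftrightarrow>
     projective A P \<and> u \<in> lhom A M P \<and>
     (\<forall>(Q :: ('a, nat \<Rightarrow> 'a) module) f. projective A Q \<and> f \<in> lhom A M Q \<longrightarrow>
        (\<exists>h\<in>lhom A P Q. compose (carrier M) h u = f)) \<and>
     (\<forall>h\<in>lhom A P P. compose (carrier M) h u = u \<longrightarrow> bij_betw h (carrier P) (carrier P))"

definition mho :: "('a, 'r) ring_scheme \<Rightarrow> ('a, 'm) module \<Rightarrow> ('a, (nat \<Rightarrow> 'a) set) module" where
  "mho A M =
     (let (P, u) = (SOME (P, u). minimal_left_approx A M P u) in quot_mod P (u ` carrier M))"


section \<open>Duality\<close>

definition opp_ring :: "('a, 'r) ring_scheme \<Rightarrow> ('a, 'r) ring_scheme" where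
  "opp_ring A = A\<lparr>monoid.mult := (\<lambda>x y. y \<otimes>\<^bsub>A\<^esub> x)\<rparr>"

(* Right A-modules are treated as left modules over the opposite ring: the right action
   on the dual of a left module is (f a)(x) = f(x) a. As opp_ring (opp_ring A) = A,
   the double dual "dual (opp_ring A) (dual A M)" is again a left A-module. *)
definition dual :: "('a, 'r) ring_scheme \<Rightarrow> ('a, 'm) module \<Rightarrow> ('a, 'm \<Rightarrow> 'a) module" where
  "dual A M = \<lparr>carrier = lhom A M (reg_mod A), monoid.mult = undefined, one = undefined,
     ring.zero = (\<lambda>x\<in>carrier M. \<zero>\<^bsub>A\<^esub>),
     add = (\<lambda>f g. \<lambda>x\<in>carrier M. f x \<oplus>\<^bsub>A\<^esub> g x),
     smult = (\<lambda>a f. \<lambda>x\<in>carrier M. f x \<otimes>\<^bsub>A\<^esub> a)\<rparr>"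

definition reflexive :: "('a, 'r) ring_scheme \<Rightarrow> ('a, 'm) module \<Rightarrow> bool" where
  "reflexive A M \<longleftrightarrow>
     bij_betw (\<lambda>x. \<lambda>f\<in>carrier (dual A M). f x)
       (carrier M) (carrier (dual (opp_ring A) (dual A M)))"


section \<open>Ext\<close>

definition projective_resolution ::
  "('a, 'r) ring_scheme \<Rightarrow> ('a, 'm) module \<Rightarrow>
   (nat \<Rightarrow> ('a, 'p) module) \<Rightarrow> (nat \<Rightarrow> 'p \<Rightarrow> 'p) \<Rightarrow> ('p \<Rightarrow> 'm) \<Rightarrow> bool" where
  "projective_resolution A M P d \<epsilon> \<longleftrightarrow>
     (\<forall>n. projective A (P n)) \<and> (\<forall>n. d n \<in> lhom A (P (Suc n)) (P n)) \<and>
     \<epsilon> \<in> lhom A (P 0) M \<and> \<epsilon> ` carrier (P 0) = carrier M \<and>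
     d 0 ` carrier (P (Suc 0)) = a_kernel (P 0) M \<epsilon> \<and>
     (\<forall>n. d (Suc n) ` carrier (P (Suc (Suc n))) = a_kernel (P (Suc n)) (P n) (d n))"

definition hom_group ::
  "('a, 'r) ring_scheme \<Rightarrow> ('a, 'm) module \<Rightarrow> ('a, 'n) module \<Rightarrow> ('m \<Rightarrow> 'n) monoid" where
  "hom_group A M N = \<lparr>carrier = lhom A M N,
     monoid.mult = (\<lambda>f g. \<lambda>x\<in>carrier M. f x \<oplus>\<^bsub>N\<^esub> g x),
     one = (\<lambda>x\<in>carrier M. \<zero>\<^bsub>N\<^esub>)\<rparr>"

definition cocycles ::
  "('a, 'r) ring_scheme \<Rightarrow> (nat \<Rightarrow> ('a, 'p) module) \<Rightarrow> (nat \<Rightarrow> 'p \<Rightarrow> 'p) \<Rightarrow>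
   ('a, 'n) module \<Rightarrow> nat \<Rightarrow> ('p \<Rightarrow> 'n) set" where
  "cocycles A P d N i = {f \<in> lhom A (P i) N. \<forall>x\<in>carrier (P (Suc i)). f (d i x) = \<zero>\<^bsub>N\<^esub>}"

fun coboundaries ::
  "('a, 'r) ring_scheme \<Rightarrow> (nat \<Rightarrow> ('a, 'p) module) \<Rightarrow> (nat \<Rightarrow> 'p \<Rightarrow> 'p) \<Rightarrow>
   ('a, 'n) module \<Rightarrow> nat \<Rightarrow> ('p \<Rightarrow> 'n) set" where
  "coboundaries A P d N 0 = {\<lambda>x\<in>carrier (P 0). \<zero>\<^bsub>N\<^esub>}"
| "coboundaries A P d N (Suc i) =
     (\<lambda>g. compose (carrier (P (Suc i))) g (d i)) ` lhom A (P i) N"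

definition Ext_group ::
  "('a, 'r) ring_scheme \<Rightarrow> (nat \<Rightarrow> ('a, 'p) module) \<Rightarrow> (nat \<Rightarrow> 'p \<Rightarrow> 'p) \<Rightarrow>
   ('a, 'n) module \<Rightarrow> nat \<Rightarrow> ('p \<Rightarrow> 'n) set monoid" where
  "Ext_group A P d N i =
     ((hom_group A (P i) N)\<lparr>carrier := cocycles A P d N i\<rparr>) Mod (coboundaries A P d N i)"

(* Ext^i(M,N) does not depend on the resolution, up to isomorphism. *)
definition Ext_vanishes ::
  "('a, 'r) ring_scheme \<Rightarrow> nat \<Rightarrow> ('a, 'm) module \<Rightarrow> ('a, 'n) module \<Rightarrow> bool" where
  "Ext_vanishes A i M N \<longleftrightarrow>
     (\<forall>(P :: nat \<Rightarrow> ('a, nat \<Rightarrow> 'a) module) d \<epsilon>.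
        projective_resolution A M P d \<epsilon> \<longrightarrow> trivial_group (Ext_group A P d N i))"

end

theory Submission
  imports Defs
begin

text \<open>
Let \<open>J\<close> be the radical of \<open>A\<close>, let \<open>t(X)\<close> be the minimal number of generators of \<open>X\<close> and \<open>h(X)\<close> the
dimension of \<open>Hom(X, A)\<close>. In the sequence \<open>X\<^sub>-\<^sub>1 = \<mho>M\<close>, \<open>X\<^sub>0 = M\<close>, \<open>X\<^sub>1 = \<Omega>M\<close>, \<open>X\<^sub>2 = \<Omega>\<^sup>2M\<close> each
\<open>X\<^sub>i\<^sub>+\<^sub>1\<close> is the syzygy of \<open>X\<^sub>i\<close>, inside the projective cover \<open>P\<^sub>i\<close>. The hypotheses on \<open>M\<close> provide two
properties of this sequence, for \<open>i = -1, 0, 1\<close>: every map \<open>X\<^sub>i\<^sub>+\<^sub>1 \<rightarrow> A\<close> extends to \<open>P\<^sub>i\<close>, and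
\<open>J\<^sup>2P\<^sub>i \<subseteq> X\<^sub>i\<^sub>+\<^sub>1 \<subseteq> JP\<^sub>i\<close>. For \<open>i = 0, 1\<close> the first one is the vanishing of Ext
(\<open>Omega_syz\<close>, \<open>Omega2_syz\<close>), and the second one holds because \<open>X\<^sub>i \<subseteq> JP\<^sub>i\<^sub>-\<^sub>1\<close> is
annihilated by \<open>J\<^sup>2\<close>. For \<open>i = -1\<close> the inclusion of \<open>M\<close> is an approximation by construction, it goes into
\<open>JP\<^sub>-\<^sub>1\<close> because \<open>M\<close> has no free summand, and reflexivity makes it contain \<open>J\<^sup>2P\<^sub>-\<^sub>1\<close> (\<open>mho_syz\<close>).

Let \<open>f\<close> be a map of rank one from \<open>Y = X\<^sub>i\<^sub>+\<^sub>1\<close> to the socle of \<open>A\<close>, extended to \<open>\<phi> : P\<^sub>i \<rightarrow> A\<close>. If \<open>\<phi>\<close>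
has an invertible coefficient, then \<open>\<phi>\<close> maps \<open>J\<^sup>2P\<^sub>i \<subseteq> Y\<close> onto \<open>J\<^sup>2\<close>, so \<open>J\<^sup>2\<close> lies in the line \<open>f(Y)\<close>;
otherwise \<open>f(Y) \<subseteq> \<phi>(JP\<^sub>i) \<subseteq> J\<^sup>2\<close> (\<open>rank_one_unit\<close>). When \<open>J\<^sup>2 \<noteq> 0\<close>, both alternatives put \<open>f(Y)\<close> into
\<open>J\<^sup>2\<close>, so the socle is \<open>J\<^sup>2\<close> (\<open>socle_eq_J2\<close>); the case \<open>J\<^sup>2 = 0\<close> leads to a socle of dimension at most
one (\<open>semisimple_case\<close>). An algebra of this kind with such a socle is self-injective
(\<open>socle_in_line_self_injective\<close>), which is excluded, so \<open>J\<^sup>2\<close> is the socle and \<open>a \<ge> 2\<close>. Now only the second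
alternative is left: all maps \<open>Y \<rightarrow> J\<^sup>2\<close> come from coefficients in \<open>J\<close> (\<open>rho_J_onto\<close>). Counting
dimensions gives \<open>h(X\<^sub>i\<^sub>+\<^sub>1) = t(X\<^sub>i) + a t(X\<^sub>i\<^sub>+\<^sub>1)\<close> (\<open>dim_dual\<close>) and \<open>a t(X\<^sub>i\<^sub>+\<^sub>1) \<le> e t(X\<^sub>i)\<close>
(\<open>growth_le\<close>), while exactness of \<open>Hom(-, A)\<close> gives \<open>h(X\<^sub>i) + h(X\<^sub>i\<^sub>+\<^sub>1) = t(X\<^sub>i)(1 + e + a)\<close>
(\<open>syz_dual\<close>).

Moreover \<open>JX\<^sub>i\<^sub>+\<^sub>1 = J\<^sup>2P\<^sub>i\<close> for \<open>i = -1, 0\<close> (\<open>aligned\<close>): otherwise the residue field \<open>k\<close> is a direct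
summand of \<open>X\<^sub>i\<^sub>+\<^sub>1\<close>, all maps from its syzygy \<open>J\<close> to \<open>A\<close> extend to \<open>A\<close>, and the growth
inequality for \<open>k\<close> reads \<open>a e \<le> e\<close>, which is false (\<open>J_not_extends\<close>). The lengths of the sequences
\<open>0 \<rightarrow> X\<^sub>i\<^sub>+\<^sub>1 \<rightarrow> P\<^sub>i \<rightarrow> X\<^sub>i \<rightarrow> 0\<close> together with the equations for \<open>h\<close> form a linear system with
inequalities whose only solutions have \<open>e = a + 1\<close> and constant \<open>t\<close> (\<open>dimension_recursion\<close>).

All dimensions are lengths of modules, over \<open>A\<close> for the modules \<open>X\<^sub>i\<close> and over the ground field for
spaces of homomorphisms; the tool for comparing them is \<open>length_rank_nullity\<close>. Syzygies are handled
through a minimal generating set of \<open>X\<^sub>i\<close> and coordinate functions on \<open>X\<^sub>i\<^sub>+\<^sub>1\<close>, so that maps to \<open>A\<close>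
become vectors of coefficients.\<close>

section \<open>Linear maps and length\<close>

declare (in left_module) smult_closed [simp] and smult_one [simp]

text \<open>The condition on \<open>lhom\<close> outside the carrier is dropped, so that restrictions and
  composites of maps need no adjustment.\<close>
definition lin ::
  "('a, 'r) ring_scheme \<Rightarrow> ('a, 'm) module \<Rightarrow> ('a, 'n) module \<Rightarrow> ('m \<Rightarrow> 'n) \<Rightarrow> bool" where
  "lin R X Y f \<longleftrightarrow> f \<in> carrier X \<rightarrow> carrier Y \<and>
     (\<forall>x\<in>carrier X. \<forall>y\<in>carrier X. f (x \<oplus>\<^bsub>X\<^esub> y) = f x \<oplus>\<^bsub>Y\<^esub> f y) \<and>
     (\<forall>a\<in>carrier R. \<forall>x\<in>carrier X. f (a \<odot>\<^bsub>X\<^esub> x) = a \<odot>\<^bsub>Y\<^esub> f x)"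

lemma lhom_iff: "f \<in> lhom R X Y \<longleftrightarrow> lin R X Y f \<and> f \<in> extensional (carrier X)"
  by (auto simp: lhom_def lin_def PiE_def)

lemma lhom_lin: "f \<in> lhom R X Y \<Longrightarrow> lin R X Y f"
  by (simp add: lhom_iff)

lemma lin_restrict:
  assumes "left_module R X" "lin R X Y f"
  shows "restrict f (carrier X) \<in> lhom R X Y"
proof -
  interpret X: left_module R X by fact
  show ?thesis using assms(2) unfolding lhom_def lin_def by (auto simp: Pi_iff)
qed

lemma lin_comp: "lin R X Y f \<Longrightarrow> lin R Y Z g \<Longrightarrow> lin R X Z (\<lambda>x. g (f x))"
  by (auto simp: lin_def Pi_iff)

lemma lin_sub_mod:
  "lin R X Y f \<Longrightarrow> N \<subseteq> carrier X \<Longrightarrow> f ` N \<subseteq> N' \<Longrightarrow> lin R (sub_mod X N) (sub_mod Y N') f"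
  by (auto simp: lin_def sub_mod_def Pi_iff subset_iff)

lemma sub_mod_simps [simp]:
  "carrier (sub_mod X N) = N" "zero (sub_mod X N) = zero X" "add (sub_mod X N) = add X"
  "smult (sub_mod X N) = smult X" "sub_mod (sub_mod X N) N' = sub_mod X N'"
  "sub_mod X (carrier X) = X"
  by (simp_all add: sub_mod_def)

lemma reg_mod_simps [simp]:
  "carrier (reg_mod R) = carrier R" "zero (reg_mod R) = zero R" "add (reg_mod R) = add R"
  "smult (reg_mod R) = monoid.mult R"
  by (simp_all add: reg_mod_def)

context left_module
begin

lemma smult_l_zero [simp]: "x \<in> carrier M \<Longrightarrow> \<zero> \<odot>\<^bsub>M\<^esub> x = \<zero>\<^bsub>M\<^esub>"
  using smult_l_distr[of \<zero> \<zero> x] smult_closed[of \<zero> x]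
  by (metis M.add.l_cancel_one R.r_zero R.zero_closed)

lemma smult_r_zero [simp]: "a \<in> carrier R \<Longrightarrow> a \<odot>\<^bsub>M\<^esub> \<zero>\<^bsub>M\<^esub> = \<zero>\<^bsub>M\<^esub>"
  using smult_r_distr[of a "\<zero>\<^bsub>M\<^esub>" "\<zero>\<^bsub>M\<^esub>"] smult_closed[of a "\<zero>\<^bsub>M\<^esub>"]
  by (metis M.add.l_cancel_one M.r_zero M.zero_closed)

lemma smult_l_minus: "a \<in> carrier R \<Longrightarrow> x \<in> carrier M \<Longrightarrow> (\<ominus> a) \<odot>\<^bsub>M\<^esub> x = \<ominus>\<^bsub>M\<^esub> (a \<odot>\<^bsub>M\<^esub> x)"
  using smult_l_distr[of "\<ominus> a" a x]
  by (metis M.minus_equality R.add.inv_closed R.l_neg smult_closed smult_l_zero)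

lemma smult_r_minus: "a \<in> carrier R \<Longrightarrow> x \<in> carrier M \<Longrightarrow> a \<odot>\<^bsub>M\<^esub> (\<ominus>\<^bsub>M\<^esub> x) = \<ominus>\<^bsub>M\<^esub> (a \<odot>\<^bsub>M\<^esub> x)"
  using smult_r_distr[of a "\<ominus>\<^bsub>M\<^esub> x" x]
  by (metis M.minus_equality M.add.inv_closed M.l_neg smult_closed smult_r_zero)

lemmas mod_a_ac = M.a_assoc M.a_comm M.a_lcomm
lemmas mod_l_neg = M.l_neg
lemmas mod_neg_unique = M.minus_equality

lemma mod_neg_zero: "\<ominus>\<^bsub>M\<^esub> \<zero>\<^bsub>M\<^esub> = \<zero>\<^bsub>M\<^esub>"
  using M.minus_equality[of "\<zero>\<^bsub>M\<^esub>" "\<zero>\<^bsub>M\<^esub>"] by simp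

lemma mod_minus_self: "x \<in> carrier M \<Longrightarrow> x \<ominus>\<^bsub>M\<^esub> x = \<zero>\<^bsub>M\<^esub>"
  by (simp add: a_minus_def M.r_neg)

lemma mod_minus_add: "x \<in> carrier M \<Longrightarrow> y \<in> carrier M \<Longrightarrow> (x \<ominus>\<^bsub>M\<^esub> y) \<oplus>\<^bsub>M\<^esub> y = x"
  by (simp add: a_minus_def M.a_assoc M.l_neg)

lemma submodule_iff:
  "submodule U R M \<longleftrightarrow> U \<subseteq> carrier M \<and> \<zero>\<^bsub>M\<^esub> \<in> U \<and> (\<forall>x\<in>U. \<forall>y\<in>U. x \<oplus>\<^bsub>M\<^esub> y \<in> U) \<and>
     (\<forall>a\<in>carrier R. \<forall>x\<in>U. a \<odot>\<^bsub>M\<^esub> x \<in> U)"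
proof
  assume "submodule U R M"
  then interpret submodule U R M .
  show "U \<subseteq> carrier M \<and> \<zero>\<^bsub>M\<^esub> \<in> U \<and> (\<forall>x\<in>U. \<forall>y\<in>U. x \<oplus>\<^bsub>M\<^esub> y \<in> U) \<and>
     (\<forall>a\<in>carrier R. \<forall>x\<in>U. a \<odot>\<^bsub>M\<^esub> x \<in> U)"
    using subset m_closed one_closed smult_closed by auto
next
  assume *: "U \<subseteq> carrier M \<and> \<zero>\<^bsub>M\<^esub> \<in> U \<and> (\<forall>x\<in>U. \<forall>y\<in>U. x \<oplus>\<^bsub>M\<^esub> y \<in> U) \<and>
     (\<forall>a\<in>carrier R. \<forall>x\<in>U. a \<odot>\<^bsub>M\<^esub> x \<in> U)"
  have "inv\<^bsub>add_monoid M\<^esub> x \<in> U" if "x \<in> U" for x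
  proof -
    have "inv\<^bsub>add_monoid M\<^esub> x = (\<ominus> \<one>) \<odot>\<^bsub>M\<^esub> x"
      using * that by (subst smult_l_minus) (auto simp: a_inv_def)
    then show ?thesis using * that by auto
  qed
  with * show "submodule U R M"
    by (unfold_locales) auto
qed

lemma submoduleI:
  assumes "U \<subseteq> carrier M" "\<zero>\<^bsub>M\<^esub> \<in> U" "\<And>x y. x \<in> U \<Longrightarrow> y \<in> U \<Longrightarrow> x \<oplus>\<^bsub>M\<^esub> y \<in> U"
    "\<And>a x. a \<in> carrier R \<Longrightarrow> x \<in> U \<Longrightarrow> a \<odot>\<^bsub>M\<^esub> x \<in> U"
  shows "submodule U R M"
  using assms by (auto simp: submodule_iff)

lemma submoduleD:
  assumes "submodule U R M"
  shows "U \<subseteq> carrier M" "\<zero>\<^bsub>M\<^esub> \<in> U" "x \<in> U \<Longrightarrow> y \<in> U \<Longrightarrow> x \<oplus>\<^bsub>M\<^esub> y \<in> U"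
    "a \<in> carrier R \<Longrightarrow> x \<in> U \<Longrightarrow> a \<odot>\<^bsub>M\<^esub> x \<in> U" "x \<in> U \<Longrightarrow> \<ominus>\<^bsub>M\<^esub> x \<in> U"
    "x \<in> U \<Longrightarrow> y \<in> U \<Longrightarrow> x \<ominus>\<^bsub>M\<^esub> y \<in> U"
proof -
  show 1: "U \<subseteq> carrier M" "\<zero>\<^bsub>M\<^esub> \<in> U" "\<And>x y. x \<in> U \<Longrightarrow> y \<in> U \<Longrightarrow> x \<oplus>\<^bsub>M\<^esub> y \<in> U"
    "\<And>a x. a \<in> carrier R \<Longrightarrow> x \<in> U \<Longrightarrow> a \<odot>\<^bsub>M\<^esub> x \<in> U"
    using assms by (auto simp: submodule_iff)
  show 2: "\<ominus>\<^bsub>M\<^esub> x \<in> U" if "x \<in> U" for x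
    using 1(4)[of "\<ominus> \<one>" x] 1(1) that by (simp add: smult_l_minus subset_iff)
  show "x \<in> U \<Longrightarrow> y \<in> U \<Longrightarrow> x \<ominus>\<^bsub>M\<^esub> y \<in> U"
    using 1 2 by (simp add: a_minus_def)
qed

lemma submodule_carrier: "submodule (carrier M) R M"
  by (simp add: submodule_iff)

lemma submodule_zero: "submodule {\<zero>\<^bsub>M\<^esub>} R M"
  by (simp add: submodule_iff)

lemma sub_mod_left_module:
  assumes "submodule N R M"
  shows "left_module R (sub_mod M N)"
proof -
  note N = submoduleD[OF assms]
  have "abelian_group (sub_mod M N)"
  proof (rule abelian_groupI, goal_cases)
    case (6 x)
    then show ?case using N(1) N(5)[of x] by (auto intro!: bexI[of _ "\<ominus>\<^bsub>M\<^esub> x"] M.l_neg)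
  qed (use N in \<open>auto simp: subset_iff M.a_assoc intro: M.a_comm\<close>)
  then show ?thesis
    unfolding left_module_def left_module_axioms_def
    using N by (auto simp: subset_iff R.ring_axioms smult_l_distr smult_r_distr smult_assoc)
qed

lemma submodule_sub_mod:
  assumes "submodule N R M"
  shows "submodule U R (sub_mod M N) \<longleftrightarrow> submodule U R M \<and> U \<subseteq> N"
  using submoduleD(1)[OF assms]
  by (auto simp: left_module.submodule_iff[OF sub_mod_left_module[OF assms]] submodule_iff)

lemma submodule_trans: "submodule N R M \<Longrightarrow> submodule U R (sub_mod M N) \<Longrightarrow> submodule U R M"
  by (simp add: submodule_sub_mod)

lemma submodule_Int: "submodule U R M \<Longrightarrow> submodule V R M \<Longrightarrow> submodule (U \<inter> V) R M"
  by (auto simp: submodule_iff)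

end

lemma left_moduleI:
  fixes M (structure)
  assumes "ring R"
    "\<And>x y. x \<in> carrier M \<Longrightarrow> y \<in> carrier M \<Longrightarrow> x \<oplus> y \<in> carrier M" "\<zero> \<in> carrier M"
    "\<And>x y z. x \<in> carrier M \<Longrightarrow> y \<in> carrier M \<Longrightarrow> z \<in> carrier M \<Longrightarrow> (x \<oplus> y) \<oplus> z = x \<oplus> (y \<oplus> z)"
    "\<And>x y. x \<in> carrier M \<Longrightarrow> y \<in> carrier M \<Longrightarrow> x \<oplus> y = y \<oplus> x"
    "\<And>x. x \<in> carrier M \<Longrightarrow> \<zero> \<oplus> x = x"
    "\<And>x. x \<in> carrier M \<Longrightarrow> \<exists>y\<in>carrier M. y \<oplus> x = \<zero>"
    "\<And>a x. a \<in> carrier R \<Longrightarrow> x \<in> carrier M \<Longrightarrow> a \<odot> x \<in> carrier M"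
    "\<And>a b x. a \<in> carrier R \<Longrightarrow> b \<in> carrier R \<Longrightarrow> x \<in> carrier M \<Longrightarrow> (a \<oplus>\<^bsub>R\<^esub> b) \<odot> x = a \<odot> x \<oplus> b \<odot> x"
    "\<And>a x y. a \<in> carrier R \<Longrightarrow> x \<in> carrier M \<Longrightarrow> y \<in> carrier M \<Longrightarrow> a \<odot> (x \<oplus> y) = a \<odot> x \<oplus> a \<odot> y"
    "\<And>a b x. a \<in> carrier R \<Longrightarrow> b \<in> carrier R \<Longrightarrow> x \<in> carrier M \<Longrightarrow> (a \<otimes>\<^bsub>R\<^esub> b) \<odot> x = a \<odot> (b \<odot> x)"
    "\<And>x. x \<in> carrier M \<Longrightarrow> \<one>\<^bsub>R\<^esub> \<odot> x = x"
  shows "left_module R M"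
  by (intro left_module.intro left_module_axioms.intro abelian_groupI) (use assms in auto)

lemma reg_mod_left_module: "ring R \<Longrightarrow> left_module R (reg_mod R)"
proof -
  assume "ring R"
  then interpret ring R .
  show ?thesis
    by (rule left_moduleI)
      (auto simp: \<open>ring R\<close> a_assoc l_distr r_distr m_assoc intro: a_comm bexI[of _ "\<ominus>\<^bsub>R\<^esub> _"] l_neg)
qed

locale lin_map = X?: left_module R X + Y?: left_module R Y
  for R (structure) and X :: "('a, 'x) module" (structure) and Y :: "('a, 'y) module" (structure) +
  fixes f assumes lin: "lin R X Y f"
begin

lemma f_closed [simp]: "x \<in> carrier X \<Longrightarrow> f x \<in> carrier Y"
  using lin by (auto simp: lin_def)

lemma f_add: "x \<in> carrier X \<Longrightarrow> y \<in> carrier X \<Longrightarrow> f (x \<oplus>\<^bsub>X\<^esub> y) = f x \<oplus>\<^bsub>Y\<^esub> f y"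
  using lin by (auto simp: lin_def)

lemma f_smult: "a \<in> carrier R \<Longrightarrow> x \<in> carrier X \<Longrightarrow> f (a \<odot>\<^bsub>X\<^esub> x) = a \<odot>\<^bsub>Y\<^esub> f x"
  using lin by (auto simp: lin_def)

lemma f_zero [simp]: "f \<zero>\<^bsub>X\<^esub> = \<zero>\<^bsub>Y\<^esub>"
  using f_smult[of "\<zero>" "\<zero>\<^bsub>X\<^esub>"] by simp

lemma f_neg: "x \<in> carrier X \<Longrightarrow> f (\<ominus>\<^bsub>X\<^esub> x) = \<ominus>\<^bsub>Y\<^esub> f x"
  using f_add[of "\<ominus>\<^bsub>X\<^esub> x" x] Y.mod_neg_unique[of "f (\<ominus>\<^bsub>X\<^esub> x)" "f x"] by (simp add: X.mod_l_neg)

lemma f_minus: "x \<in> carrier X \<Longrightarrow> y \<in> carrier X \<Longrightarrow> f (x \<ominus>\<^bsub>X\<^esub> y) = f x \<ominus>\<^bsub>Y\<^esub> f y"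
  by (simp add: a_minus_def f_add f_neg)

abbreviation "ker \<equiv> {x \<in> carrier X. f x = \<zero>\<^bsub>Y\<^esub>}"

lemma ker_submodule: "submodule ker R X"
  by (auto simp: X.submodule_iff f_add f_smult)

lemma vimage_submodule: "submodule V R Y \<Longrightarrow> submodule {x \<in> carrier X. f x \<in> V} R X"
  by (auto simp: X.submodule_iff Y.submodule_iff f_add f_smult)

lemma image_submodule: "submodule U R X \<Longrightarrow> submodule (f ` U) R Y"
proof -
  assume "submodule U R X"
  note U = X.submoduleD[OF this]
  show ?thesis
  proof (rule Y.submoduleI)
    show "f ` U \<subseteq> carrier Y" using U by auto
    show "\<zero>\<^bsub>Y\<^esub> \<in> f ` U" using U(2) f_zero by (metis imageI)
    show "x \<oplus>\<^bsub>Y\<^esub> y \<in> f ` U" if "x \<in> f ` U" "y \<in> f ` U" for x y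
      using that U by (auto simp: f_add[symmetric] subset_iff)
    show "a \<odot>\<^bsub>Y\<^esub> x \<in> f ` U" if "a \<in> carrier R" "x \<in> f ` U" for a x
      using that U by (auto simp: f_smult[symmetric] subset_iff)
  qed
qed

lemma inj_onI_ker: "ker \<subseteq> {\<zero>\<^bsub>X\<^esub>} \<Longrightarrow> inj_on f (carrier X)"
proof (rule inj_onI)
  fix x y assume *: "ker \<subseteq> {\<zero>\<^bsub>X\<^esub>}" "x \<in> carrier X" "y \<in> carrier X" "f x = f y"
  then have "f (x \<ominus>\<^bsub>X\<^esub> y) = \<zero>\<^bsub>Y\<^esub>" by (simp add: f_minus Y.mod_minus_self)
  then have "x \<ominus>\<^bsub>X\<^esub> y = \<zero>\<^bsub>X\<^esub>" using * by auto
  then show "x = y" using * X.mod_minus_add[of x y] by simp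
qed

end

lemma lin_mapI: "left_module R X \<Longrightarrow> left_module R Y \<Longrightarrow> lin R X Y f \<Longrightarrow> lin_map R X Y f"
  by (intro lin_map.intro lin_map_axioms.intro)

lemma lhom_zero:
  assumes "left_module R X" "left_module R Y" "f \<in> lhom R X Y"
  shows "f \<zero>\<^bsub>X\<^esub> = \<zero>\<^bsub>Y\<^esub>"
  using assms by (intro lin_map.f_zero[of R] lin_mapI lhom_lin)

definition mod_chain :: "('a, 'r) ring_scheme \<Rightarrow> ('a, 'm) module \<Rightarrow> nat \<Rightarrow> (nat \<Rightarrow> 'm set) \<Rightarrow> bool" where
  "mod_chain R M n U \<longleftrightarrow> (\<forall>i\<le>n. submodule (U i) R M) \<and> (\<forall>i<n. U i \<subset> U (Suc i))"

lemma mod_chain_truncate: "mod_chain R M n U \<Longrightarrow> m \<le> n \<Longrightarrow> mod_chain R M m U"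
  by (auto simp: mod_chain_def)

lemma mod_length_ge: "mod_chain R M n U \<Longrightarrow> enat n \<le> mod_length R M"
  unfolding mod_length_def mod_chain_def by (intro Sup_upper) blast

text \<open>A chain can be cut off at any step, so no length below the supremum is missed.\<close>
lemma (in left_module) mod_length_ge_iff: "enat n \<le> mod_length R M \<longleftrightarrow> (\<exists>U. mod_chain R M n U)"
proof
  assume n: "enat n \<le> mod_length R M"
  show "\<exists>U. mod_chain R M n U"
  proof (rule ccontr)
    assume no: "\<nexists>U. mod_chain R M n U"
    moreover have "mod_chain R M 0 (\<lambda>_. carrier M)"
      by (simp add: mod_chain_def submodule_carrier)
    ultimately obtain k where k: "n = Suc k" by (metis not0_implies_Suc)
    have "mod_length R M \<le> enat k"
      unfolding mod_length_def
    proof (rule Sup_least, safe)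
      fix m U assume "\<forall>i\<le>m. submodule (U i) R M" "\<forall>i<m. U i \<subset> U (Suc i)"
      then have "mod_chain R M m U" by (simp add: mod_chain_def)
      then have "\<not> n \<le> m" using no mod_chain_truncate by blast
      then show "enat m \<le> enat k" using k by simp
    qed
    with n k show False by (metis enat_ord_simps(1) not_less_eq_eq order.refl order.trans)
  qed
qed (auto intro: mod_length_ge)

text \<open>Leaving out the repetitions turns a weakly increasing chain into a chain with as many steps as
  there are strict inclusions.\<close>
lemma (in left_module) weak_chain:
  assumes "\<And>i. i \<le> n \<Longrightarrow> submodule (V i) R M" "\<And>i. i < n \<Longrightarrow> V i \<subseteq> V (Suc i)"
  shows "\<exists>U. mod_chain R M (card {i. i < n \<and> V i \<noteq> V (Suc i)}) U \<and>
             U (card {i. i < n \<and> V i \<noteq> V (Suc i)}) = V n"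
  using assms
proof (induction n)
  case 0
  then show ?case by (auto simp: mod_chain_def)
next
  case (Suc n)
  define c where "c = card {i. i < n \<and> V i \<noteq> V (Suc i)}"
  have "\<exists>U. mod_chain R M c U \<and> U c = V n"
    unfolding c_def by (rule Suc.IH) (use Suc.prems in auto)
  then obtain U where U: "mod_chain R M c U" "U c = V n" by blast
  show ?case
  proof (cases "V n = V (Suc n)")
    case True
    then have "{i. i < Suc n \<and> V i \<noteq> V (Suc i)} = {i. i < n \<and> V i \<noteq> V (Suc i)}"
      using less_Suc_eq by auto
    then show ?thesis using U True by (auto simp: c_def)
  next
    case False
    then have "{i. i < Suc n \<and> V i \<noteq> V (Suc i)} = insert n {i. i < n \<and> V i \<noteq> V (Suc i)}"
      using less_Suc_eq by auto
    then have "card {i. i < Suc n \<and> V i \<noteq> V (Suc i)} = Suc c"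
      by (simp add: c_def)
    moreover have "mod_chain R M (Suc c) (U(Suc c := V (Suc n)))"
      using U Suc.prems False unfolding mod_chain_def by (auto simp: le_Suc_eq less_Suc_eq)
    ultimately show ?thesis
      by (simp only:) (rule exI[of _ "U(Suc c := V (Suc n))"], simp only: fun_upd_same)
  qed
qed

lemma enat_le_plus_split:
  assumes "enat n \<le> x + y"
  obtains p q where "n = p + q" "enat p \<le> x" "enat q \<le> y"
proof (cases x)
  case (enat m)
  show ?thesis
  proof (cases "n \<le> m")
    case True
    then show ?thesis using that[of n 0] enat by (simp add: zero_enat_def[symmetric])
  next
    case False
    show ?thesis using that[of m "n - m"] enat False assms by (cases y) auto
  qed
next
  case infinity
  then show ?thesis using that[of n 0] by (simp add: zero_enat_def[symmetric])
qed

lemma enat_leI: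
  assumes "\<And>n. enat n \<le> x \<Longrightarrow> enat n \<le> y"
  shows "x \<le> y"
proof (cases x)
  case infinity
  then have "enat (Suc k) \<le> y" for k using assms by simp
  then have "y = \<infinity>" by (cases y) (metis enat_ord_simps(1) not_less_eq_eq order.refl, simp)
  then show ?thesis by simp
qed (use assms in auto)

lemma enat_eqI: "(\<And>n. enat n \<le> x \<longleftrightarrow> enat n \<le> y) \<Longrightarrow> x = (y::enat)"
  by (rule antisym; rule enat_leI) auto

context lin_map
begin

text \<open>A chain in the kernel continues with the preimages of a chain in the image. Conversely, a
  chain in \<open>X\<close> is intersected with the kernel and mapped to the image; by the modular law no step becomes
  an equality in both.\<close>
lemma length_rank_nullity:
  "mod_length R X = mod_length R (sub_mod X ker) + mod_length R (sub_mod Y (f ` carrier X))"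
proof (rule enat_eqI)
  fix n
  have im: "submodule (f ` carrier X) R Y" using X.submodule_carrier by (rule image_submodule)
  interpret Ke: left_module R "sub_mod X ker" using X.sub_mod_left_module[OF ker_submodule] .
  interpret Im: left_module R "sub_mod Y (f ` carrier X)" using Y.sub_mod_left_module[OF im] .
  have 1: "enat p + enat q \<le> mod_length R X"
    if pq: "enat p \<le> mod_length R (sub_mod X ker)" "enat q \<le> mod_length R (sub_mod Y (f ` carrier X))" for p q
  proof -
    obtain U where U: "mod_chain R (sub_mod X ker) p U"
      using pq(1) unfolding Ke.mod_length_ge_iff by blast
    obtain W where W: "mod_chain R (sub_mod Y (f ` carrier X)) q W"
      using pq(2) unfolding Im.mod_length_ge_iff by blast
    define V where "V i = (if i \<le> p then U i else {x \<in> carrier X. f x \<in> W (i - p)})" for i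
    have "mod_chain R X (p + q) V"
      unfolding mod_chain_def
    proof safe
      fix i assume i: "i \<le> p + q"
      show "submodule (V i) R X"
      proof (cases "i \<le> p")
        case True
        then show ?thesis using U X.submodule_trans[OF ker_submodule] by (auto simp: V_def mod_chain_def)
      next
        case False
        then show ?thesis using W i by (auto simp: V_def mod_chain_def intro!: vimage_submodule Y.submodule_trans[OF im])
      qed
    next
      fix i assume i: "i < p + q"
      consider "i < p" | "i = p" | "i > p" by linarith
      then have "V i \<subset> V (Suc i)"
      proof cases
        case 1
        then show ?thesis using U by (auto simp: V_def mod_chain_def)
      next
        case 2
        have W01: "W 0 \<subset> W (Suc 0)" using W 2 i by (auto simp: mod_chain_def)
        have W0: "submodule (W 0) R Y" "submodule (W 1) R Y" "W 1 \<subseteq> f ` carrier X"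
          using W 2 i Y.submodule_sub_mod[OF im] by (auto simp: mod_chain_def)
        have Up: "U p \<subseteq> ker" using U X.submodule_sub_mod[OF ker_submodule] by (auto simp: mod_chain_def)
        have sub: "U p \<subseteq> {x \<in> carrier X. f x \<in> W 0}" using Up Y.submoduleD(2)[OF W0(1)] by auto
        obtain y where y: "y \<in> W 1" "y \<notin> W 0" using W01 by auto
        then obtain x where "x \<in> carrier X" "f x = y" using W0(3) by auto
        then show ?thesis using 2 sub y W01 by (auto simp: V_def)
      next
        case 3
        then have s: "W (i - p) \<subset> W (Suc (i - p))" "Suc i - p = Suc (i - p)"
          using W i by (auto simp: mod_chain_def)
        then obtain y where y: "y \<in> W (Suc (i-p))" "y \<notin> W (i-p)" by auto
        have "W (Suc (i-p)) \<subseteq> f ` carrier X"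
          using W 3 i Y.submodule_sub_mod[OF im] by (auto simp: mod_chain_def)
        then obtain x where "x \<in> carrier X" "f x = y" using y by auto
        then show ?thesis using 3 s y by (auto simp: V_def)
      qed
      then show "x \<in> V i \<Longrightarrow> x \<in> V (Suc i)" "V i = V (Suc i) \<Longrightarrow> False" for x by auto
    qed
    then show ?thesis using mod_length_ge by fastforce
  qed
  have 2: "enat n \<le> mod_length R (sub_mod X ker) + mod_length R (sub_mod Y (f ` carrier X))"
    if n: "enat n \<le> mod_length R X"
  proof -
    obtain U where U: "mod_chain R X n U" using n unfolding X.mod_length_ge_iff by blast
    define V where "V i = U i \<inter> ker" for i
    define W where "W i = f ` U i" for i
    have sU: "submodule (U i) R X" if "i \<le> n" for i using U that by (auto simp: mod_chain_def)
    have mU: "U i \<subset> U (Suc i)" if "i < n" for i using U that by (auto simp: mod_chain_def)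
    define c where "c = {i. i < n \<and> V i \<noteq> V (Suc i)}"
    define d where "d = {i. i < n \<and> W i \<noteq> W (Suc i)}"
    have c: "enat (card c) \<le> mod_length R (sub_mod X ker)"
    proof -
      have "\<exists>U. mod_chain R (sub_mod X ker) (card c) U \<and> U (card c) = V n"
        unfolding c_def
      proof (rule Ke.weak_chain)
        show "submodule (V i) R (sub_mod X ker)" if "i \<le> n" for i
          using sU[OF that] X.submodule_Int[OF _ ker_submodule]
          by (simp add: X.submodule_sub_mod[OF ker_submodule] V_def)
        show "V i \<subseteq> V (Suc i)" if "i < n" for i using mU[OF that] by (auto simp: V_def)
      qed
      then show ?thesis using mod_length_ge by blast
    qed
    have d: "enat (card d) \<le> mod_length R (sub_mod Y (f ` carrier X))"
    proof -
      have "\<exists>U. mod_chain R (sub_mod Y (f ` carrier X)) (card d) U \<and> U (card d) = W n"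
        unfolding d_def
      proof (rule Im.weak_chain)
        show "submodule (W i) R (sub_mod Y (f ` carrier X))" if "i \<le> n" for i
          using image_submodule[OF sU[OF that]] X.submoduleD(1)[OF sU[OF that]]
          by (auto simp: Y.submodule_sub_mod[OF im] W_def)
        show "W i \<subseteq> W (Suc i)" if "i < n" for i using mU[OF that] by (auto simp: W_def)
      qed
      then show ?thesis using mod_length_ge by blast
    qed
    have "{..<n} \<subseteq> c \<union> d"
    proof (rule ccontr)
      assume "\<not> {..<n} \<subseteq> c \<union> d"
      then obtain i where i: "i < n" "V i = V (Suc i)" "W i = W (Suc i)" by (auto simp: c_def d_def)
      then obtain x where x: "x \<in> U (Suc i)" "x \<notin> U i" using mU by blast
      have xX: "x \<in> carrier X" using x(1) sU[of "Suc i"] X.submoduleD(1) i by (metis Suc_leI subsetD)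
      have "f x \<in> W i" using i x by (auto simp: W_def)
      then obtain y where y: "y \<in> U i" "f y = f x" by (auto simp: W_def)
      have yX: "y \<in> carrier X" using y(1) sU[of i] X.submoduleD(1) i by (metis less_imp_le subsetD)
      have "x \<ominus>\<^bsub>X\<^esub> y \<in> U (Suc i)"
        using x y mU[OF i(1)] i by (intro X.submoduleD(6)[OF sU]) auto
      then have "x \<ominus>\<^bsub>X\<^esub> y \<in> V (Suc i)" using y(2) xX yX by (auto simp: V_def f_minus Y.mod_minus_self)
      then have "x \<ominus>\<^bsub>X\<^esub> y \<in> U i" using i by (auto simp: V_def)
      then have "(x \<ominus>\<^bsub>X\<^esub> y) \<oplus>\<^bsub>X\<^esub> y \<in> U i" using y i by (intro X.submoduleD(3)[OF sU]) auto
      moreover have "(x \<ominus>\<^bsub>X\<^esub> y) \<oplus>\<^bsub>X\<^esub> y = x" using xX yX by (rule X.mod_minus_add)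
      ultimately show False using x by simp
    qed
    then have "n \<le> card (c \<union> d)" using card_mono[of "c \<union> d" "{..<n}"] by (auto simp: c_def d_def)
    also have "\<dots> \<le> card c + card d" by (rule card_Un_le)
    finally have "enat n \<le> enat (card c) + enat (card d)" by simp
    then show ?thesis using add_mono[OF c d] order_trans by blast
  qed
  show "enat n \<le> mod_length R X \<longleftrightarrow>
        enat n \<le> mod_length R (sub_mod X ker) + mod_length R (sub_mod Y (f ` carrier X))"
  proof
    assume "enat n \<le> mod_length R (sub_mod X ker) + mod_length R (sub_mod Y (f ` carrier X))"
    then obtain p q where pq: "n = p + q" "enat p \<le> mod_length R (sub_mod X ker)"
      "enat q \<le> mod_length R (sub_mod Y (f ` carrier X))" by (rule enat_le_plus_split)
    show "enat n \<le> mod_length R X" using 1[OF pq(2,3)] pq(1) by simp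
  qed (rule 2)
qed

end

lemma (in left_module) mod_length_eq_0_iff: "mod_length R M = 0 \<longleftrightarrow> carrier M = {\<zero>\<^bsub>M\<^esub>}"
proof
  assume 0: "mod_length R M = 0"
  show "carrier M = {\<zero>\<^bsub>M\<^esub>}"
  proof (rule ccontr)
    assume "carrier M \<noteq> {\<zero>\<^bsub>M\<^esub>}"
    then have "mod_chain R M 1 (\<lambda>i. if i = 0 then {\<zero>\<^bsub>M\<^esub>} else carrier M)"
      using M.zero_closed by (auto simp: mod_chain_def submodule_zero submodule_carrier)
    then show False using mod_length_ge[of R M 1] 0 by (simp add: zero_enat_def)
  qed
next
  assume c: "carrier M = {\<zero>\<^bsub>M\<^esub>}"
  have "\<not> enat 1 \<le> mod_length R M"
  proof
    assume "enat 1 \<le> mod_length R M"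
    then obtain U where "mod_chain R M 1 U" using mod_length_ge_iff by blast
    then have "submodule (U 0) R M" "submodule (U 1) R M" "U 0 \<subset> U 1" by (auto simp: mod_chain_def)
    then show False using c by (auto simp: submodule_iff)
  qed
  then show "mod_length R M = 0"
    by (cases "mod_length R M") (auto simp: zero_enat_def)
qed

context lin_map
begin

lemma length_image_le: "mod_length R (sub_mod Y (f ` carrier X)) \<le> mod_length R X"
  unfolding length_rank_nullity by simp

lemma length_inj:
  assumes "ker \<subseteq> {\<zero>\<^bsub>X\<^esub>}"
  shows "mod_length R X = mod_length R (sub_mod Y (f ` carrier X))"
proof -
  have "ker = {\<zero>\<^bsub>X\<^esub>}" using assms by auto
  moreover have "mod_length R (sub_mod X {\<zero>\<^bsub>X\<^esub>}) = 0"
    by (subst left_module.mod_length_eq_0_iff[OF X.sub_mod_left_module[OF X.submodule_zero]]) simp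
  ultimately show ?thesis using length_rank_nullity by simp
qed

lemma length_surj:
  assumes "f ` carrier X = carrier Y"
  shows "mod_length R X = mod_length R (sub_mod X ker) + mod_length R Y"
  using length_rank_nullity assms by simp

lemma length_vimage:
  assumes "f ` carrier X = carrier Y" "submodule V R Y"
  shows "mod_length R X + mod_length R (sub_mod Y V) = mod_length R (sub_mod X {x \<in> carrier X. f x \<in> V}) + mod_length R Y"
proof -
  let ?U = "{x \<in> carrier X. f x \<in> V}"
  have U: "submodule ?U R X" using vimage_submodule[OF assms(2)] .
  interpret U: lin_map R "sub_mod X ?U" "sub_mod Y V" f
    by (intro lin_mapI X.sub_mod_left_module Y.sub_mod_left_module U assms
      lin_sub_mod lin) auto
  have k: "U.ker = ker" using Y.submoduleD(2)[OF assms(2)] by auto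
  have "f ` ?U = V" using assms(1) Y.submoduleD(1)[OF assms(2)] by (auto 0 3)
  then have "mod_length R (sub_mod X ?U) = mod_length R (sub_mod X ker) + mod_length R (sub_mod Y V)"
    using U.length_surj k by simp
  then show ?thesis by (simp only: length_surj[OF assms(1)] ac_simps)
qed

end

lemma (in left_module) length_submodule_le:
  assumes "submodule N R M"
  shows "mod_length R (sub_mod M N) \<le> mod_length R M"
proof (rule enat_leI)
  fix n assume "enat n \<le> mod_length R (sub_mod M N)"
  then obtain U where "mod_chain R (sub_mod M N) n U"
    using left_module.mod_length_ge_iff[OF sub_mod_left_module[OF assms]] by blast
  then have "mod_chain R M n U" using submodule_trans[OF assms] by (auto simp: mod_chain_def)
  then show "enat n \<le> mod_length R M" by (rule mod_length_ge)
qed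

text \<open>A proper submodule extends any chain inside it by one more step.\<close>
lemma (in left_module) length_submodule_eqD:
  assumes N: "submodule N R M" and "mod_length R M \<le> mod_length R (sub_mod M N)" "mod_length R M \<noteq> \<infinity>"
  shows "N = carrier M"
proof (rule ccontr)
  assume "N \<noteq> carrier M"
  then have ps: "N \<subset> carrier M" using submoduleD(1)[OF N] by auto
  obtain n where n: "mod_length R M = enat n" using assms(3) by auto
  then have "enat n \<le> mod_length R (sub_mod M N)" using assms by simp
  then obtain U where U: "mod_chain R (sub_mod M N) n U"
    using left_module.mod_length_ge_iff[OF sub_mod_left_module[OF N]] by blast
  have "mod_chain R M (Suc n) (\<lambda>i. if i \<le> n then U i else carrier M)"
    using U ps submodule_carrier submodule_sub_mod[OF N]
    by (auto simp: mod_chain_def less_Suc_eq le_Suc_eq)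
  then have "enat (Suc n) \<le> enat n" using mod_length_ge n by metis
  then show False by simp
qed

subsection \<open>Quotients\<close>

context left_module
begin

lemma submodule_abelian_subgroup: "submodule N R M \<Longrightarrow> abelian_subgroup N M"
  by (rule abelian_subgroupI3)
    (auto intro!: additive_subgroup.intro submodule.axioms(1) M.abelian_group_axioms)

lemma quot_eq_iff:
  assumes N: "submodule N R M" and "x \<in> carrier M" "y \<in> carrier M"
  shows "N +>\<^bsub>M\<^esub> x = N +>\<^bsub>M\<^esub> y \<longleftrightarrow> x \<ominus>\<^bsub>M\<^esub> y \<in> N"
proof -
  interpret N: abelian_subgroup N M using submodule_abelian_subgroup[OF N] .
  have "x \<ominus>\<^bsub>M\<^esub> y \<in> N \<longleftrightarrow> x \<in> N +>\<^bsub>M\<^esub> y"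
    using N.a_rcos_module[of y x] assms by (simp add: a_minus_def)
  also have "\<dots> \<longleftrightarrow> N +>\<^bsub>M\<^esub> x = N +>\<^bsub>M\<^esub> y"
    using N.a_repr_independence'[of x y] N.a_rcos_self[of x] assms by auto
  finally show ?thesis by simp
qed

lemma quot_smult:
  assumes N: "submodule N R M" and a: "a \<in> carrier R" and x: "x \<in> carrier M"
  shows "a \<odot>\<^bsub>quot_mod M N\<^esub> (N +>\<^bsub>M\<^esub> x) = N +>\<^bsub>M\<^esub> (a \<odot>\<^bsub>M\<^esub> x)"
proof -
  interpret N: abelian_subgroup N M using submodule_abelian_subgroup[OF N] .
  have eq: "N +>\<^bsub>M\<^esub> (a \<odot>\<^bsub>M\<^esub> z) = N +>\<^bsub>M\<^esub> (a \<odot>\<^bsub>M\<^esub> x)" if "z \<in> N +>\<^bsub>M\<^esub> x" for z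
  proof -
    have z: "z \<in> carrier M" using that N.a_elemrcos_carrier x by blast
    have "z \<ominus>\<^bsub>M\<^esub> x \<in> N" using quot_eq_iff[OF N z x] N.a_repr_independence'[OF that] x by simp
    then have "a \<odot>\<^bsub>M\<^esub> (z \<ominus>\<^bsub>M\<^esub> x) \<in> N" using submoduleD(4)[OF N] a by simp
    moreover have "a \<odot>\<^bsub>M\<^esub> (z \<ominus>\<^bsub>M\<^esub> x) = a \<odot>\<^bsub>M\<^esub> z \<ominus>\<^bsub>M\<^esub> a \<odot>\<^bsub>M\<^esub> x"
      using a x z by (simp add: a_minus_def smult_r_distr smult_r_minus)
    ultimately show ?thesis using quot_eq_iff[OF N] a x z by simp
  qed
  have "(\<Union>z\<in>N +>\<^bsub>M\<^esub> x. N +>\<^bsub>M\<^esub> (a \<odot>\<^bsub>M\<^esub> z)) = (\<Union>z\<in>N +>\<^bsub>M\<^esub> x. N +>\<^bsub>M\<^esub> (a \<odot>\<^bsub>M\<^esub> x))"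
    by (rule SUP_cong[OF refl eq])
  moreover have "N +>\<^bsub>M\<^esub> x \<noteq> {}" using N.a_rcos_self[OF x] by auto
  ultimately show ?thesis by (simp add: quot_mod_def)
qed

lemma quot_add:
  assumes N: "submodule N R M" and "x \<in> carrier M" "y \<in> carrier M"
  shows "(N +>\<^bsub>M\<^esub> x) \<oplus>\<^bsub>quot_mod M N\<^esub> (N +>\<^bsub>M\<^esub> y) = N +>\<^bsub>M\<^esub> (x \<oplus>\<^bsub>M\<^esub> y)"
  using abelian_subgroup.a_rcos_sum[OF submodule_abelian_subgroup[OF N]] assms by (simp add: quot_mod_def)

lemma quot_carrier: "carrier (quot_mod M N) = (\<lambda>x. N +>\<^bsub>M\<^esub> x) ` carrier M"
  by (auto simp: quot_mod_def A_RCOSETS_def')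

lemma quot_zero: "submodule N R M \<Longrightarrow> \<zero>\<^bsub>quot_mod M N\<^esub> = N +>\<^bsub>M\<^esub> \<zero>\<^bsub>M\<^esub>"
  by (simp add: quot_mod_def M.a_coset_add_zero submoduleD(1))

lemma quot_left_module:
  assumes N: "submodule N R M"
  shows "left_module R (quot_mod M N)"
proof (rule left_moduleI, goal_cases)
  case (7 x)
  then obtain y where y: "y \<in> carrier M" "x = N +>\<^bsub>M\<^esub> y" by (auto simp: quot_carrier)
  then show ?case
    by (intro bexI[of _ "N +>\<^bsub>M\<^esub> (\<ominus>\<^bsub>M\<^esub> y)"]) (auto simp: quot_carrier quot_add[OF N] quot_zero[OF N] M.l_neg)
qed (use R.ring_axioms in \<open>auto simp: quot_carrier quot_add[OF N] quot_smult[OF N] quot_zero[OF N]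
  smult_l_distr smult_r_distr smult_assoc mod_a_ac\<close>)

lemma quot_lin:
  assumes N: "submodule N R M"
  shows "lin R M (quot_mod M N) (\<lambda>x. N +>\<^bsub>M\<^esub> x)"
  by (auto simp: lin_def quot_carrier quot_add[OF N] quot_smult[OF N])

lemma quot_eq_zero_iff:
  assumes N: "submodule N R M" and x: "x \<in> carrier M"
  shows "N +>\<^bsub>M\<^esub> x = \<zero>\<^bsub>quot_mod M N\<^esub> \<longleftrightarrow> x \<in> N"
  using quot_eq_iff[OF N x, of "\<zero>\<^bsub>M\<^esub>"] x by (simp add: quot_zero[OF N] a_minus_def mod_neg_zero)

lemma quot_lin_map:
  assumes N: "submodule N R M"
  shows "lin_map R M (quot_mod M N) (\<lambda>x. N +>\<^bsub>M\<^esub> x)"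
  using quot_lin[OF N] quot_left_module[OF N] left_module_axioms
  by (auto intro!: lin_mapI)

lemma length_quot:
  assumes N: "submodule N R M"
  shows "mod_length R M = mod_length R (sub_mod M N) + mod_length R (quot_mod M N)"
proof -
  interpret q: lin_map R M "quot_mod M N" "\<lambda>x. N +>\<^bsub>M\<^esub> x" using quot_lin_map[OF N] .
  have "q.ker = N" using submoduleD(1)[OF N] quot_eq_zero_iff[OF N] by auto
  then show ?thesis using q.length_surj by (simp add: quot_carrier)
qed

end

section \<open>Linear combinations and powers of a module\<close>

primrec lc :: "('a, 'm) module \<Rightarrow> nat \<Rightarrow> (nat \<Rightarrow> 'a) \<Rightarrow> (nat \<Rightarrow> 'm) \<Rightarrow> 'm" where
  "lc M 0 a x = \<zero>\<^bsub>M\<^esub>"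
| "lc M (Suc n) a x = lc M n a x \<oplus>\<^bsub>M\<^esub> (a n \<odot>\<^bsub>M\<^esub> x n)"

lemma lc_cong:
  "(\<And>i. i < n \<Longrightarrow> a i = b i) \<Longrightarrow> (\<And>i. i < n \<Longrightarrow> x i = y i) \<Longrightarrow> lc M n a x = lc M n b y"
  by (induction n) auto

context left_module
begin

lemma lc_closed [simp]:
  "(\<And>i. i < n \<Longrightarrow> a i \<in> carrier R) \<Longrightarrow> (\<And>i. i < n \<Longrightarrow> x i \<in> carrier M) \<Longrightarrow> lc M n a x \<in> carrier M"
  by (induction n) auto

lemma lc_in_submodule:
  assumes "submodule U R M" "\<And>i. i < n \<Longrightarrow> a i \<odot>\<^bsub>M\<^esub> x i \<in> U"
  shows "lc M n a x \<in> U"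
  using assms(2) by (induction n) (auto intro: submoduleD(2,3)[OF assms(1)])

lemma lc_eq_zeroI:
  "(\<And>i. i < n \<Longrightarrow> a i \<odot>\<^bsub>M\<^esub> x i = \<zero>\<^bsub>M\<^esub>) \<Longrightarrow> lc M n a x = \<zero>\<^bsub>M\<^esub>"
  using lc_in_submodule[OF submodule_zero, of n a x] by auto

lemma lc_add:
  assumes "\<And>i. i < n \<Longrightarrow> a i \<in> carrier R" "\<And>i. i < n \<Longrightarrow> b i \<in> carrier R" "\<And>i. i < n \<Longrightarrow> x i \<in> carrier M"
  shows "lc M n (\<lambda>i. a i \<oplus> b i) x = lc M n a x \<oplus>\<^bsub>M\<^esub> lc M n b x"
  using assms by (induction n) (auto simp: smult_l_distr mod_a_ac)

lemma lc_smult: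
  assumes "r \<in> carrier R" "\<And>i. i < n \<Longrightarrow> a i \<in> carrier R" "\<And>i. i < n \<Longrightarrow> x i \<in> carrier M"
  shows "lc M n (\<lambda>i. r \<otimes> a i) x = r \<odot>\<^bsub>M\<^esub> lc M n a x"
  using assms by (induction n) (auto simp: smult_r_distr smult_assoc)

lemma lc_diff:
  assumes "\<And>i. i < n \<Longrightarrow> a i \<in> carrier R" "\<And>i. i < n \<Longrightarrow> b i \<in> carrier R" "\<And>i. i < n \<Longrightarrow> x i \<in> carrier M"
  shows "lc M n (\<lambda>i. a i \<ominus> b i) x = lc M n a x \<ominus>\<^bsub>M\<^esub> lc M n b x"
proof -
  have "lc M n (\<lambda>i. a i \<ominus> b i) x \<oplus>\<^bsub>M\<^esub> lc M n b x = lc M n a x"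
    using assms by (subst lc_add[symmetric]) (auto simp: a_minus_def R.a_assoc R.l_neg intro!: lc_cong)
  moreover have "lc M n (\<lambda>i. a i \<ominus> b i) x \<in> carrier M" "lc M n b x \<in> carrier M" using assms by auto
  ultimately show ?thesis by (metis M.add.inv_solve_right a_minus_def lc_closed assms(1,3))
qed

lemma lc_add_right:
  assumes "\<And>i. i < n \<Longrightarrow> a i \<in> carrier R" "\<And>i. i < n \<Longrightarrow> x i \<in> carrier M" "\<And>i. i < n \<Longrightarrow> y i \<in> carrier M"
  shows "lc M n a (\<lambda>i. x i \<oplus>\<^bsub>M\<^esub> y i) = lc M n a x \<oplus>\<^bsub>M\<^esub> lc M n a y"
  using assms by (induction n) (auto simp: smult_r_distr mod_a_ac)

lemma lc_split:
  assumes "j < n" "\<And>i. i < n \<Longrightarrow> a i \<in> carrier R" "\<And>i. i < n \<Longrightarrow> x i \<in> carrier M"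
  shows "lc M n a x = (a j \<odot>\<^bsub>M\<^esub> x j) \<oplus>\<^bsub>M\<^esub> lc M n (\<lambda>i. if i = j then \<zero> else a i) x"
  using assms
proof (induction n)
  case (Suc n)
  show ?case
  proof (cases "j = n")
    case True
    have "lc M n (\<lambda>i. if i = n then \<zero> else a i) x = lc M n a x" by (rule lc_cong) auto
    then show ?thesis using Suc.prems True by (simp add: mod_a_ac)
  next
    case False
    then have "lc M n a x = (a j \<odot>\<^bsub>M\<^esub> x j) \<oplus>\<^bsub>M\<^esub> lc M n (\<lambda>i. if i = j then \<zero> else a i) x"
      using Suc by simp
    moreover have "lc M n (\<lambda>i. if i = j then \<zero> else a i) x \<in> carrier M" using Suc.prems by auto
    ultimately show ?thesis using Suc.prems False by (simp add: M.a_assoc)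
  qed
qed simp

lemma lc_single:
  assumes "j < n" "\<And>i. i < n \<Longrightarrow> a i \<in> carrier R" "\<And>i. i < n \<Longrightarrow> x i \<in> carrier M"
    "\<And>i. i < n \<Longrightarrow> i \<noteq> j \<Longrightarrow> a i \<odot>\<^bsub>M\<^esub> x i = \<zero>\<^bsub>M\<^esub>"
  shows "lc M n a x = a j \<odot>\<^bsub>M\<^esub> x j"
proof -
  have "lc M n (\<lambda>i. if i = j then \<zero> else a i) x = \<zero>\<^bsub>M\<^esub>" by (rule lc_eq_zeroI) (use assms in auto)
  then show ?thesis using lc_split[of j n a x] assms by simp
qed

lemma lc_unit:
  assumes "j < n" "r \<in> carrier R" "\<And>i. i < n \<Longrightarrow> x i \<in> carrier M"
  shows "lc M n (\<lambda>i. if i = j then r else \<zero>) x = r \<odot>\<^bsub>M\<^esub> x j"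
  using assms by (subst lc_single[where j = j]) auto

end

lemma (in lin_map) f_lc:
  assumes "\<And>i. i < n \<Longrightarrow> a i \<in> carrier R" "\<And>i. i < n \<Longrightarrow> x i \<in> carrier X"
  shows "f (lc X n a x) = lc Y n a (\<lambda>i. f (x i))"
  using assms by (induction n) (auto simp: f_add f_smult)

definition pow_mod :: "('a, 'm) module \<Rightarrow> nat \<Rightarrow> ('a, nat \<Rightarrow> 'm) module" where
  "pow_mod X n = \<lparr>carrier = {..<n} \<rightarrow>\<^sub>E carrier X, monoid.mult = undefined, one = undefined,
     ring.zero = (\<lambda>i\<in>{..<n}. \<zero>\<^bsub>X\<^esub>), add = (\<lambda>f g. \<lambda>i\<in>{..<n}. f i \<oplus>\<^bsub>X\<^esub> g i),
     smult = (\<lambda>a f. \<lambda>i\<in>{..<n}. a \<odot>\<^bsub>X\<^esub> f i)\<rparr>"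

abbreviation free_mod :: "('a, 'r) ring_scheme \<Rightarrow> nat \<Rightarrow> ('a, nat \<Rightarrow> 'a) module" where
  "free_mod R n \<equiv> pow_mod (reg_mod R) n"

lemma pow_mod_simps [simp]:
  "carrier (pow_mod X n) = {..<n} \<rightarrow>\<^sub>E carrier X" "zero (pow_mod X n) = (\<lambda>i\<in>{..<n}. \<zero>\<^bsub>X\<^esub>)"
  "add (pow_mod X n) = (\<lambda>f g. \<lambda>i\<in>{..<n}. f i \<oplus>\<^bsub>X\<^esub> g i)"
  "smult (pow_mod X n) = (\<lambda>a f. \<lambda>i\<in>{..<n}. a \<odot>\<^bsub>X\<^esub> f i)"
  by (simp_all add: pow_mod_def)

lemma sub_mod_pow_mod: "sub_mod (pow_mod X n) ({..<n} \<rightarrow>\<^sub>E I) = pow_mod (sub_mod X I) n"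
  by (simp add: sub_mod_def pow_mod_def)

lemma pow_mod_left_module:
  assumes "left_module R X"
  shows "left_module R (pow_mod X n)"
proof -
  interpret X: left_module R X by fact
  show ?thesis
  proof (rule left_moduleI, goal_cases)
    case (12 x)
    have "\<one>\<^bsub>R\<^esub> \<odot>\<^bsub>X\<^esub> x i = x i" if "i < n" for i using 12 that by (intro X.smult_one) auto
    then show ?case using 12 by (auto simp: PiE_iff extensional_def fun_eq_iff)
  next
    case (7 x)
    then have "(\<lambda>i\<in>{..<n}. \<ominus>\<^bsub>X\<^esub> x i) \<in> carrier (pow_mod X n)" by (auto simp: PiE_mem)
    moreover have "(\<lambda>i\<in>{..<n}. \<ominus>\<^bsub>X\<^esub> x i) \<oplus>\<^bsub>pow_mod X n\<^esub> x = \<zero>\<^bsub>pow_mod X n\<^esub>"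
      using 7 by (simp, intro restrict_ext) (simp add: PiE_iff X.mod_l_neg)
    ultimately show ?case by blast
  next
    case (6 x)
    have "\<zero>\<^bsub>X\<^esub> \<oplus>\<^bsub>X\<^esub> x i = x i" if "i < n" for i using 6 that by (intro X.M.l_zero) auto
    then show ?case using 6 by (auto simp: PiE_iff extensional_def fun_eq_iff)
  qed (auto simp: X.R.ring_axioms PiE_iff X.smult_l_distr X.smult_r_distr X.smult_assoc X.mod_a_ac
      fun_eq_iff)
qed

context left_module
begin

lemma pow_submodule:
  assumes "submodule I R M"
  shows "submodule ({..<n} \<rightarrow>\<^sub>E I) R (pow_mod M n)"
proof -
  interpret P: left_module R "pow_mod M n" by (rule pow_mod_left_module) (rule left_module_axioms)
  show ?thesis
    using submoduleD[OF assms] by (intro P.submoduleI) (auto simp: PiE_mem PiE_iff subset_iff)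
qed

lemma length_pow: "mod_length R (pow_mod M n) = enat n * mod_length R M"
proof (induction n)
  case 0
  interpret P: left_module R "pow_mod M 0" by (rule pow_mod_left_module) (rule left_module_axioms)
  have "mod_length R (pow_mod M 0) = 0"
    by (subst P.mod_length_eq_0_iff) auto
  then show ?case by (simp add: zero_enat_def[symmetric])
next
  case (Suc n)
  let ?r = "\<lambda>f. restrict f {..<n}"
  interpret r: lin_map R "pow_mod M (Suc n)" "pow_mod M n" ?r
  proof (intro lin_mapI pow_mod_left_module left_module_axioms)
    show "lin R (pow_mod M (Suc n)) (pow_mod M n) ?r"
      unfolding lin_def by (intro conjI ballI funcsetI) (auto simp: fun_eq_iff restrict_def PiE_iff extensional_def)
  qed
  have "?r ` carrier (pow_mod M (Suc n)) = carrier (pow_mod M n)"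
  proof (intro equalityI subsetI)
    fix g assume g: "g \<in> carrier (pow_mod M n)"
    show "g \<in> ?r ` carrier (pow_mod M (Suc n))"
    proof (rule image_eqI)
      show "g = ?r (\<lambda>i\<in>{..<Suc n}. if i < n then g i else \<zero>\<^bsub>M\<^esub>)"
        using g by (auto simp: PiE_iff extensional_def fun_eq_iff)
      show "(\<lambda>i\<in>{..<Suc n}. if i < n then g i else \<zero>\<^bsub>M\<^esub>) \<in> carrier (pow_mod M (Suc n))"
        using g by (auto simp: PiE_iff)
    qed
  qed (use r.f_closed in blast)
  note r.length_surj[OF this]
  moreover
  have ks: "submodule r.ker R (pow_mod M (Suc n))" by (rule r.ker_submodule)
  interpret e: lin_map R "sub_mod (pow_mod M (Suc n)) r.ker" M "\<lambda>f. f n"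
    by (intro lin_mapI r.X.sub_mod_left_module[OF ks] left_module_axioms)
      (auto simp: lin_def)
  have "mod_length R (sub_mod (pow_mod M (Suc n)) r.ker) = mod_length R (sub_mod M ((\<lambda>f. f n) ` r.ker))"
  proof (subst e.length_inj)
    show "{f \<in> carrier (sub_mod (pow_mod M (Suc n)) r.ker). f n = \<zero>\<^bsub>M\<^esub>}
        \<subseteq> {\<zero>\<^bsub>sub_mod (pow_mod M (Suc n)) r.ker\<^esub>}"
    proof
      fix f assume "f \<in> {f \<in> carrier (sub_mod (pow_mod M (Suc n)) r.ker). f n = \<zero>\<^bsub>M\<^esub>}"
      then have f: "f \<in> {..<Suc n} \<rightarrow>\<^sub>E carrier M" "restrict f {..<n} = (\<lambda>i\<in>{..<n}. \<zero>\<^bsub>M\<^esub>)" "f n = \<zero>\<^bsub>M\<^esub>"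
        by auto
      have "f i = \<zero>\<^bsub>M\<^esub>" if "i < Suc n" for i
        using f(3) fun_cong[OF f(2), of i] that by (auto simp: less_Suc_eq)
      then have "f = (\<lambda>i\<in>{..<Suc n}. \<zero>\<^bsub>M\<^esub>)"
        using f(1) by (auto simp: fun_eq_iff PiE_iff extensional_def)
      then show "f \<in> {\<zero>\<^bsub>sub_mod (pow_mod M (Suc n)) r.ker\<^esub>}" by simp
    qed
  qed simp
  moreover have "(\<lambda>f. f n) ` r.ker = carrier M"
  proof (intro equalityI subsetI)
    fix m assume m: "m \<in> carrier M"
    show "m \<in> (\<lambda>f. f n) ` r.ker"
      by (rule image_eqI[of _ _ "\<lambda>i\<in>{..<Suc n}. if i = n then m else \<zero>\<^bsub>M\<^esub>"])
        (use m in \<open>auto intro!: restrict_ext\<close>)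
  qed auto
  ultimately have "mod_length R (pow_mod M (Suc n)) = mod_length R M + enat n * mod_length R M"
    using Suc by simp
  then show ?case
    by (cases "mod_length R M") (auto simp: zero_enat_def)
qed

lemma lc_pow:
  assumes "j < m"
  shows "(lc (pow_mod M m) n a b) j = lc M n a (\<lambda>i. b i j)"
  using assms by (induction n) auto

lemma lc_lin: 
  assumes "\<And>i. i < n \<Longrightarrow> x i \<in> carrier M"
  shows "lin R (free_mod R n) M (\<lambda>c. lc M n c x)"
  unfolding lin_def
proof (intro conjI ballI funcsetI)
  fix c d assume cd: "c \<in> carrier (free_mod R n)" "d \<in> carrier (free_mod R n)"
  have cd': "\<And>i. i < n \<Longrightarrow> c i \<in> carrier R" "\<And>i. i < n \<Longrightarrow> d i \<in> carrier R" using cd by auto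
  show "lc M n c x \<in> carrier M" using cd' assms by simp
  have "lc M n (c \<oplus>\<^bsub>free_mod R n\<^esub> d) x = lc M n (\<lambda>i. c i \<oplus> d i) x"
    by (rule lc_cong) auto
  then show "lc M n (c \<oplus>\<^bsub>free_mod R n\<^esub> d) x = lc M n c x \<oplus>\<^bsub>M\<^esub> lc M n d x"
    using cd' assms by (simp add: lc_add)
next
  fix r c assume rc: "r \<in> carrier R" "c \<in> carrier (free_mod R n)"
  then have c: "\<And>i. i < n \<Longrightarrow> c i \<in> carrier R" by auto
  have "lc M n (r \<odot>\<^bsub>free_mod R n\<^esub> c) x = lc M n (\<lambda>i. r \<otimes> c i) x"
    by (rule lc_cong) auto
  then show "lc M n (r \<odot>\<^bsub>free_mod R n\<^esub> c) x = r \<odot>\<^bsub>M\<^esub> lc M n c x"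
    using rc c assms by (simp add: lc_smult)
qed

lemma lc_lin_map: 
  assumes "\<And>i. i < n \<Longrightarrow> x i \<in> carrier M"
  shows "lin_map R (free_mod R n) M (\<lambda>c. lc M n c x)"
  by (intro lin_mapI lc_lin pow_mod_left_module reg_mod_left_module
      left_module_axioms assms R.ring_axioms)

end

section \<open>Generators\<close>

definition gens :: "('a, 'r) ring_scheme \<Rightarrow> ('a, 'm) module \<Rightarrow> nat \<Rightarrow> (nat \<Rightarrow> 'm) \<Rightarrow> bool" where
  "gens R X n x \<longleftrightarrow> (\<forall>i<n. x i \<in> carrier X) \<and>
     (\<forall>y\<in>carrier X. \<exists>a. (\<forall>i<n. a i \<in> carrier R) \<and> y = lc X n a x)"

text \<open>The relations between the generators have coefficients in \<open>J\<close>: for the radical \<open>J\<close> of a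
  local ring this says that the map from the free module is a projective cover.\<close>
definition mingen :: "('a, 'r) ring_scheme \<Rightarrow> 'a set \<Rightarrow> ('a, 'm) module \<Rightarrow> nat \<Rightarrow> (nat \<Rightarrow> 'm) \<Rightarrow> bool" where
  "mingen R J X n x \<longleftrightarrow> gens R X n x \<and>
     (\<forall>a. (\<forall>i<n. a i \<in> carrier R) \<and> lc X n a x = \<zero>\<^bsub>X\<^esub> \<longrightarrow> (\<forall>i<n. a i \<in> J))"

lemma gensD: "gens R X n x \<Longrightarrow> i < n \<Longrightarrow> x i \<in> carrier X"
  by (simp add: gens_def)

lemma gensE:
  assumes "gens R X n x" "y \<in> carrier X"
  obtains a where "\<And>i. i < n \<Longrightarrow> a i \<in> carrier R" "y = lc X n a x"
  using assms unfolding gens_def by blast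

lemma mingenD:
  "mingen R J X n x \<Longrightarrow> (\<And>i. i < n \<Longrightarrow> a i \<in> carrier R) \<Longrightarrow> lc X n a x = \<zero>\<^bsub>X\<^esub> \<Longrightarrow> i < n \<Longrightarrow> a i \<in> J"
  by (auto simp: mingen_def)

lemma mingen_gens: "mingen R J X n x \<Longrightarrow> gens R X n x"
  by (simp add: mingen_def)

definition lspan :: "('a, 'r) ring_scheme \<Rightarrow> ('a, 'm) module \<Rightarrow> nat \<Rightarrow> (nat \<Rightarrow> 'm) \<Rightarrow> 'm set" where
  "lspan R X n x = (\<lambda>c. lc X n c x) ` carrier (free_mod R n)"

context left_module
begin

lemma mem_span_iff: "y \<in> lspan R M n x \<longleftrightarrow> (\<exists>a. (\<forall>i<n. a i \<in> carrier R) \<and> y = lc M n a x)"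
proof
  assume "\<exists>a. (\<forall>i<n. a i \<in> carrier R) \<and> y = lc M n a x"
  then obtain a where "\<forall>i<n. a i \<in> carrier R" "y = lc M n a x" by blast
  then show "y \<in> lspan R M n x"
    unfolding lspan_def by (intro image_eqI[of _ _ "restrict a {..<n}"]) (auto intro: lc_cong)
qed (auto simp: lspan_def PiE_mem)

lemma span_submodule:
  assumes "\<And>i. i < n \<Longrightarrow> x i \<in> carrier M"
  shows "submodule (lspan R M n x) R M"
proof -
  interpret l: lin_map R "free_mod R n" M "\<lambda>c. lc M n c x" using assms by (rule lc_lin_map)
  show ?thesis unfolding lspan_def by (rule l.image_submodule) (rule l.X.submodule_carrier)
qed

lemma span_superset: "i < n \<Longrightarrow> (\<And>i. i < n \<Longrightarrow> x i \<in> carrier M) \<Longrightarrow> x i \<in> lspan R M n x"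
  unfolding mem_span_iff
  by (rule exI[of _ "\<lambda>j. if j = i then \<one> else \<zero>"]) (simp add: lc_unit)

lemma gens_iff_span: "gens R M n x \<longleftrightarrow> (\<forall>i<n. x i \<in> carrier M) \<and> lspan R M n x = carrier M"
proof -
  have "lspan R M n x \<subseteq> carrier M" if "\<forall>i<n. x i \<in> carrier M"
    using span_submodule that submoduleD(1) by blast
  then show ?thesis unfolding gens_def using mem_span_iff[of _ n x] by blast
qed

lemma gens_image: "gens R M n x \<Longrightarrow> (\<lambda>c. lc M n c x) ` carrier (free_mod R n) = carrier M"
  using gens_iff_span by (simp add: lspan_def)

lemma span_least:
  assumes "submodule U R M" "\<And>i. i < n \<Longrightarrow> x i \<in> U"
  shows "lspan R M n x \<subseteq> U"
  using assms by (auto simp: mem_span_iff intro!: lc_in_submodule submoduleD(4))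

text \<open>Generators outside the span of the previous ones produce a chain of spans, which cannot be longer
  than the module.\<close>
lemma finite_length_gens:
  assumes "mod_length R M \<noteq> \<infinity>"
  obtains n x where "gens R M n x"
proof -
  obtain l where l: "mod_length R M = enat l" using assms by auto
  define S where "S = {n. \<exists>x. (\<forall>i<n. x i \<in> carrier M) \<and> mod_chain R M n (\<lambda>i. lspan R M i x)}"
  have 0: "0 \<in> S" by (auto simp: S_def mod_chain_def intro!: span_submodule)
  have bd: "S \<subseteq> {..l}" using mod_length_ge l by (fastforce simp: S_def)
  then have fin: "finite S" using finite_subset by blast
  define n where "n = Max S"
  have "n \<in> S" unfolding n_def using fin 0 by (intro Max_in) auto
  then obtain x where x: "\<forall>i<n. x i \<in> carrier M" "mod_chain R M n (\<lambda>i. lspan R M i x)" by (auto simp: S_def)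
  have "lspan R M n x = carrier M"
  proof (rule ccontr)
    assume "lspan R M n x \<noteq> carrier M"
    then obtain y where y: "y \<in> carrier M" "y \<notin> lspan R M n x"
      using span_submodule[of n x] x(1) submoduleD(1) by blast
    let ?x = "x(n := y)"
    have eq: "lspan R M i ?x = lspan R M i x" if "i \<le> n" for i
    proof -
      have "lc M i c ?x = lc M i c x" for c using that by (intro lc_cong) auto
      then show ?thesis by (simp add: lspan_def)
    qed
    have cl: "\<forall>i<Suc n. ?x i \<in> carrier M" using x(1) y by (auto simp: less_Suc_eq)
    have sm: "submodule (lspan R M (Suc n) ?x) R M" using cl by (intro span_submodule) blast
    have "lspan R M n x \<subset> lspan R M (Suc n) ?x"
    proof
      show "lspan R M n x \<subseteq> lspan R M (Suc n) ?x"
      proof (rule span_least)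
        show "submodule (lspan R M (Suc n) ?x) R M" using cl by (intro span_submodule) blast
        show "x i \<in> lspan R M (Suc n) ?x" if "i < n" for i
          using span_superset[of i "Suc n" ?x] cl that by auto
      qed
      show "lspan R M n x \<noteq> lspan R M (Suc n) ?x" using span_superset[of n "Suc n" ?x] cl y by auto
    qed
    then have "mod_chain R M (Suc n) (\<lambda>i. lspan R M i ?x)"
      using x(2) eq sm unfolding mod_chain_def
      by (simp add: le_Suc_eq less_Suc_eq)
    then have "Suc n \<in> S" using cl by (auto simp: S_def intro!: exI[of _ ?x])
    then have "Suc n \<le> n" unfolding n_def using fin by (intro Max_ge)
    then show False by simp
  qed
  then show thesis using that x(1) gens_iff_span by blast
qed

text \<open>The value at a linear combination does not depend on its coefficients, because two choices differ by
  a relation.\<close>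
lemma lhom_of_gens:
  assumes N: "left_module R N" and g: "gens R M n x" and v: "\<And>i. i < n \<Longrightarrow> v i \<in> carrier N"
    and rel: "\<And>a. (\<And>i. i < n \<Longrightarrow> a i \<in> carrier R) \<Longrightarrow> lc M n a x = \<zero>\<^bsub>M\<^esub> \<Longrightarrow> lc N n a v = \<zero>\<^bsub>N\<^esub>"
  obtains f where "f \<in> lhom R M N" "\<And>i. i < n \<Longrightarrow> f (x i) = v i"
    "\<And>a. (\<And>i. i < n \<Longrightarrow> a i \<in> carrier R) \<Longrightarrow> f (lc M n a x) = lc N n a v"
proof -
  interpret N: left_module R N by fact
  note xM = gensD[OF g]
  have ex: "\<exists>a. (\<forall>i<n. a i \<in> carrier R) \<and> y = lc M n a x" if "y \<in> carrier M" for y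
    using g that by (auto simp: gens_def)
  define co where "co y = (SOME a. (\<forall>i<n. a i \<in> carrier R) \<and> y = lc M n a x)" for y
  have co: "(\<forall>i<n. co y i \<in> carrier R) \<and> y = lc M n (co y) x" if "y \<in> carrier M" for y
    unfolding co_def using someI_ex[OF ex[OF that]] .
  define f where "f = (\<lambda>y\<in>carrier M. lc N n (co y) v)"
  have f: "f (lc M n a x) = lc N n a v" if a: "\<And>i. i < n \<Longrightarrow> a i \<in> carrier R" for a
  proof -
    let ?y = "lc M n a x"
    have y: "?y \<in> carrier M" using a xM by simp
    have "lc M n (\<lambda>i. a i \<ominus> co ?y i) x = ?y \<ominus>\<^bsub>M\<^esub> lc M n (co ?y) x"
      using a xM co[OF y] by (intro lc_diff) auto
    also have "\<dots> = \<zero>\<^bsub>M\<^esub>" using co[OF y] y by (metis mod_minus_self)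
    finally have "lc N n (\<lambda>i. a i \<ominus> co ?y i) v = \<zero>\<^bsub>N\<^esub>" using rel a co[OF y] by simp
    moreover have "lc N n (\<lambda>i. a i \<ominus> co ?y i) v = lc N n a v \<ominus>\<^bsub>N\<^esub> lc N n (co ?y) v"
      using a v co[OF y] by (intro N.lc_diff) auto
    moreover have "lc N n a v \<in> carrier N" "lc N n (co ?y) v \<in> carrier N" using a v co[OF y] by auto
    ultimately have "lc N n a v = lc N n (co ?y) v"
      using N.mod_minus_add by (metis N.M.l_zero)
    then show ?thesis using y by (simp add: f_def)
  qed
  have "f \<in> lhom R M N"
    unfolding lhom_def
  proof (intro CollectI conjI ballI)
    show "f \<in> carrier M \<rightarrow>\<^sub>E carrier N"
      using co v by (auto simp: f_def)
  next
    fix y z assume yz: "y \<in> carrier M" "z \<in> carrier M"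
    have "y \<oplus>\<^bsub>M\<^esub> z = lc M n (\<lambda>i. co y i \<oplus> co z i) x"
      using co[OF yz(1)] co[OF yz(2)] xM by (subst lc_add) auto
    then have "f (y \<oplus>\<^bsub>M\<^esub> z) = lc N n (\<lambda>i. co y i \<oplus> co z i) v"
      using f co[OF yz(1)] co[OF yz(2)] by simp
    also have "\<dots> = f y \<oplus>\<^bsub>N\<^esub> f z"
      using co[OF yz(1)] co[OF yz(2)] v yz by (simp add: N.lc_add f_def)
    finally show "f (y \<oplus>\<^bsub>M\<^esub> z) = f y \<oplus>\<^bsub>N\<^esub> f z" .
  next
    fix r y assume ry: "r \<in> carrier R" "y \<in> carrier M"
    have "r \<odot>\<^bsub>M\<^esub> y = lc M n (\<lambda>i. r \<otimes> co y i) x"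
      using co[OF ry(2)] ry xM by (subst lc_smult) auto
    then have "f (r \<odot>\<^bsub>M\<^esub> y) = lc N n (\<lambda>i. r \<otimes> co y i) v"
      using f co[OF ry(2)] ry by simp
    also have "\<dots> = r \<odot>\<^bsub>N\<^esub> f y"
      using co[OF ry(2)] v ry by (simp add: N.lc_smult f_def)
    finally show "f (r \<odot>\<^bsub>M\<^esub> y) = r \<odot>\<^bsub>N\<^esub> f y" .
  qed
  moreover have "f (x i) = v i" if "i < n" for i
    using f[of "\<lambda>j. if j = i then \<one> else \<zero>"] that xM v by (simp add: lc_unit N.lc_unit)
  ultimately show thesis using that f by blast
qed

end

lemma lhom_eqI:
  assumes "left_module R X" "left_module R Y" "gens R X n x" "f \<in> lhom R X Y" "g \<in> lhom R X Y"
    and eq: "\<And>i. i < n \<Longrightarrow> f (x i) = g (x i)"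
  shows "f = g"
proof (rule extensionalityI[of f "carrier X"])
  show "f \<in> extensional (carrier X)" "g \<in> extensional (carrier X)" using assms by (auto simp: lhom_iff)
  interpret f: lin_map R X Y f using assms by (auto intro!: lin_mapI lhom_lin)
  interpret g: lin_map R X Y g using assms by (auto intro!: lin_mapI lhom_lin)
  fix y assume "y \<in> carrier X"
  then obtain a where a: "\<And>i. i < n \<Longrightarrow> a i \<in> carrier R" "y = lc X n a x" using assms(3) by (auto elim: gensE)
  then show "f y = g y" using gensD[OF assms(3)] by (auto simp: f.f_lc g.f_lc eq intro: lc_cong)
qed

section \<open>Local rings with nilpotent radical\<close>

text \<open>The assumptions are elementary and symmetric in left and right, so that they pass to the
  opposite ring at once. They make \<open>J\<close> the radical of a local ring with \<open>J\<^sup>3 = 0\<close>.\<close>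
locale rad_ring = ring R for R (structure) +
  fixes J :: "'a set"
  assumes J_carr: "x \<in> J \<Longrightarrow> x \<in> carrier R"
    and J_zero: "\<zero> \<in> J"
    and J_add: "x \<in> J \<Longrightarrow> y \<in> J \<Longrightarrow> x \<oplus> y \<in> J"
    and J_lmult: "r \<in> carrier R \<Longrightarrow> x \<in> J \<Longrightarrow> r \<otimes> x \<in> J"
    and J_rmult: "r \<in> carrier R \<Longrightarrow> x \<in> J \<Longrightarrow> x \<otimes> r \<in> J"
    and J_inv: "x \<in> carrier R \<Longrightarrow> x \<notin> J \<Longrightarrow> \<exists>y\<in>carrier R. y \<otimes> x = \<one> \<and> x \<otimes> y = \<one>"
    and J_cube: "x \<in> J \<Longrightarrow> y \<in> J \<Longrightarrow> z \<in> J \<Longrightarrow> x \<otimes> (y \<otimes> z) = \<zero>"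
    and one_notin_J: "\<one> \<notin> J"
begin

lemma J_submodule: "submodule J R (reg_mod R)"
  by (rule left_module.submoduleI[OF reg_mod_left_module[OF ring_axioms]])
    (auto simp: J_carr J_zero J_add J_lmult)

lemma J_neg: "x \<in> J \<Longrightarrow> \<ominus> x \<in> J"
  using J_lmult[of "\<ominus> \<one>" x] J_carr[of x] by (simp add: l_minus)

lemma smult_J_submodule:
  assumes X: "left_module R X" and N: "N \<subseteq> carrier X" "N \<noteq> {}"
    "\<And>r x. r \<in> carrier R \<Longrightarrow> x \<in> N \<Longrightarrow> r \<odot>\<^bsub>X\<^esub> x \<in> N"
  shows "submodule (ideal_smult X J N) R X"
proof -
  interpret X: left_module R X by fact
  have c: "w \<in> carrier X" if "w \<in> ideal_smult X J N" for w
    using that by induction (use N in \<open>auto simp: J_carr subset_iff\<close>)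
  show ?thesis
  proof (rule X.submoduleI)
    show "ideal_smult X J N \<subseteq> carrier X" using c by auto
    obtain x where x: "x \<in> N" using N by auto
    then show "\<zero>\<^bsub>X\<^esub> \<in> ideal_smult X J N"
      using ideal_smult.smult[OF J_zero x, of X] N by (simp add: subset_iff)
    show "x \<oplus>\<^bsub>X\<^esub> y \<in> ideal_smult X J N" if "x \<in> ideal_smult X J N" "y \<in> ideal_smult X J N" for x y
      using that by (rule ideal_smult.add)
    show "r \<odot>\<^bsub>X\<^esub> w \<in> ideal_smult X J N" if r: "r \<in> carrier R" and w: "w \<in> ideal_smult X J N" for r w
      using w
    proof induction
      case (smult j x)
      then have "r \<odot>\<^bsub>X\<^esub> (j \<odot>\<^bsub>X\<^esub> x) = (r \<otimes> j) \<odot>\<^bsub>X\<^esub> x"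
        using r N by (simp add: X.smult_assoc J_carr subset_iff)
      then show ?case using smult r by (simp add: ideal_smult.smult J_lmult)
    next
      case (add x y)
      then show ?case using r c by (simp add: X.smult_r_distr ideal_smult.add)
    qed
  qed
qed

abbreviation rad :: "('a, 'm) module \<Rightarrow> 'm set" where
  "rad X \<equiv> ideal_smult X J (carrier X)"

lemma rad_submodule: "left_module R X \<Longrightarrow> submodule (rad X) R X"
  by (rule smult_J_submodule) (auto simp: left_module.smult_closed dest: left_module.submodule_zero
      left_module.submoduleD(1))

lemma smult_J_least:
  assumes "left_module R X" "submodule U R X" "\<And>j x. j \<in> J \<Longrightarrow> x \<in> N \<Longrightarrow> j \<odot>\<^bsub>X\<^esub> x \<in> U"
  shows "ideal_smult X J N \<subseteq> U"
proof
  interpret X: left_module R X by fact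
  fix w assume "w \<in> ideal_smult X J N"
  then show "w \<in> U" by induction (auto intro: assms X.submoduleD(3)[OF assms(2)])
qed

lemma rad_gens_iff:
  assumes X: "left_module R X" and g: "gens R X n x"
  shows "y \<in> rad X \<longleftrightarrow> (\<exists>a. (\<forall>i<n. a i \<in> J) \<and> y = lc X n a x)"
proof
  interpret X: left_module R X by fact
  note xX = gensD[OF g]
  show "y \<in> rad X \<Longrightarrow> \<exists>a. (\<forall>i<n. a i \<in> J) \<and> y = lc X n a x"
  proof (induction rule: ideal_smult.induct)
    case (smult j y)
    then obtain a where a: "\<And>i. i < n \<Longrightarrow> a i \<in> carrier R" "y = lc X n a x" using g by (auto elim: gensE)
    then show ?case using smult xX
      by (intro exI[of _ "\<lambda>i. j \<otimes> a i"]) (auto simp: X.lc_smult J_carr J_rmult)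
  next
    case (add y z)
    then obtain a b where "\<forall>i<n. a i \<in> J" "y = lc X n a x" "\<forall>i<n. b i \<in> J" "z = lc X n b x" by blast
    then show ?case using xX
      by (intro exI[of _ "\<lambda>i. a i \<oplus> b i"]) (auto simp: X.lc_add J_carr J_add)
  qed
  assume "\<exists>a. (\<forall>i<n. a i \<in> J) \<and> y = lc X n a x"
  then obtain a where "\<forall>i<n. a i \<in> J" "y = lc X n a x" by blast
  then show "y \<in> rad X"
    using xX by (auto intro!: X.lc_in_submodule[OF rad_submodule[OF X]] ideal_smult.smult)
qed

lemma J3_smult:
  assumes X: "left_module R X" and j: "i \<in> J" "j \<in> J" and w: "w \<in> rad X"
  shows "i \<odot>\<^bsub>X\<^esub> (j \<odot>\<^bsub>X\<^esub> w) = \<zero>\<^bsub>X\<^esub>"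
  using w
proof induction
  interpret X: left_module R X by fact
  case (smult k x)
  then have "i \<odot>\<^bsub>X\<^esub> (j \<odot>\<^bsub>X\<^esub> (k \<odot>\<^bsub>X\<^esub> x)) = (i \<otimes> (j \<otimes> k)) \<odot>\<^bsub>X\<^esub> x"
    using j by (simp add: X.smult_assoc J_carr)
  then show ?case using smult j by (simp add: J_cube)
next
  interpret X: left_module R X by fact
  case (add x y)
  then have "x \<in> carrier X" "y \<in> carrier X" using X.submoduleD(1)[OF rad_submodule[OF X]] by auto
  then show ?case using add j by (simp add: X.smult_r_distr J_carr)
qed

text \<open>Substituting \<open>X = U + JX\<close> into itself moves the remainder into \<open>J\<^sup>3X = 0\<close>.\<close>
lemma nakayama:
  assumes X: "left_module R X" and U: "submodule U R X"
    and ex: "\<And>x. x \<in> carrier X \<Longrightarrow> \<exists>u\<in>U. \<exists>w\<in>rad X. x = u \<oplus>\<^bsub>X\<^esub> w"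
  shows "U = carrier X"
proof -
  interpret X: left_module R X by fact
  let ?N = "rad X"
  note Us = X.submoduleD[OF U]
  have N: "?N \<subseteq> carrier X" using X.submoduleD(1)[OF rad_submodule[OF X]] .
  have 1: "j \<odot>\<^bsub>X\<^esub> w \<in> U" if j: "j \<in> J" and w: "w \<in> ?N" for j w
    using w
  proof induction
    case (smult k x)
    obtain u v where uv: "u \<in> U" "v \<in> ?N" "x = u \<oplus>\<^bsub>X\<^esub> v" using ex smult by blast
    then have "j \<odot>\<^bsub>X\<^esub> (k \<odot>\<^bsub>X\<^esub> x) = j \<odot>\<^bsub>X\<^esub> (k \<odot>\<^bsub>X\<^esub> u) \<oplus>\<^bsub>X\<^esub> j \<odot>\<^bsub>X\<^esub> (k \<odot>\<^bsub>X\<^esub> v)"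
      using j smult N Us(1) by (simp add: X.smult_r_distr J_carr subset_iff)
    also have "\<dots> = j \<odot>\<^bsub>X\<^esub> (k \<odot>\<^bsub>X\<^esub> u)"
      using j smult uv Us(1) by (simp add: J3_smult[OF X] J_carr subset_iff)
    finally show ?case using j smult uv Us by (simp add: J_carr)
  next
    case (add x y)
    then show ?case using j N Us(3) by (simp add: X.smult_r_distr J_carr subset_iff)
  qed
  have 2: "?N \<subseteq> U"
  proof (rule smult_J_least[OF X U])
    fix j x assume jx: "j \<in> J" "x \<in> carrier X"
    obtain u v where uv: "u \<in> U" "v \<in> ?N" "x = u \<oplus>\<^bsub>X\<^esub> v" using ex jx by blast
    then have "j \<odot>\<^bsub>X\<^esub> x = j \<odot>\<^bsub>X\<^esub> u \<oplus>\<^bsub>X\<^esub> j \<odot>\<^bsub>X\<^esub> v"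
      using jx N Us(1) by (simp add: X.smult_r_distr J_carr subset_iff)
    then show "j \<odot>\<^bsub>X\<^esub> x \<in> U" using 1 jx uv Us(3,4) by (simp add: J_carr)
  qed
  show ?thesis
  proof
    show "carrier X \<subseteq> U"
    proof
      fix x assume "x \<in> carrier X"
      then obtain u w where "u \<in> U" "w \<in> ?N" "x = u \<oplus>\<^bsub>X\<^esub> w" using ex by blast
      then show "x \<in> U" using 2 Us(3) by auto
    qed
  qed (rule Us(1))
qed

text \<open>A redundant generator is one that occurs in some relation with an invertible coefficient,
  so a generating set of least size is minimal.\<close>
lemma mingen_exists:
  assumes X: "left_module R X" and g: "gens R X n x"
  obtains m y where "mingen R J X m y"
proof -
  interpret X: left_module R X by fact
  define m where "m = (LEAST m. \<exists>y. gens R X m y)"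
  have "\<exists>y. gens R X m y" unfolding m_def by (rule LeastI[of _ n]) (use g in blast)
  then obtain y where y: "gens R X m y" by blast
  have least: "m \<le> k" if "gens R X k z" for k z unfolding m_def using that by (intro Least_le) blast
  note yX = gensD[OF y]
  have "a j \<in> J" if a: "\<forall>i<m. a i \<in> carrier R" and z: "lc X m a y = \<zero>\<^bsub>X\<^esub>" and j: "j < m" for a j
  proof (rule ccontr)
    assume nJ: "a j \<notin> J"
    obtain v where v: "v \<in> carrier R" "v \<otimes> a j = \<one>" using J_inv nJ a j by blast
    obtain k where k: "m = Suc k" using j by (cases m) auto
    define z where "z i = (if i = j then y k else y i)" for i
    have zX: "z i \<in> carrier X" if "i < k" for i using yX k that by (auto simp: z_def)
    have S: "submodule (lspan R X k z) R X" using zX by (rule X.span_submodule)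
    have 1: "y i \<in> lspan R X k z" if i: "i < m" "i \<noteq> j" for i
    proof (cases "i = k")
      case True
      then have "j < k" using i j k by auto
      then show ?thesis using X.span_superset[of j k z] zX True by (simp add: z_def)
    next
      case False
      then show ?thesis using X.span_superset[of i k z] zX i k by (simp add: z_def)
    qed
    let ?b = "\<lambda>i. if i = j then \<zero> else a i"
    have "lc X m ?b y \<in> lspan R X k z"
    proof (rule X.lc_in_submodule[OF S])
      show "?b i \<odot>\<^bsub>X\<^esub> y i \<in> lspan R X k z" if "i < m" for i
        using 1[OF that] that yX a X.submoduleD(2,4)[OF S] by auto
    qed
    moreover have "a j \<odot>\<^bsub>X\<^esub> y j = \<ominus>\<^bsub>X\<^esub> lc X m ?b y"
    proof -
      have c: "lc X m ?b y \<in> carrier X" "a j \<odot>\<^bsub>X\<^esub> y j \<in> carrier X" using a yX j by auto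
      have "(a j \<odot>\<^bsub>X\<^esub> y j) \<oplus>\<^bsub>X\<^esub> lc X m ?b y = \<zero>\<^bsub>X\<^esub>"
        using X.lc_split[OF j, of a y] a yX z by simp
      then show ?thesis using X.mod_neg_unique c by metis
    qed
    ultimately have "a j \<odot>\<^bsub>X\<^esub> y j \<in> lspan R X k z" using X.submoduleD(5)[OF S] by simp
    then have "v \<odot>\<^bsub>X\<^esub> (a j \<odot>\<^bsub>X\<^esub> y j) \<in> lspan R X k z" using X.submoduleD(4)[OF S] v by simp
    then have "y j \<in> lspan R X k z"
      using v a j yX by (simp flip: X.smult_assoc)
    then have "lspan R X m y \<subseteq> lspan R X k z" using 1 by (intro X.span_least[OF S]) metis
    then have "gens R X k z" using y zX X.gens_iff_span X.submoduleD(1)[OF S] by blast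
    then show False using least k by fastforce
  qed
  then have "mingen R J X m y" using y unfolding mingen_def by blast
  then show thesis by (rule that)
qed

text \<open>A nonzero submodule of \<open>R/J\<close> contains the class of a unit.\<close>
lemma length_R_mod_J: "mod_length R (quot_mod (reg_mod R) J) = 1"
proof -
  interpret A: left_module R "reg_mod R" using reg_mod_left_module[OF ring_axioms] .
  interpret Q: left_module R "quot_mod (reg_mod R) J" using A.quot_left_module[OF J_submodule] .
  have nz: "J +>\<^bsub>reg_mod R\<^esub> x \<noteq> \<zero>\<^bsub>quot_mod (reg_mod R) J\<^esub>" if "x \<in> carrier R" "x \<notin> J" for x
    using A.quot_eq_zero_iff[OF J_submodule] that by simp
  have "mod_length R (quot_mod (reg_mod R) J) \<noteq> 0"
    unfolding Q.mod_length_eq_0_iff using nz[of \<one>] one_notin_J A.quot_carrier[of J] by auto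
  moreover have "\<not> enat 2 \<le> mod_length R (quot_mod (reg_mod R) J)"
  proof
    assume "enat 2 \<le> mod_length R (quot_mod (reg_mod R) J)"
    then obtain U where U: "mod_chain R (quot_mod (reg_mod R) J) 2 U" unfolding Q.mod_length_ge_iff by blast
    then have U1: "submodule (U 1) R (quot_mod (reg_mod R) J)" and U0: "submodule (U 0) R (quot_mod (reg_mod R) J)"
      and U2: "submodule (U 2) R (quot_mod (reg_mod R) J)" and lt: "U 0 \<subset> U 1" "U 1 \<subset> U 2"
      by (auto simp: mod_chain_def numeral_2_eq_2)
    then obtain z where z: "z \<in> U 1" "z \<noteq> \<zero>\<^bsub>quot_mod (reg_mod R) J\<^esub>" using Q.submoduleD(2)[OF U0] by blast
    then obtain x where x: "x \<in> carrier R" "z = J +>\<^bsub>reg_mod R\<^esub> x"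
      using Q.submoduleD(1)[OF U1] A.quot_carrier[of J] by auto
    then have "x \<notin> J" using z A.quot_eq_zero_iff[OF J_submodule] by simp
    then obtain y where y: "y \<in> carrier R" "y \<otimes> x = \<one>" using J_inv x by blast
    have "J +>\<^bsub>reg_mod R\<^esub> r \<in> U 1" if r: "r \<in> carrier R" for r
    proof -
      have "(r \<otimes> y) \<odot>\<^bsub>quot_mod (reg_mod R) J\<^esub> z \<in> U 1" using Q.submoduleD(4)[OF U1] z r y by simp
      then show ?thesis using x y r A.quot_smult[OF J_submodule] by (simp add: m_assoc)
    qed
    then have "carrier (quot_mod (reg_mod R) J) \<subseteq> U 1" using A.quot_carrier[of J] by auto
    then show False using lt(2) Q.submoduleD(1)[OF U2] by auto
  qed
  ultimately show ?thesis
    by (cases "mod_length R (quot_mod (reg_mod R) J)") (auto simp: zero_enat_def one_enat_def)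
qed

lemma length_R: "mod_length R (reg_mod R) = mod_length R (sub_mod (reg_mod R) J) + 1"
  using left_module.length_quot[OF reg_mod_left_module[OF ring_axioms] J_submodule] length_R_mod_J by simp

lemma mingen_rad_iff:
  assumes X: "left_module R X" and g: "mingen R J X n x" and a: "\<And>i. i < n \<Longrightarrow> a i \<in> carrier R"
  shows "lc X n a x \<in> rad X \<longleftrightarrow> (\<forall>i<n. a i \<in> J)"
proof
  interpret X: left_module R X by fact
  note gg = mingen_gens[OF g]
  note xX = gensD[OF gg]
  assume "lc X n a x \<in> rad X"
  then obtain b where b: "\<forall>i<n. b i \<in> J" "lc X n a x = lc X n b x" using rad_gens_iff[OF X gg] by blast
  have "lc X n (\<lambda>i. a i \<ominus> b i) x = lc X n a x \<ominus>\<^bsub>X\<^esub> lc X n b x"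
    using a b(1) xX by (intro X.lc_diff) (auto simp: J_carr)
  also have "\<dots> = \<zero>\<^bsub>X\<^esub>"
    unfolding b(2) using b(1) xX by (intro X.mod_minus_self X.lc_closed) (auto simp: J_carr)
  finally have d: "a i \<ominus> b i \<in> J" if "i < n" for i
    using that a b(1) mingenD[OF g, of "\<lambda>i. a i \<ominus> b i" i] by (simp add: J_carr)
  show "\<forall>i<n. a i \<in> J"
  proof safe
    fix i assume i: "i < n"
    have "(a i \<ominus> b i) \<oplus> b i = a i"
      using a b(1) i by (simp add: J_carr a_minus_def a_assoc l_neg)
    then show "a i \<in> J" using J_add[OF d[OF i], of "b i"] b(1) i by simp
  qed
next
  assume "\<forall>i<n. a i \<in> J"
  then show "lc X n a x \<in> rad X" using rad_gens_iff[OF X mingen_gens[OF g]] by blast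
qed

text \<open>The free module on the generators maps onto the top of \<open>X\<close>, and minimality makes the kernel
  \<open>J\<^sup>n\<close>.\<close>
lemma length_top:
  assumes X: "left_module R X" and g: "mingen R J X n x" and fin: "mod_length R (reg_mod R) \<noteq> \<infinity>"
  shows "mod_length R (quot_mod X (rad X)) = enat n"
proof -
  interpret X: left_module R X by fact
  interpret A: left_module R "reg_mod R" using reg_mod_left_module[OF ring_axioms] .
  let ?N = "rad X"
  have N: "submodule ?N R X" by (rule rad_submodule[OF X])
  note gg = mingen_gens[OF g]
  note xX = gensD[OF gg]
  interpret l: lin_map R "free_mod R n" X "\<lambda>c. lc X n c x" using xX by (rule X.lc_lin_map)
  interpret q: lin_map R X "quot_mod X ?N" "\<lambda>y. ?N +>\<^bsub>X\<^esub> y" using X.quot_lin_map[OF N] .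
  interpret c: lin_map R "free_mod R n" "quot_mod X ?N" "\<lambda>c. ?N +>\<^bsub>X\<^esub> lc X n c x"
    by (intro lin_mapI l.X.left_module_axioms q.Y.left_module_axioms
        lin_comp[OF l.lin q.lin])
  have "(\<lambda>c. ?N +>\<^bsub>X\<^esub> lc X n c x) ` carrier (free_mod R n)
      = (\<lambda>y. ?N +>\<^bsub>X\<^esub> y) ` ((\<lambda>c. lc X n c x) ` carrier (free_mod R n))" by (simp add: image_image)
  also have "\<dots> = carrier (quot_mod X ?N)" unfolding X.gens_image[OF gg] X.quot_carrier ..
  finally have "mod_length R (free_mod R n) = mod_length R (sub_mod (free_mod R n) c.ker) + mod_length R (quot_mod X ?N)"
    by (rule c.length_surj)
  moreover have "c.ker = {..<n} \<rightarrow>\<^sub>E J"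
  proof -
    have "c \<in> c.ker \<longleftrightarrow> c \<in> {..<n} \<rightarrow>\<^sub>E J" for c
    proof -
      have "c \<in> c.ker \<longleftrightarrow> c \<in> {..<n} \<rightarrow>\<^sub>E carrier R \<and> lc X n c x \<in> ?N"
      proof (cases "c \<in> {..<n} \<rightarrow>\<^sub>E carrier R")
        case True
        then have "lc X n c x \<in> carrier X" using xX by (auto simp: PiE_iff)
        then show ?thesis using X.quot_eq_zero_iff[OF N] True by simp
      qed simp
      also have "\<dots> \<longleftrightarrow> c \<in> {..<n} \<rightarrow>\<^sub>E J"
        using mingen_rad_iff[OF X g, of c] by (auto simp: PiE_iff J_carr)
      finally show ?thesis .
    qed
    then show ?thesis by blast
  qed
  ultimately have "enat n * mod_length R (reg_mod R) = enat n * mod_length R (sub_mod (reg_mod R) J)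
      + mod_length R (quot_mod X ?N)"
    using A.length_pow left_module.length_pow[OF A.sub_mod_left_module[OF J_submodule]]
    by (simp add: sub_mod_pow_mod)
  then show ?thesis using length_R fin
    by (cases "mod_length R (sub_mod (reg_mod R) J)"; cases "mod_length R (quot_mod X ?N)")
      (auto simp: one_enat_def)
qed

end

section \<open>Free and projective modules\<close>

definition basis :: "('a, 'r) ring_scheme \<Rightarrow> ('a, 'm) module \<Rightarrow> nat \<Rightarrow> (nat \<Rightarrow> 'm) \<Rightarrow> bool" where
  "basis R P n b \<longleftrightarrow> gens R P n b \<and>
     (\<forall>a. (\<forall>i<n. a i \<in> carrier R) \<and> lc P n a b = \<zero>\<^bsub>P\<^esub> \<longrightarrow> (\<forall>i<n. a i = \<zero>\<^bsub>R\<^esub>))"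

definition unit_vec :: "('a, 'r) ring_scheme \<Rightarrow> nat \<Rightarrow> nat \<Rightarrow> nat \<Rightarrow> 'a" where
  "unit_vec R n i = (\<lambda>j\<in>{..<n}. if j = i then \<one>\<^bsub>R\<^esub> else \<zero>\<^bsub>R\<^esub>)"

context ring
begin

lemma unit_vec_closed [simp]: "unit_vec R n i \<in> {..<n} \<rightarrow>\<^sub>E carrier R"
  by (auto simp: unit_vec_def)

lemma lc_unit_vec:
  assumes c: "\<And>i. i < n \<Longrightarrow> c i \<in> carrier R"
  shows "lc (free_mod R n) n c (unit_vec R n) = restrict c {..<n}"
proof (rule extensionalityI[of _ "{..<n}"])
  interpret A: left_module R "reg_mod R" using reg_mod_left_module[OF ring_axioms] .
  interpret F: left_module R "free_mod R n" by (rule pow_mod_left_module) (rule A.left_module_axioms)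
  have "lc (free_mod R n) n c (unit_vec R n) \<in> carrier (free_mod R n)" using c by (intro F.lc_closed) simp_all
  then show "lc (free_mod R n) n c (unit_vec R n) \<in> extensional {..<n}" by (simp add: PiE_iff)
  fix j assume "j \<in> {..<n}"
  then have j: "j < n" by simp
  have "lc (free_mod R n) n c (unit_vec R n) j = lc (reg_mod R) n c (\<lambda>i. unit_vec R n i j)"
    using j by (rule A.lc_pow)
  also have "\<dots> = c j \<otimes> unit_vec R n j j"
    using A.lc_single[of j n c "\<lambda>i. unit_vec R n i j"] c j by (auto simp: unit_vec_def)
  finally show "lc (free_mod R n) n c (unit_vec R n) j = restrict c {..<n} j"
    using c j by (simp add: unit_vec_def)
qed simp

lemma free_basis: "basis R (free_mod R n) n (unit_vec R n)"
  unfolding basis_def gens_def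
proof (intro conjI allI impI ballI)
  show "unit_vec R n i \<in> carrier (free_mod R n)" for i by simp
  show "\<exists>a. (\<forall>i<n. a i \<in> carrier R) \<and> y = lc (free_mod R n) n a (unit_vec R n)"
    if "y \<in> carrier (free_mod R n)" for y
    using that by (intro exI[of _ y]) (auto simp: lc_unit_vec PiE_iff intro: extensional_restrict[symmetric])
  show "a i = \<zero>" if "(\<forall>i<n. a i \<in> carrier R) \<and> lc (free_mod R n) n a (unit_vec R n) = \<zero>\<^bsub>free_mod R n\<^esub>" "i < n" for a i
  proof -
    have "restrict a {..<n} = (\<lambda>i\<in>{..<n}. \<zero>)" using that lc_unit_vec[of n a] by simp
    from fun_cong[OF this, of i] show ?thesis using that by simp
  qed
qed

lemma basis_lhom:
  assumes P: "left_module R P" and N: "left_module R N" and b: "basis R P n b"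
    and v: "\<And>i. i < n \<Longrightarrow> v i \<in> carrier N"
  obtains f where "f \<in> lhom R P N" "\<And>i. i < n \<Longrightarrow> f (b i) = v i"
    "\<And>a. (\<And>i. i < n \<Longrightarrow> a i \<in> carrier R) \<Longrightarrow> f (lc P n a b) = lc N n a v"
proof -
  interpret N: left_module R N by fact
  show ?thesis
  proof (rule left_module.lhom_of_gens[OF P N, of n b v])
    show "gens R P n b" using b by (simp add: basis_def)
    show "lc N n a v = \<zero>\<^bsub>N\<^esub>" if "\<And>i. i < n \<Longrightarrow> a i \<in> carrier R" "lc P n a b = \<zero>\<^bsub>P\<^esub>" for a
    proof -
      have "a i = \<zero>" if "i < n" for i using b \<open>lc P n a b = \<zero>\<^bsub>P\<^esub>\<close> \<open>\<And>i. i < n \<Longrightarrow> a i \<in> carrier R\<close> that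
        by (auto simp: basis_def)
      then show ?thesis using v by (intro N.lc_eq_zeroI) simp
    qed
  qed (use v that in auto)
qed

lemma basis_coordinates:
  assumes P: "left_module R P" and b: "basis R P n b"
  obtains \<iota> where "\<And>i. i < n \<Longrightarrow> \<iota> i \<in> lhom R P (reg_mod R)"
    "\<And>a i. (\<And>i. i < n \<Longrightarrow> a i \<in> carrier R) \<Longrightarrow> i < n \<Longrightarrow> \<iota> i (lc P n a b) = a i"
    "\<And>p. p \<in> carrier P \<Longrightarrow> lc P n (\<lambda>i. \<iota> i p) b = p"
proof -
  interpret A: left_module R "reg_mod R" using reg_mod_left_module[OF ring_axioms] .
  have "\<exists>f. f \<in> lhom R P (reg_mod R) \<and>
      (\<forall>a. (\<forall>i<n. a i \<in> carrier R) \<longrightarrow> f (lc P n a b) = lc (reg_mod R) n a (\<lambda>i. if i = j then \<one> else \<zero>))" for j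
    by (rule basis_lhom[OF P A.left_module_axioms b, of "\<lambda>i. if i = j then \<one> else \<zero>"]) auto
  then obtain \<iota> where i: "\<And>j. \<iota> j \<in> lhom R P (reg_mod R)"
    "\<And>j a. (\<forall>i<n. a i \<in> carrier R) \<Longrightarrow> \<iota> j (lc P n a b) = lc (reg_mod R) n a (\<lambda>i. if i = j then \<one> else \<zero>)"
    by metis
  have *: "\<iota> j (lc P n a b) = a j" if a: "\<And>i. i < n \<Longrightarrow> a i \<in> carrier R" and j: "j < n" for a j
    using i(2)[of a j] A.lc_single[of j n a "\<lambda>i. if i = j then \<one> else \<zero>"] a j by simp
  moreover have "lc P n (\<lambda>i. \<iota> i p) b = p" if p: "p \<in> carrier P" for p
  proof -
    obtain a where a: "\<And>i. i < n \<Longrightarrow> a i \<in> carrier R" "p = lc P n a b" using b p by (auto simp: basis_def elim: gensE)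
    then show ?thesis using * by (auto intro: lc_cong)
  qed
  ultimately show thesis using i(1) that by blast
qed

end

context rad_ring
begin

lemma basis_length:
  assumes P: "left_module R P" and b: "basis R P n b"
  shows "mod_length R P = enat n * mod_length R (reg_mod R)"
proof -
  interpret P: left_module R P by fact
  interpret A: left_module R "reg_mod R" using reg_mod_left_module[OF ring_axioms] .
  have g: "gens R P n b" using b by (simp add: basis_def)
  interpret l: lin_map R "free_mod R n" P "\<lambda>c. lc P n c b" using gensD[OF g] by (rule P.lc_lin_map)
  have "l.ker \<subseteq> {\<zero>\<^bsub>free_mod R n\<^esub>}"
  proof
    fix c assume "c \<in> l.ker"
    then have c: "c \<in> {..<n} \<rightarrow>\<^sub>E carrier R" "lc P n c b = \<zero>\<^bsub>P\<^esub>" by auto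
    then have "\<forall>i<n. c i = \<zero>" using b by (auto simp: basis_def)
    then show "c \<in> {\<zero>\<^bsub>free_mod R n\<^esub>}" using c by (auto simp: fun_eq_iff PiE_iff extensional_def)
  qed
  then show ?thesis using l.length_inj P.gens_image[OF g] A.length_pow by simp
qed

lemma basis_projective:
  assumes P: "left_module R P" and b: "basis R P n b" and fin: "mod_length R (reg_mod R) \<noteq> \<infinity>"
  shows "projective R P"
proof -
  interpret P: left_module R P by fact
  have g: "gens R P n b" using b by (simp add: basis_def)
  have "fl_module R P" using basis_length[OF P b] P fin
    by (cases "mod_length R (reg_mod R)") (auto simp: fl_module_def)
  moreover have "\<exists>h\<in>lhom R P Z. compose (carrier P) g h = f"
    if Z: "fl_module R Z" and Y: "fl_module R Y" and gg: "g \<in> lhom R Z Y" and s: "g ` carrier Z = carrier Y"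
      and f: "f \<in> lhom R P Y" for Z Y :: "('a, nat \<Rightarrow> 'a) module" and g f
  proof -
    have Zl: "left_module R Z" and Yl: "left_module R Y" using Z Y by (auto simp: fl_module_def)
    interpret f: lin_map R P Y f using P Yl lhom_lin[OF f] by (auto intro!: lin_mapI)
    interpret g: lin_map R Z Y g using Zl Yl lhom_lin[OF gg] by (auto intro!: lin_mapI)
    have "\<exists>z\<in>carrier Z. g z = f (b i)" if "i < n" for i
      using s f.f_closed[OF gensD[OF g that]] by (metis imageE)
    then obtain z where z: "\<And>i. i < n \<Longrightarrow> z i \<in> carrier Z" "\<And>i. i < n \<Longrightarrow> g (z i) = f (b i)" by metis
    obtain h where h: "h \<in> lhom R P Z" "\<And>i. i < n \<Longrightarrow> h (b i) = z i"
      by (rule basis_lhom[OF P Zl b, of z]) (use z in auto)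
    interpret h: lin_map R P Z h using P Zl lhom_lin[OF h(1)] by (auto intro!: lin_mapI)
    have "compose (carrier P) g h \<in> lhom R P Y"
      using lin_restrict[OF P lin_comp[OF h.lin g.lin]] by (simp add: compose_def)
    then have "compose (carrier P) g h = f"
      by (rule lhom_eqI[OF P Yl g _ f]) (use z h gensD[OF g] in \<open>simp add: compose_def\<close>)
    then show ?thesis using h by blast
  qed
  ultimately show ?thesis unfolding projective_def by blast
qed

text \<open>A minimal presentation of a projective module splits, so its relations form a direct
  summand inside the radical; such a summand vanishes because the radical is nilpotent.\<close>
lemma projective_basis:
  assumes pr: "projective R (P :: ('a, nat \<Rightarrow> 'a) module)" and fin: "mod_length R (reg_mod R) \<noteq> \<infinity>"
  obtains n b where "basis R P n b"
proof -
  interpret A: left_module R "reg_mod R" using reg_mod_left_module[OF ring_axioms] .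
  have fl: "fl_module R P" using pr by (simp add: projective_def)
  then have P: "left_module R P" by (simp add: fl_module_def)
  interpret P: left_module R P by fact
  obtain m x where "gens R P m x" using P.finite_length_gens fl by (auto simp: fl_module_def)
  then obtain n b where b: "mingen R J P n b" using mingen_exists[OF P] by blast
  note g = mingen_gens[OF b]
  interpret l: lin_map R "free_mod R n" P "\<lambda>c. lc P n c b" using gensD[OF g] by (rule P.lc_lin_map)
  let ?g = "restrict (\<lambda>c. lc P n c b) (carrier (free_mod R n))"
  have F: "projective R (free_mod R n)" using basis_projective[OF l.X.left_module_axioms free_basis fin] .
  have "?g \<in> lhom R (free_mod R n) P" using lin_restrict[OF l.X.left_module_axioms l.lin] .
  moreover have "?g ` carrier (free_mod R n) = carrier P" using P.gens_image[OF g] by simp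
  moreover have "restrict (\<lambda>p. p) (carrier P) \<in> lhom R P P" by (rule lin_restrict[OF P]) (simp add: lin_def)
  ultimately obtain h where h: "h \<in> lhom R P (free_mod R n)" "compose (carrier P) ?g h = restrict (\<lambda>p. p) (carrier P)"
    using pr F unfolding projective_def by blast
  interpret h: lin_map R P "free_mod R n" h
    using P l.X.left_module_axioms lhom_lin[OF h(1)] by (auto intro!: lin_mapI)
  have gh: "lc P n (h p) b = p" if "p \<in> carrier P" for p
    using fun_cong[OF h(2), of p] that h.f_closed[OF that] by (simp add: compose_def)
  define k where "k i j = unit_vec R n i j \<ominus> h (b i) j" for i j
  have hR: "h p j \<in> carrier R" if "p \<in> carrier P" "j < n" for p j
    using h.f_closed[OF that(1)] that(2) by auto
  have uR: "unit_vec R n i j \<in> carrier R" if "j < n" for i j using that by (simp add: unit_vec_def)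
  have bP: "b i \<in> carrier P" if "i < n" for i using gensD[OF g that] .
  have kR: "k i j \<in> carrier R" if "i < n" "j < n" for i j
    using hR[OF bP[OF that(1)] that(2)] uR[OF that(2)] by (simp add: k_def)
  have kJ: "k i j \<in> J" if i: "i < n" and j: "j < n" for i j
  proof -
    have "lc P n (unit_vec R n i) b = b i"
      using P.lc_unit[of i n \<one> b] i bP by (simp add: unit_vec_def cong: lc_cong)
    then have "lc P n (\<lambda>j. k i j) b = b i \<ominus>\<^bsub>P\<^esub> lc P n (h (b i)) b"
      unfolding k_def using hR[OF bP[OF i]] uR bP by (subst P.lc_diff) auto
    also have "\<dots> = \<zero>\<^bsub>P\<^esub>" using gh bP i by (simp add: P.mod_minus_self)
    finally show ?thesis using mingenD[OF b, of "k i" j] kR i j by blast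
  qed
  have "\<forall>i<n. c i = \<zero>" if cR: "\<forall>i<n. c i \<in> carrier R" and c0: "lc P n c b = \<zero>\<^bsub>P\<^esub>" for c
  proof -
    have cJ: "c i \<in> J" if "i < n" for i using mingenD[OF b] cR c0 that by blast
    have ck: "c j = lc (reg_mod R) n c (\<lambda>i. k i j)" if j: "j < n" for j
    proof -
      have "h (lc P n c b) j = lc (reg_mod R) n c (\<lambda>i. h (b i) j)"
        using h.f_lc[of n c b] cR bP A.lc_pow[OF j] by simp
      then have z: "lc (reg_mod R) n c (\<lambda>i. h (b i) j) = \<zero>" using c0 j by simp
      have eq: "k i j \<oplus> h (b i) j = unit_vec R n i j" if "i < n" for i
        using kR[OF that j] hR[OF bP[OF that] j] uR[OF j] by (simp add: k_def a_minus_def a_assoc l_neg)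
      have "lc (reg_mod R) n c (\<lambda>i. k i j) = lc (reg_mod R) n c (\<lambda>i. k i j) \<oplus> lc (reg_mod R) n c (\<lambda>i. h (b i) j)"
        using z A.lc_closed[of n c "\<lambda>i. k i j"] kR j cR by simp
      also have "\<dots> = lc (reg_mod R) n c (\<lambda>i. k i j \<oplus> h (b i) j)"
        using A.lc_add_right[of n c "\<lambda>i. k i j" "\<lambda>i. h (b i) j"] cR kR hR bP j by simp
      also have "\<dots> = lc (reg_mod R) n c (\<lambda>i. unit_vec R n i j)" using eq by (intro lc_cong) auto
      also have "\<dots> = c j"
        using A.lc_single[of j n c "\<lambda>i. unit_vec R n i j"] cR j by (auto simp: unit_vec_def)
      finally show ?thesis by simp
    qed
    have r: "lc (reg_mod R) n c (\<lambda>i. k i j) \<otimes> z = lc (reg_mod R) n c (\<lambda>i. k i j \<otimes> z)" if "j < n" "z \<in> carrier R" for j z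
    proof -
      interpret z: lin_map R "reg_mod R" "reg_mod R" "\<lambda>x. x \<otimes> z"
        by (intro lin_mapI A.left_module_axioms)
          (auto simp: lin_def l_distr m_assoc that)
      show ?thesis using z.f_lc[of n c "\<lambda>i. k i j"] cR kR that by simp
    qed
    have cz: "c j \<otimes> z = \<zero>" if "j < n" "z \<in> J" for j z
    proof -
      have "lc (reg_mod R) n c (\<lambda>i. k i j \<otimes> z) = \<zero>"
        using A.lc_eq_zeroI[of n c "\<lambda>i. k i j \<otimes> z"] cJ kJ that J_cube by simp
      then show ?thesis using r[of j z] ck[of j] that by (simp add: J_carr)
    qed
    have "lc (reg_mod R) n c (\<lambda>i. k i j) = \<zero>" if "j < n" for j
      using A.lc_eq_zeroI[of n c "\<lambda>i. k i j"] cz kJ that by simp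
    then show ?thesis using ck by simp
  qed
  then have "basis R P n b" using g by (auto simp: basis_def)
  then show thesis using that by blast
qed

end

section \<open>Syzygies, resolutions and Ext\<close>

locale artin_rad_ring = rad_ring +
  assumes fin: "mod_length R (reg_mod R) \<noteq> \<infinity>"

text \<open>\<open>Y\<close> is the syzygy of \<open>X\<close> with respect to the minimal generators \<open>x\<close>: the functions \<open>\<iota>\<close> are the
  coordinates of an embedding of \<open>Y\<close> into a free module whose image is the module of relations.
  Coordinates instead of an inclusion allow \<open>M\<close> itself to be the syzygy of \<open>\<mho>M\<close>.\<close>
definition syz ::
  "('a, 'r) ring_scheme \<Rightarrow> 'a set \<Rightarrow> ('a, 'm) module \<Rightarrow> nat \<Rightarrow> (nat \<Rightarrow> 'm) \<Rightarrow> ('a, 'n) module \<Rightarrow>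
   (nat \<Rightarrow> 'n \<Rightarrow> 'a) \<Rightarrow> bool" where
  "syz R J X n x Y \<iota> \<longleftrightarrow> left_module R X \<and> left_module R Y \<and> mingen R J X n x \<and>
     (\<forall>i<n. \<iota> i \<in> lhom R Y (reg_mod R)) \<and>
     (\<forall>y\<in>carrier Y. (\<forall>i<n. \<iota> i y = \<zero>\<^bsub>R\<^esub>) \<longrightarrow> y = \<zero>\<^bsub>Y\<^esub>) \<and>
     (\<forall>y\<in>carrier Y. lc X n (\<lambda>i. \<iota> i y) x = \<zero>\<^bsub>X\<^esub>) \<and>
     (\<forall>a. (\<forall>i<n. a i \<in> carrier R) \<and> lc X n a x = \<zero>\<^bsub>X\<^esub> \<longrightarrow> (\<exists>y\<in>carrier Y. \<forall>i<n. \<iota> i y = a i))"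

text \<open>Every map from \<open>Y\<close> to the ring extends along the embedding given by \<open>\<iota>\<close>; a map on the free
  module is a vector \<open>c\<close> of coefficients. If \<open>Y\<close> is the syzygy of \<open>X\<close>, this is \<open>Ext\<^sup>1(X, R) = 0\<close>.\<close>
definition extends ::
  "('a, 'r) ring_scheme \<Rightarrow> nat \<Rightarrow> ('a, 'n) module \<Rightarrow> (nat \<Rightarrow> 'n \<Rightarrow> 'a) \<Rightarrow> bool" where
  "extends R n Y \<iota> \<longleftrightarrow> (\<forall>f\<in>lhom R Y (reg_mod R). \<exists>c. (\<forall>i<n. c i \<in> carrier R) \<and>
     (\<forall>y\<in>carrier Y. f y = lc (reg_mod R) n (\<lambda>i. \<iota> i y) c))"

text \<open>The choice made in the definition of \<open>Omega\<close>.\<close>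
definition cover :: "('a, 'r) ring_scheme \<Rightarrow> ('a, 'm) module \<Rightarrow> ('a, nat \<Rightarrow> 'a) module \<times> ((nat \<Rightarrow> 'a) \<Rightarrow> 'm)" where
  "cover R X = (SOME (P, p). projective_cover R X P p)"

lemma Omega_cover: "Omega R X = sub_mod (fst (cover R X)) (a_kernel (fst (cover R X)) X (snd (cover R X)))"
  by (simp add: Omega_def cover_def case_prod_beta Let_def)

lemma set_addE:
  assumes "c \<in> U <+>\<^bsub>P\<^esub> K"
  obtains u k where "u \<in> U" "k \<in> K" "c = u \<oplus>\<^bsub>P\<^esub> k"
  using assms by (auto simp: set_add_def')

context artin_rad_ring
begin

lemma minimal_cover:
  assumes X: "left_module R X" and g: "mingen R J X n x"
  shows "projective_cover R X (free_mod R n) (restrict (\<lambda>c. lc X n c x) (carrier (free_mod R n)))"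
proof -
  interpret X: left_module R X by fact
  note gg = mingen_gens[OF g]
  interpret l: lin_map R "free_mod R n" X "\<lambda>c. lc X n c x" using gensD[OF gg] by (rule X.lc_lin_map)
  have F: "left_module R (free_mod R n)" by (rule l.X.left_module_axioms)
  let ?p = "restrict (\<lambda>c. lc X n c x) (carrier (free_mod R n))"
  have "U = carrier (free_mod R n)"
    if U: "submodule U R (free_mod R n)"
      and s: "U <+>\<^bsub>free_mod R n\<^esub> a_kernel (free_mod R n) X ?p = carrier (free_mod R n)" for U
  proof (rule nakayama[OF F U])
    fix c assume "c \<in> carrier (free_mod R n)"
    then have "c \<in> U <+>\<^bsub>free_mod R n\<^esub> a_kernel (free_mod R n) X ?p" by (simp only: s)
    then obtain u w where uw: "u \<in> U" "w \<in> a_kernel (free_mod R n) X ?p" "c = u \<oplus>\<^bsub>free_mod R n\<^esub> w"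
      by (rule set_addE)
    have w: "w \<in> {..<n} \<rightarrow>\<^sub>E carrier R" "lc X n w x = \<zero>\<^bsub>X\<^esub>"
      using uw(2) by (simp_all add: a_kernel_def' split: if_splits)
    then have "\<forall>i<n. w i \<in> J" using mingenD[OF g, of w] by auto
    moreover have "w = lc (free_mod R n) n w (unit_vec R n)"
      using w by (subst lc_unit_vec) (auto simp: PiE_iff extensional_restrict)
    ultimately have "w \<in> rad (free_mod R n)"
      using rad_gens_iff[OF F, of n "unit_vec R n" w] free_basis[of n] by (auto simp: basis_def)
    then show "\<exists>u\<in>U. \<exists>w\<in>rad (free_mod R n). c = u \<oplus>\<^bsub>free_mod R n\<^esub> w"
      using uw by blast
  qed
  then show ?thesis
    unfolding projective_cover_def
    using basis_projective[OF F free_basis fin] lin_restrict[OF F l.lin] X.gens_image[OF gg] by simp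
qed

lemma fl_mingen:
  assumes "fl_module R X"
  obtains n x where "mingen R J X n x"
  using assms left_module.finite_length_gens mingen_exists unfolding fl_module_def by metis

lemma projective_cover_cover:
  assumes X: "fl_module R X"
  shows "projective_cover R X (fst (cover R X)) (snd (cover R X))"
proof -
  obtain n x where "mingen R J X n x" using fl_mingen[OF X] .
  then have "projective_cover R X (free_mod R n) (restrict (\<lambda>c. lc X n c x) (carrier (free_mod R n)))"
    using minimal_cover X by (auto simp: fl_module_def)
  then have "\<exists>Pp. case Pp of (P, p) \<Rightarrow> projective_cover R X (P :: ('a, nat \<Rightarrow> 'a) module) p" by blast
  then have "case cover R X of (P, p) \<Rightarrow> projective_cover R X P p"
    unfolding cover_def by (rule someI_ex)
  then show ?thesis by (simp add: case_prod_beta)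
qed

text \<open>A projective cover \<open>P\<close> is free, and the images of its basis are minimal generators: if a relation
  had an invertible \<open>j\<close>-th coefficient, the elements of \<open>P\<close> with \<open>j\<close>-th coordinate in \<open>J\<close> would together
  with the kernel span \<open>P\<close>, although they form a proper submodule.\<close>
lemma cover_syz:
  assumes X: "left_module R X" and c: "projective_cover R X (P :: ('a, nat \<Rightarrow> 'a) module) p"
  shows "\<exists>n x \<iota>. syz R J X n x (sub_mod P (a_kernel P X p)) \<iota> \<and>
    ((\<forall>f\<in>lhom R (sub_mod P (a_kernel P X p)) (reg_mod R).
        \<exists>g\<in>lhom R P (reg_mod R). \<forall>y\<in>a_kernel P X p. g y = f y) \<longrightarrow>
     extends R n (sub_mod P (a_kernel P X p)) \<iota>)"
proof -
  let ?K = "a_kernel P X p"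
  interpret A: left_module R "reg_mod R" using reg_mod_left_module[OF ring_axioms] .
  interpret X: left_module R X by fact
  have pr: "projective R P" and p: "p \<in> lhom R P X" and s: "p ` carrier P = carrier X"
    and sf: "\<And>U. submodule U R P \<Longrightarrow> U <+>\<^bsub>P\<^esub> ?K = carrier P \<Longrightarrow> U = carrier P"
    using c by (auto simp: projective_cover_def)
  then have P: "left_module R P" by (simp add: projective_def fl_module_def)
  interpret p: lin_map R P X p using P X lhom_lin[OF p] by (auto intro!: lin_mapI)
  obtain n b where b: "basis R P n b" using projective_basis[OF pr fin] .
  then have g: "gens R P n b" by (simp add: basis_def)
  note bP = gensD[OF g]
  obtain \<iota> where \<iota>: "\<And>i. i < n \<Longrightarrow> \<iota> i \<in> lhom R P (reg_mod R)"
    "\<And>a i. (\<And>i. i < n \<Longrightarrow> a i \<in> carrier R) \<Longrightarrow> i < n \<Longrightarrow> \<iota> i (lc P n a b) = a i"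
    "\<And>p. p \<in> carrier P \<Longrightarrow> lc P n (\<lambda>i. \<iota> i p) b = p"
    using basis_coordinates[OF P b] by metis
  have iR: "\<iota> i q \<in> carrier R" if "i < n" "q \<in> carrier P" for i q
    using lhom_lin[OF \<iota>(1)[OF that(1)]] that(2) by (auto simp: lin_def)
  have K: "?K = p.ker" by (simp add: a_kernel_def')
  have Ks: "submodule ?K R P" unfolding K by (rule p.ker_submodule)
  have Kl: "left_module R (sub_mod P ?K)" by (rule p.X.sub_mod_left_module[OF Ks])
  define x where "x = (\<lambda>i. p (b i))"
  have px: "p (lc P n a b) = lc X n a x" if "\<And>i. i < n \<Longrightarrow> a i \<in> carrier R" for a
    using p.f_lc[of n a b] that bP by (simp add: x_def)
  have gx: "gens R X n x"
    unfolding gens_def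
  proof (intro conjI allI impI ballI)
    show "x i \<in> carrier X" if "i < n" for i using bP[OF that] by (simp add: x_def)
    show "\<exists>a. (\<forall>i<n. a i \<in> carrier R) \<and> y = lc X n a x" if y: "y \<in> carrier X" for y
    proof -
      have "y \<in> p ` carrier P" using y s by simp
      then obtain q where "q \<in> carrier P" "y = p q" by blast
      moreover from this obtain a where "\<And>i. i < n \<Longrightarrow> a i \<in> carrier R" "q = lc P n a b"
        using gensE[OF g] by blast
      ultimately show ?thesis using px by auto
    qed
  qed
  have "mingen R J X n x"
    unfolding mingen_def
  proof (intro conjI gx allI impI)
    fix a j assume a: "(\<forall>i<n. a i \<in> carrier R) \<and> lc X n a x = \<zero>\<^bsub>X\<^esub>" and j: "j < n"
    show "a j \<in> J"
    proof (rule ccontr)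
      assume "a j \<notin> J"
      then obtain v where v: "v \<in> carrier R" "v \<otimes> a j = \<one>" using J_inv a j by blast
      interpret e: lin_map R P "reg_mod R" "\<iota> j"
        using P A.left_module_axioms lhom_lin[OF \<iota>(1)[OF j]] by (auto intro!: lin_mapI)
      define w where "w = lc P n a b"
      have w: "w \<in> carrier P" "w \<in> ?K" "\<iota> j w = a j"
        using a px \<iota>(2)[of a] j bP by (auto simp: w_def K)
      let ?U = "{q \<in> carrier P. \<iota> j q \<in> J}"
      have U: "submodule ?U R P" using e.vimage_submodule[OF J_submodule] .
      have "?U <+>\<^bsub>P\<^esub> ?K = carrier P"
      proof (intro equalityI subsetI)
        fix q assume q: "q \<in> carrier P"
        let ?k = "(\<iota> j q \<otimes> v) \<odot>\<^bsub>P\<^esub> w"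
        have r: "\<iota> j q \<in> carrier R" using e.f_closed[OF q] by simp
        have k: "?k \<in> ?K" using w v r by (intro p.X.submoduleD(4)[OF Ks]) auto
        then have kP: "?k \<in> carrier P" using p.X.submoduleD(1)[OF Ks] by auto
        have "\<iota> j ?k = \<iota> j q" using w v r a j by (simp add: e.f_smult m_assoc)
        then have "\<iota> j (q \<ominus>\<^bsub>P\<^esub> ?k) = \<zero>" using q kP r A.mod_minus_self[of "\<iota> j q"] by (simp add: e.f_minus)
        then have "q \<ominus>\<^bsub>P\<^esub> ?k \<in> ?U" using q kP J_zero by simp
        moreover have "q = (q \<ominus>\<^bsub>P\<^esub> ?k) \<oplus>\<^bsub>P\<^esub> ?k" using q kP p.X.mod_minus_add by simp
        ultimately show "q \<in> ?U <+>\<^bsub>P\<^esub> ?K" using k unfolding set_add_def' by blast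
      qed (use p.X.submoduleD(1)[OF Ks] in \<open>auto elim!: set_addE\<close>)
      then have "?U = carrier P" using sf U by blast
      then have "\<iota> j (b j) \<in> J" using bP[OF j] by blast
      moreover have "\<iota> j (b j) = \<one>"
        using \<iota>(2)[of "\<lambda>i. if i = j then \<one> else \<zero>" j] p.X.lc_unit[of j n \<one> b] j bP by simp
      ultimately show False using one_notin_J by simp
    qed
  qed
  moreover have "\<forall>i<n. restrict (\<iota> i) ?K \<in> lhom R (sub_mod P ?K) (reg_mod R)"
  proof safe
    fix i assume "i < n"
    then have "lin R P (reg_mod R) (\<iota> i)" using lhom_lin \<iota>(1) by blast
    then have "lin R (sub_mod P ?K) (reg_mod R) (\<iota> i)"
      using p.X.submoduleD(1)[OF Ks] by (auto simp: lin_def Pi_iff subset_iff)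
    then show "restrict (\<iota> i) ?K \<in> lhom R (sub_mod P ?K) (reg_mod R)" using lin_restrict[OF Kl] by simp
  qed
  moreover have "\<forall>y\<in>?K. (\<forall>i<n. restrict (\<iota> i) ?K y = \<zero>) \<longrightarrow> y = \<zero>\<^bsub>P\<^esub>"
  proof (intro ballI impI)
    fix y assume y: "y \<in> ?K" "\<forall>i<n. restrict (\<iota> i) ?K y = \<zero>"
    then have "lc P n (\<lambda>i. \<iota> i y) b = \<zero>\<^bsub>P\<^esub>" using bP by (intro p.X.lc_eq_zeroI) simp
    then show "y = \<zero>\<^bsub>P\<^esub>" using \<iota>(3)[of y] y K by simp
  qed
  moreover have "\<forall>y\<in>?K. lc X n (\<lambda>i. restrict (\<iota> i) ?K y) x = \<zero>\<^bsub>X\<^esub>"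
  proof
    fix y assume y: "y \<in> ?K"
    then have yP: "y \<in> carrier P" using K by auto
    have "lc X n (\<lambda>i. restrict (\<iota> i) ?K y) x = p (lc P n (\<lambda>i. \<iota> i y) b)"
      using y yP iR by (subst px) auto
    then show "lc X n (\<lambda>i. restrict (\<iota> i) ?K y) x = \<zero>\<^bsub>X\<^esub>" using \<iota>(3)[OF yP] y K by simp
  qed
  moreover have "\<exists>y\<in>?K. \<forall>i<n. restrict (\<iota> i) ?K y = a i"
    if "\<forall>i<n. a i \<in> carrier R" "lc X n a x = \<zero>\<^bsub>X\<^esub>" for a
    using that px[of a] \<iota>(2)[of a] K bP by (intro bexI[of _ "lc P n a b"]) auto
  ultimately have syz: "syz R J X n x (sub_mod P ?K) (\<lambda>i. restrict (\<iota> i) ?K)"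
    unfolding syz_def using X Kl by auto
  have "extends R n (sub_mod P ?K) (\<lambda>i. restrict (\<iota> i) ?K)"
    if ext: "\<forall>f\<in>lhom R (sub_mod P ?K) (reg_mod R). \<exists>g\<in>lhom R P (reg_mod R). \<forall>y\<in>?K. g y = f y"
    unfolding extends_def
  proof
    fix f assume "f \<in> lhom R (sub_mod P ?K) (reg_mod R)"
    then obtain g where g: "g \<in> lhom R P (reg_mod R)" "\<forall>y\<in>?K. g y = f y" using ext by blast
    interpret g: lin_map R P "reg_mod R" g
      using P A.left_module_axioms lhom_lin[OF g(1)] by (auto intro!: lin_mapI)
    have "f y = lc (reg_mod R) n (\<lambda>i. restrict (\<iota> i) ?K y) (\<lambda>i. g (b i))" if y: "y \<in> ?K" for y
    proof -
      have yP: "y \<in> carrier P" using y K by auto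
      have "f y = g (lc P n (\<lambda>i. \<iota> i y) b)" using y g(2) \<iota>(3)[OF yP] by simp
      also have "\<dots> = lc (reg_mod R) n (\<lambda>i. \<iota> i y) (\<lambda>i. g (b i))"
        using iR yP bP by (intro g.f_lc) auto
      finally show ?thesis using y by simp
    qed
    then show "\<exists>c. (\<forall>i<n. c i \<in> carrier R) \<and>
        (\<forall>y\<in>carrier (sub_mod P ?K). f y = lc (reg_mod R) n (\<lambda>i. restrict (\<iota> i) ?K y) c)"
      using g.f_closed bP by (intro exI[of _ "\<lambda>i. g (b i)"]) simp
  qed
  with syz show ?thesis by blast
qed

lemma Omega_fl:
  assumes X: "fl_module R X"
  shows "fl_module R (Omega R X)"
proof -
  let ?P = "fst (cover R X)" and ?p = "snd (cover R X)"
  have c: "projective_cover R X ?P ?p" by (rule projective_cover_cover[OF X])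
  have P: "fl_module R ?P" using c by (simp add: projective_cover_def projective_def)
  interpret p: lin_map R ?P X ?p
    using P X c by (auto intro!: lin_mapI lhom_lin simp: fl_module_def projective_cover_def)
  have K: "submodule (a_kernel ?P X ?p) R ?P" using p.ker_submodule by (simp add: a_kernel_def')
  show ?thesis
    using p.X.sub_mod_left_module[OF K] p.X.length_submodule_le[OF K] P
    unfolding Omega_cover fl_module_def by (auto dest: enat_ile)
qed

text \<open>Splicing the chosen covers of the iterated syzygies gives a projective resolution, so the
  vanishing of Ext says that maps from a syzygy into \<open>N\<close> extend to the projective containing it.\<close>
lemma Ext_vanishes_extends_aux:
  assumes X: "fl_module R X" and N: "left_module R N" and ext: "Ext_vanishes R (Suc i) X N"
  defines "Z \<equiv> \<lambda>k. (Omega R ^^ k) (Omega R X)"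
  defines "P \<equiv> \<lambda>k. case k of 0 \<Rightarrow> fst (cover R X) | Suc k \<Rightarrow> fst (cover R (Z k))"
  assumes f: "f \<in> lhom R (Z i) N"
  shows "\<exists>g\<in>lhom R (P i) N. \<forall>y\<in>carrier (Z i). g y = f y"
proof -
  define d where "d k = snd (cover R (Z k))" for k
  let ?\<epsilon> = "snd (cover R X)"
  interpret N: left_module R N by fact
  have Zfl: "fl_module R (Z k)" for k
    by (induction k) (auto simp: Z_def Omega_fl X)
  have c0: "projective_cover R X (P 0) ?\<epsilon>" using projective_cover_cover[OF X] by (simp add: P_def)
  have cS: "projective_cover R (Z k) (P (Suc k)) (d k)" for k
    using projective_cover_cover[OF Zfl] by (simp add: P_def d_def)
  have prP: "projective R (P k)" for k using c0 cS by (cases k) (auto simp: projective_cover_def)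
  have Pl: "left_module R (P k)" for k using prP by (simp add: projective_def fl_module_def)
  have Z0: "Z 0 = sub_mod (P 0) (a_kernel (P 0) X ?\<epsilon>)" by (simp add: Z_def P_def Omega_cover)
  have ZS: "Z (Suc k) = sub_mod (P (Suc k)) (a_kernel (P (Suc k)) (Z k) (d k))" for k
    by (simp add: Z_def P_def d_def Omega_cover)
  have ZP: "carrier (Z k) \<subseteq> carrier (P k) \<and> add (Z k) = add (P k) \<and> smult (Z k) = smult (P k)
      \<and> zero (Z k) = zero (P k)" for k
    by (cases k) (auto simp: Z0 ZS a_kernel_def')
  have dZ: "d k \<in> lhom R (P (Suc k)) (Z k)" "d k ` carrier (P (Suc k)) = carrier (Z k)" for k
    using cS by (auto simp: projective_cover_def)
  have dP: "d k \<in> lhom R (P (Suc k)) (P k)" for k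
    using dZ(1)[of k] ZP[of k] by (auto simp: lhom_def PiE_iff)
  have res: "projective_resolution R X P d ?\<epsilon>"
    unfolding projective_resolution_def
  proof (intro conjI allI prP dP)
    show "?\<epsilon> \<in> lhom R (P 0) X" "?\<epsilon> ` carrier (P 0) = carrier X" using c0 by (auto simp: projective_cover_def)
    show "d 0 ` carrier (P (Suc 0)) = a_kernel (P 0) X ?\<epsilon>" using dZ(2)[of 0] Z0 by simp
    show "d (Suc k) ` carrier (P (Suc (Suc k))) = a_kernel (P (Suc k)) (P k) (d k)" for k
      using dZ(2)[of "Suc k"] ZS[of k] ZP[of k] by (simp add: a_kernel_def')
  qed
  interpret di: lin_map R "P (Suc i)" "Z i" "d i"
    using Pl Zfl dZ(1) by (auto intro!: lin_mapI lhom_lin simp: fl_module_def)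
  interpret f: lin_map R "Z i" N f
    using Zfl N f by (auto intro!: lin_mapI lhom_lin simp: fl_module_def)
  \<comment> \<open>the cocycle obtained from \<open>f\<close> along the cover of the \<open>i\<close>-th syzygy\<close>
  let ?z = "compose (carrier (P (Suc i))) f (d i)"
  let ?H = "coboundaries R P d N (Suc i)" and ?G = "(hom_group R (P (Suc i)) N)\<lparr>carrier := cocycles R P d N (Suc i)\<rparr>"
  have z: "?z \<in> lhom R (P (Suc i)) N"
    using lin_restrict[OF Pl lin_comp[OF di.lin f.lin]] by (simp add: compose_def)
  have zc: "?z \<in> cocycles R P d N (Suc i)"
    unfolding cocycles_def
  proof (intro CollectI conjI z ballI)
    fix q assume "q \<in> carrier (P (Suc (Suc i)))"
    then have "d (Suc i) q \<in> a_kernel (P (Suc i)) (Z i) (d i)"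
      using dZ(2)[of "Suc i"] ZS[of i] by auto
    then show "?z (d (Suc i) q) = \<zero>\<^bsub>N\<^esub>"
      using f.f_zero by (auto simp: a_kernel_def' compose_def)
  qed
  have "trivial_group (Ext_group R P d N (Suc i))" using ext res by (auto simp: Ext_vanishes_def)
  then have "carrier (?G Mod ?H) = {?H}"
    by (simp add: trivial_group_def Ext_group_def FactGroup_def del: coboundaries.simps)
  moreover have "?H #>\<^bsub>?G\<^esub> ?z \<in> carrier (?G Mod ?H)"
    using zc by (auto simp: FactGroup_def RCOSETS_def simp del: coboundaries.simps)
  ultimately have HH: "?H #>\<^bsub>?G\<^esub> ?z = ?H" by blast
  \<comment> \<open>add the zero coboundary\<close>
  have "?z \<in> ?H #>\<^bsub>?G\<^esub> ?z"
  proof -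
    let ?o = "\<lambda>x\<in>carrier (P i). \<zero>\<^bsub>N\<^esub>"
    have "?o \<in> lhom R (P i) N" by (rule lin_restrict[OF Pl]) (auto simp: lin_def)
    then have o: "compose (carrier (P (Suc i))) ?o (d i) \<in> ?H" by simp
    have "\<zero>\<^bsub>N\<^esub> \<oplus>\<^bsub>N\<^esub> f (d i x) = f (d i x)" "d i x \<in> carrier (P i)" if "x \<in> carrier (P (Suc i))" for x
      using di.f_closed[OF that] ZP[of i] by auto
    then have "compose (carrier (P (Suc i))) ?o (d i) \<otimes>\<^bsub>?G\<^esub> ?z = ?z"
      by (auto simp: hom_group_def compose_def fun_eq_iff)
    then show ?thesis unfolding r_coset_def by (intro UN_I[OF o]) (simp only: singleton_iff)
  qed
  then have "?z \<in> ?H" using HH by simp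
  then obtain g where g: "g \<in> lhom R (P i) N" "?z = compose (carrier (P (Suc i))) g (d i)" by auto
  have "g y = f y" if y: "y \<in> carrier (Z i)" for y
  proof -
    obtain q where "q \<in> carrier (P (Suc i))" "y = d i q" using y dZ(2)[of i] by blast
    then show ?thesis using fun_cong[OF g(2), of q] by (simp add: compose_def)
  qed
  then show ?thesis using g(1) by blast
qed

lemma Omega_syz:
  assumes X: "fl_module R X"
  shows "\<exists>n x \<iota>. syz R J X n x (Omega R X) \<iota> \<and>
    (Ext_vanishes R 1 X (reg_mod R) \<longrightarrow> extends R n (Omega R X) \<iota>)"
proof -
  let ?P = "fst (cover R X)"
  have Xl: "left_module R X" using X by (simp add: fl_module_def)
  have "\<forall>f\<in>lhom R (Omega R X) (reg_mod R). \<exists>g\<in>lhom R ?P (reg_mod R). \<forall>y\<in>carrier (Omega R X). g y = f y"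
    if "Ext_vanishes R 1 X (reg_mod R)"
    using Ext_vanishes_extends_aux[OF X reg_mod_left_module[OF ring_axioms], of 0] that by simp
  note ext = this[unfolded Omega_cover sub_mod_simps]
  show ?thesis
    using cover_syz[OF Xl projective_cover_cover[OF X]] ext unfolding Omega_cover by meson
qed

lemma Omega2_syz:
  assumes X: "fl_module R X"
  shows "\<exists>n x \<iota>. syz R J (Omega R X) n x (Omega R (Omega R X)) \<iota> \<and>
    (Ext_vanishes R 2 X (reg_mod R) \<longrightarrow> extends R n (Omega R (Omega R X)) \<iota>)"
proof -
  let ?Y = "Omega R X"
  let ?P = "fst (cover R ?Y)"
  have Y: "fl_module R ?Y" by (rule Omega_fl[OF X])
  then have Yl: "left_module R ?Y" by (simp add: fl_module_def)
  have "\<forall>f\<in>lhom R (Omega R ?Y) (reg_mod R). \<exists>g\<in>lhom R ?P (reg_mod R). \<forall>y\<in>carrier (Omega R ?Y). g y = f y"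
    if "Ext_vanishes R 2 X (reg_mod R)"
    using Ext_vanishes_extends_aux[OF X reg_mod_left_module[OF ring_axioms], of 1] that
    by (simp add: numeral_2_eq_2)
  note ext = this[unfolded Omega_cover[of R ?Y] sub_mod_simps]
  show ?thesis
    using cover_syz[OF Yl projective_cover_cover[OF Y]] ext unfolding Omega_cover[of R ?Y] by meson
qed

end

section \<open>The opposite ring and the dual of a module\<close>

lemma opp_ring_simps [simp]:
  "carrier (opp_ring R) = carrier R" "zero (opp_ring R) = zero R" "add (opp_ring R) = add R"
  "one (opp_ring R) = one R" "monoid.mult (opp_ring R) = (\<lambda>x y. y \<otimes>\<^bsub>R\<^esub> x)"
  by (simp_all add: opp_ring_def)

lemma (in ring) opp_ring: "ring (opp_ring R)"
proof (rule ringI)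
  show "abelian_group (opp_ring R)"
    by (rule abelian_groupI) (auto simp: a_ac intro: bexI[of _ "\<ominus> _"] l_neg)
  show "monoid (opp_ring R)" by (rule monoidI) (auto simp: m_assoc)
qed (auto simp: l_distr r_distr)

lemma (in rad_ring) opp_rad_ring: "rad_ring (opp_ring R) J"
proof (rule rad_ring.intro[OF opp_ring], unfold_locales)
  show "\<exists>y\<in>carrier (opp_ring R). y \<otimes>\<^bsub>opp_ring R\<^esub> x = \<one>\<^bsub>opp_ring R\<^esub> \<and> x \<otimes>\<^bsub>opp_ring R\<^esub> y = \<one>\<^bsub>opp_ring R\<^esub>"
    if "x \<in> carrier (opp_ring R)" "x \<notin> J" for x
    using J_inv[of x] that by auto
  show "x \<otimes>\<^bsub>opp_ring R\<^esub> (y \<otimes>\<^bsub>opp_ring R\<^esub> z) = \<zero>\<^bsub>opp_ring R\<^esub>" if "x \<in> J" "y \<in> J" "z \<in> J" for x y z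
    using J_cube[of z y x] that by (simp add: m_assoc J_carr)
qed (auto simp: J_carr J_zero J_add J_lmult J_rmult one_notin_J)

lemma dual_simps [simp]:
  "carrier (dual R X) = lhom R X (reg_mod R)" "zero (dual R X) = (\<lambda>x\<in>carrier X. \<zero>\<^bsub>R\<^esub>)"
  "add (dual R X) = (\<lambda>f g. \<lambda>x\<in>carrier X. f x \<oplus>\<^bsub>R\<^esub> g x)"
  "smult (dual R X) = (\<lambda>a f. \<lambda>x\<in>carrier X. f x \<otimes>\<^bsub>R\<^esub> a)"
  by (simp_all add: dual_def)

lemma lhom_regD:
  assumes "f \<in> lhom R X (reg_mod R)"
  shows "x \<in> carrier X \<Longrightarrow> f x \<in> carrier R" "x \<in> carrier X \<Longrightarrow> y \<in> carrier X \<Longrightarrow> f (x \<oplus>\<^bsub>X\<^esub> y) = f x \<oplus>\<^bsub>R\<^esub> f y"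
    "r \<in> carrier R \<Longrightarrow> x \<in> carrier X \<Longrightarrow> f (r \<odot>\<^bsub>X\<^esub> x) = r \<otimes>\<^bsub>R\<^esub> f x" "f \<in> extensional (carrier X)"
  using assms by (auto simp: lhom_def PiE_iff)

lemma (in left_module) lhom_regI:
  assumes "\<And>x. x \<in> carrier M \<Longrightarrow> g x \<in> carrier R"
    "\<And>x y. x \<in> carrier M \<Longrightarrow> y \<in> carrier M \<Longrightarrow> g (x \<oplus>\<^bsub>M\<^esub> y) = g x \<oplus> g y"
    "\<And>r x. r \<in> carrier R \<Longrightarrow> x \<in> carrier M \<Longrightarrow> g (r \<odot>\<^bsub>M\<^esub> x) = r \<otimes> g x"
  shows "(\<lambda>x\<in>carrier M. g x) \<in> lhom R M (reg_mod R)"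
  using assms by (auto simp: lhom_def)

lemma dual_left_module:
  assumes X: "left_module R X"
  shows "left_module (opp_ring R) (dual R X)"
proof -
  interpret X: left_module R X by fact
  note D = lhom_regD
  show ?thesis
  proof (rule left_moduleI, goal_cases)
    case 1
    then show ?case by (rule X.R.opp_ring)
  next
    case (2 f g)
    then show ?case by (auto simp: D X.R.a_ac X.R.r_distr intro!: X.lhom_regI)
  next
    case 3
    then show ?case by (auto intro!: X.lhom_regI)
  next
    case (4 f g h)
    then show ?case by (auto simp: D X.R.a_ac fun_eq_iff)
  next
    case (5 f g)
    then show ?case by (auto simp: D X.R.a_ac fun_eq_iff)
  next
    case (6 f)
    then have "\<zero>\<^bsub>R\<^esub> \<oplus>\<^bsub>R\<^esub> f x = f x" if "x \<in> carrier X" for x using that D(1) by (intro X.R.l_zero) auto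
    then show ?case using 6 D(4)[of f R X] by (auto simp: fun_eq_iff extensional_def)
  next
    case (7 f)
    then have f: "f \<in> lhom R X (reg_mod R)" by simp
    have "(\<lambda>x\<in>carrier X. \<ominus>\<^bsub>R\<^esub> f x) \<in> lhom R X (reg_mod R)"
      by (rule X.lhom_regI) (auto simp: D[OF f] X.R.minus_add X.R.r_minus)
    moreover have "(\<lambda>x\<in>carrier X. \<ominus>\<^bsub>R\<^esub> f x) \<oplus>\<^bsub>dual R X\<^esub> f = \<zero>\<^bsub>dual R X\<^esub>"
      by (auto simp: D[OF f] X.R.l_neg fun_eq_iff)
    ultimately show ?case
      by (intro bexI[of _ "\<lambda>x\<in>carrier X. \<ominus>\<^bsub>R\<^esub> f x"]) simp_all
  next
    case (8 a f)
    then show ?case by (auto simp: D X.R.l_distr X.R.m_assoc intro!: X.lhom_regI)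
  next
    case (9 a b f)
    then show ?case by (auto simp: D X.R.r_distr fun_eq_iff)
  next
    case (10 a f g)
    then show ?case by (auto simp: D X.R.l_distr fun_eq_iff)
  next
    case (11 a b f)
    then show ?case by (auto simp: D X.R.m_assoc fun_eq_iff)
  next
    case (12 f)
    then have "f x \<otimes>\<^bsub>R\<^esub> \<one>\<^bsub>R\<^esub> = f x" if "x \<in> carrier X" for x using that D(1) by (intro X.R.r_one) auto
    then show ?case using 12 D(4)[of f R X] by (auto simp: fun_eq_iff extensional_def)
  qed
qed

section \<open>Restriction of scalars\<close>

text \<open>A space of homomorphisms to \<open>A\<close> is a module over the opposite of \<open>A\<close> only; restriction along a
  ring homomorphism \<open>\<sigma>\<close> from the field makes it comparable with left modules.\<close>
definition kmod :: "('k \<Rightarrow> 'a) \<Rightarrow> ('a, 'm) module \<Rightarrow> ('k, 'm) module" where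
  "kmod \<sigma> X = \<lparr>carrier = carrier X, monoid.mult = undefined, one = undefined, ring.zero = zero X,
     add = add X, smult = (\<lambda>c. smult X (\<sigma> c))\<rparr>"

lemma kmod_simps [simp]:
  "carrier (kmod \<sigma> X) = carrier X" "zero (kmod \<sigma> X) = zero X" "add (kmod \<sigma> X) = add X"
  "smult (kmod \<sigma> X) = (\<lambda>c. smult X (\<sigma> c))"
  by (simp_all add: kmod_def)

lemma sub_mod_kmod: "sub_mod (kmod \<sigma> X) N = kmod \<sigma> (sub_mod X N)"
  by (simp add: sub_mod_def kmod_def)

lemma pow_mod_kmod: "pow_mod (kmod \<sigma> X) n = kmod \<sigma> (pow_mod X n)"
  by (simp add: pow_mod_def kmod_def)

locale scalar_ring = K: ring K + B: ring B for K (structure) and B (structure) +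
  fixes \<sigma> assumes \<sigma>_hom: "\<sigma> \<in> ring_hom K B"
begin

lemma \<sigma>_closed [simp]: "c \<in> carrier K \<Longrightarrow> \<sigma> c \<in> carrier B"
  using \<sigma>_hom by (auto simp: ring_hom_def)

lemma kmod_left_module:
  assumes "left_module B X"
  shows "left_module K (kmod \<sigma> X)"
proof -
  interpret X: left_module B X by fact
  have "abelian_group (kmod \<sigma> X)"
    by (rule abelian_groupI) (auto simp: X.mod_a_ac intro: bexI[of _ "\<ominus>\<^bsub>X\<^esub> _"] X.mod_l_neg)
  then show ?thesis
    using K.ring_axioms \<sigma>_hom
    by (auto simp: left_module_def left_module_axioms_def ring_hom_def X.smult_l_distr X.smult_r_distr X.smult_assoc)
qed

lemma kmod_lin: "lin B X Y f \<Longrightarrow> lin K (kmod \<sigma> X) (kmod \<sigma> Y) f"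
  by (auto simp: lin_def)

lemma kmod_submodule:
  assumes "left_module B X" "submodule U B X"
  shows "submodule U K (kmod \<sigma> X)"
  using assms(2) by (simp add: left_module.submodule_iff[OF assms(1)]
    left_module.submodule_iff[OF kmod_left_module[OF assms(1)]])

lemma kmod_lin_map: "lin_map B X Y f \<Longrightarrow> lin_map K (kmod \<sigma> X) (kmod \<sigma> Y) f"
  by (intro lin_mapI kmod_left_module kmod_lin)
    (auto simp: lin_map_def lin_map_axioms_def)

lemma length_le_kmod:
  assumes "left_module B X"
  shows "mod_length B X \<le> mod_length K (kmod \<sigma> X)"
proof (rule enat_leI)
  fix n assume "enat n \<le> mod_length B X"
  then obtain U where "mod_chain B X n U" unfolding left_module.mod_length_ge_iff[OF assms] by blast
  then have "mod_chain K (kmod \<sigma> X) n U" using kmod_submodule[OF assms] by (auto simp: mod_chain_def)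
  then show "enat n \<le> mod_length K (kmod \<sigma> X)" by (rule mod_length_ge)
qed

end

section \<open>Short local algebras\<close>

text \<open>\<open>\<sigma>\<close> is the structure map of the algebra, and \<open>\<sigma>_split\<close> says that \<open>A/J\<close> is the ground field.\<close>
locale short_alg = artin_rad_ring R J + S: scalar_ring K R \<sigma>
  for R :: "('a, 'r) ring_scheme" (structure) and J and K :: "('k, 's) ring_scheme" and \<sigma> +
  fixes e a :: nat
  assumes K_field: "field K"
    and \<sigma>_central: "c \<in> carrier K \<Longrightarrow> x \<in> carrier R \<Longrightarrow> \<sigma> c \<otimes> x = x \<otimes> \<sigma> c"
    and \<sigma>_split: "x \<in> carrier R \<Longrightarrow> \<exists>c\<in>carrier K. \<exists>j\<in>J. x = \<sigma> c \<oplus> j"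
    and len_J2: "mod_length R (sub_mod (reg_mod R) (ideal_prod R J J)) = enat a"
    and len_J_J2: "mod_length R (quot_mod (sub_mod (reg_mod R) J) (ideal_prod R J J)) = enat e"
begin

abbreviation "A \<equiv> reg_mod R"
abbreviation "J2 \<equiv> ideal_prod R J J"

sublocale A: left_module R "reg_mod R" by (rule reg_mod_left_module[OF ring_axioms])

lemma J_ideal: "ideal J R"
proof (rule idealI[OF ring_axioms])
  show "subgroup J (add_monoid R)"
    by (intro subgroup.intro) (auto simp: J_carr J_zero J_add J_neg simp flip: a_inv_def)
qed (auto simp: J_lmult J_rmult)

lemma J2_ideal: "ideal J2 R" by (rule ideal_prod_is_ideal[OF J_ideal J_ideal])

lemma J2_lmult: "r \<in> carrier R \<Longrightarrow> z \<in> J2 \<Longrightarrow> r \<otimes> z \<in> J2"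
  and J2_rmult: "r \<in> carrier R \<Longrightarrow> z \<in> J2 \<Longrightarrow> z \<otimes> r \<in> J2"
  using ideal.I_l_closed[OF J2_ideal] ideal.I_r_closed[OF J2_ideal] by auto

lemma J2_J: "z \<in> J2 \<Longrightarrow> z \<in> J"
  by (induction rule: ideal_prod.induct) (auto simp: J_lmult J_carr J_add)

lemma J2_carr: "z \<in> J2 \<Longrightarrow> z \<in> carrier R" using J2_J J_carr by blast

lemma J2I: "x \<in> J \<Longrightarrow> y \<in> J \<Longrightarrow> x \<otimes> y \<in> J2" by (rule ideal_prod.prod)

lemma J2_add: "x \<in> J2 \<Longrightarrow> y \<in> J2 \<Longrightarrow> x \<oplus> y \<in> J2" by (rule ideal_prod.sum)

lemma J2_zero: "\<zero> \<in> J2" using J2I[OF J_zero J_zero] by simp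

lemma J_J2: "z \<in> J2 \<Longrightarrow> j \<in> J \<Longrightarrow> j \<otimes> z = \<zero>"
proof (induction z rule: ideal_prod.induct)
  case (sum x y)
  then show ?case using J2_carr by (simp add: r_distr J_carr)
qed (simp add: J_cube)

lemma J2_J_zero: "z \<in> J2 \<Longrightarrow> j \<in> J \<Longrightarrow> z \<otimes> j = \<zero>"
proof (induction z rule: ideal_prod.induct)
  case (sum x y)
  then show ?case using J2_carr by (simp add: l_distr J_carr)
qed (simp add: J_cube m_assoc J_carr)

lemma J2_submodule: "submodule J2 R A"
  by (rule A.submoduleI) (auto simp: J2_carr J2_zero J2_add J2_lmult)

lemma \<sigma>_zero: "\<sigma> \<zero>\<^bsub>K\<^esub> = \<zero>"
  using S.\<sigma>_hom S.K.ring_axioms ring_axioms by (meson ring_hom_zero)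

lemma \<sigma>_one: "\<sigma> \<one>\<^bsub>K\<^esub> = \<one>" using S.\<sigma>_hom by (auto simp: ring_hom_def)

lemma \<sigma>_inv:
  assumes "c \<in> carrier K" "\<sigma> c \<noteq> \<zero>"
  obtains d where "d \<in> carrier K" "\<sigma> d \<otimes> \<sigma> c = \<one>"
proof -
  interpret K: field K by (rule K_field)
  have "c \<noteq> \<zero>\<^bsub>K\<^esub>" using assms \<sigma>_zero by auto
  then have "inv\<^bsub>K\<^esub> c \<in> carrier K" "inv\<^bsub>K\<^esub> c \<otimes>\<^bsub>K\<^esub> c = \<one>\<^bsub>K\<^esub>"
    using assms(1) by (auto simp: K.field_Units)
  moreover from this have "\<sigma> (inv\<^bsub>K\<^esub> c) \<otimes> \<sigma> c = \<one>"
    using S.\<sigma>_hom \<sigma>_one assms(1) by (metis ring_hom_mult)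
  ultimately show thesis using that by blast
qed

lemma opp_scalar_ring: "scalar_ring K (opp_ring R) \<sigma>"
proof -
  have "\<sigma> \<in> ring_hom K (opp_ring R)"
  proof (rule ring_hom_memI)
    fix x y assume xy: "x \<in> carrier K" "y \<in> carrier K"
    show "\<sigma> (x \<otimes>\<^bsub>K\<^esub> y) = \<sigma> x \<otimes>\<^bsub>opp_ring R\<^esub> \<sigma> y"
      using ring_hom_mult[OF S.\<sigma>_hom xy] \<sigma>_central[OF xy(1), of "\<sigma> y"] xy by simp
    show "\<sigma> (x \<oplus>\<^bsub>K\<^esub> y) = \<sigma> x \<oplus>\<^bsub>opp_ring R\<^esub> \<sigma> y"
      using ring_hom_add[OF S.\<sigma>_hom xy] by simp
  qed (simp_all add: \<sigma>_one)
  then show ?thesis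
    by (intro scalar_ring.intro scalar_ring_axioms.intro opp_ring S.K.ring_axioms)
qed

abbreviation "dimK X \<equiv> mod_length K (kmod \<sigma> X)"
abbreviation "kdual X \<equiv> kmod \<sigma> (dual R X)"
abbreviation "kfree n \<equiv> kmod \<sigma> (free_mod R n)"

text \<open>On a module annihilated by \<open>J\<close> the ring acts through the field, so the two kinds of submodules
  coincide.\<close>
lemma length_kmod:
  assumes X: "left_module R X" and J0: "\<And>j x. j \<in> J \<Longrightarrow> x \<in> carrier X \<Longrightarrow> j \<odot>\<^bsub>X\<^esub> x = \<zero>\<^bsub>X\<^esub>"
  shows "dimK X = mod_length R X"
proof -
  interpret X: left_module R X by fact
  interpret KX: left_module K "kmod \<sigma> X" by (rule S.kmod_left_module[OF X])
  have "submodule U K (kmod \<sigma> X) \<longleftrightarrow> submodule U R X" for U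
  proof
    assume U: "submodule U K (kmod \<sigma> X)"
    note U = KX.submoduleD[OF U]
    show "submodule U R X"
    proof (rule X.submoduleI)
      fix r x assume rx: "r \<in> carrier R" "x \<in> U"
      obtain c j where c: "c \<in> carrier K" "j \<in> J" "r = \<sigma> c \<oplus> j" using \<sigma>_split[OF rx(1)] by blast
      then have "r \<odot>\<^bsub>X\<^esub> x = \<sigma> c \<odot>\<^bsub>X\<^esub> x" using U(1) rx J0[OF c(2), of x] by (simp add: X.smult_l_distr J_carr subset_iff)
      then show "r \<odot>\<^bsub>X\<^esub> x \<in> U" using U(4) c rx by simp
    qed (use U in auto)
  qed (rule S.kmod_submodule[OF X])
  then show ?thesis by (simp add: mod_length_def)
qed

lemma dimK_J2: "dimK (sub_mod A J2) = enat a"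
  using length_kmod[OF A.sub_mod_left_module[OF J2_submodule]] by (simp add: J_J2 len_J2)

lemma J2_sub_J: "submodule J2 R (sub_mod A J)"
  using A.submodule_sub_mod[OF J_submodule] J2_submodule J2_J by blast

lemma len_J: "mod_length R (sub_mod A J) = enat (e + a)"
  using left_module.length_quot[OF A.sub_mod_left_module[OF J_submodule] J2_sub_J]
  by (simp add: len_J2 len_J_J2)

lemma len_A: "mod_length R A = enat (1 + e + a)"
  using length_R by (simp add: len_J one_enat_def)

lemma dimK_quot:
  assumes X: "left_module R X" and N: "submodule N R X"
    and J0: "\<And>j x. j \<in> J \<Longrightarrow> x \<in> carrier X \<Longrightarrow> j \<odot>\<^bsub>X\<^esub> x \<in> N"
  shows "dimK X = dimK (sub_mod X N) + mod_length R (quot_mod X N)"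
proof -
  interpret X: left_module R X by fact
  interpret q: lin_map R X "quot_mod X N" "\<lambda>x. N +>\<^bsub>X\<^esub> x" using X.quot_lin_map[OF N] .
  interpret k: lin_map K "kmod \<sigma> X" "kmod \<sigma> (quot_mod X N)" "\<lambda>x. N +>\<^bsub>X\<^esub> x"
    by (rule S.kmod_lin_map) (rule q.lin_map_axioms)
  have "dimK (quot_mod X N) = mod_length R (quot_mod X N)"
  proof (rule length_kmod[OF X.quot_left_module[OF N]])
    fix j z assume j: "j \<in> J" and "z \<in> carrier (quot_mod X N)"
    then obtain x where x: "x \<in> carrier X" "z = N +>\<^bsub>X\<^esub> x" using X.quot_carrier by auto
    then show "j \<odot>\<^bsub>quot_mod X N\<^esub> z = \<zero>\<^bsub>quot_mod X N\<^esub>"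
      using j J0 X.quot_smult[OF N] X.quot_eq_zero_iff[OF N] by (simp add: J_carr)
  qed
  moreover have "k.ker = N" using X.submoduleD(1)[OF N] X.quot_eq_zero_iff[OF N] by auto
  ultimately show ?thesis using k.length_surj by (simp add: X.quot_carrier sub_mod_kmod)
qed

lemma dimK_J: "dimK (sub_mod A J) = enat (e + a)"
  using dimK_quot[OF A.sub_mod_left_module[OF J_submodule] J2_sub_J]
  by (simp add: len_J_J2 dimK_J2 J2I)

lemma dimK_A: "dimK A = enat (1 + e + a)"
  using dimK_quot[OF A.left_module_axioms J_submodule] J_rmult
  by (simp add: dimK_J length_R_mod_J one_enat_def)

lemma dimK_pow: "left_module R X \<Longrightarrow> dimK (pow_mod X n) = enat n * dimK X"
  using left_module.length_pow[OF S.kmod_left_module] by (simp add: pow_mod_kmod)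

end

section \<open>Homomorphisms from a syzygy to the algebra\<close>

definition loewy2 :: "'a set \<Rightarrow> ('a, 'm) module \<Rightarrow> bool" where
  "loewy2 J X \<longleftrightarrow> (\<forall>i\<in>J. \<forall>j\<in>J. \<forall>x\<in>carrier X. i \<odot>\<^bsub>X\<^esub> (j \<odot>\<^bsub>X\<^esub> x) = \<zero>\<^bsub>X\<^esub>)"

text \<open>Values in the socle respect all relations, because these have coefficients in \<open>J\<close>.\<close>
lemma (in rad_ring) socle_lhom:
  assumes X: "left_module R X" and g: "mingen R J X m y"
    and v: "\<And>i. i < m \<Longrightarrow> v i \<in> carrier R" "\<And>i j. i < m \<Longrightarrow> j \<in> J \<Longrightarrow> j \<otimes> v i = \<zero>"
  obtains f where "f \<in> lhom R X (reg_mod R)" "\<And>i. i < m \<Longrightarrow> f (y i) = v i"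
    "\<And>a. (\<And>i. i < m \<Longrightarrow> a i \<in> carrier R) \<Longrightarrow> f (lc X m a y) = lc (reg_mod R) m a v"
proof -
  interpret A: left_module R "reg_mod R" by (rule reg_mod_left_module[OF ring_axioms])
  show ?thesis
  proof (rule left_module.lhom_of_gens[OF X A.left_module_axioms mingen_gens[OF g], of v])
    fix a assume "\<And>i. i < m \<Longrightarrow> a i \<in> carrier R" "lc X m a y = \<zero>\<^bsub>X\<^esub>"
    then have "a i \<in> J" if "i < m" for i using mingenD[OF g] that by blast
    then show "lc (reg_mod R) m a v = \<zero>\<^bsub>reg_mod R\<^esub>" using v by (intro A.lc_eq_zeroI) auto
  qed (use v that in auto)
qed

text \<open>The restriction to \<open>Y\<close> of the map with coefficients \<open>c\<close> on the free module.\<close>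
definition rho :: "('a, 'r) ring_scheme \<Rightarrow> nat \<Rightarrow> ('a, 'n) module \<Rightarrow> (nat \<Rightarrow> 'n \<Rightarrow> 'a) \<Rightarrow> (nat \<Rightarrow> 'a) \<Rightarrow> 'n \<Rightarrow> 'a" where
  "rho R n Y \<iota> c = (\<lambda>y\<in>carrier Y. lc (reg_mod R) n (\<lambda>i. \<iota> i y) c)"

definition ev :: "nat \<Rightarrow> (nat \<Rightarrow> 'm) \<Rightarrow> ('m \<Rightarrow> 'a) \<Rightarrow> nat \<Rightarrow> 'a" where
  "ev m y f = (\<lambda>i\<in>{..<m}. f (y i))"

context short_alg
begin

lemma lcA_closed: "(\<And>i. i < n \<Longrightarrow> b i \<in> carrier R) \<Longrightarrow> (\<And>i. i < n \<Longrightarrow> x i \<in> carrier R) \<Longrightarrow> lc A n b x \<in> carrier R"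
  using A.lc_closed[of n b x] by simp

lemma lcA_rmult:
  assumes "\<And>i. i < n \<Longrightarrow> b i \<in> carrier R" "\<And>i. i < n \<Longrightarrow> x i \<in> carrier R" "r \<in> carrier R"
  shows "lc A n b (\<lambda>i. x i \<otimes> r) = lc A n b x \<otimes> r"
proof -
  interpret z: lin_map R A A "\<lambda>x. x \<otimes> r"
    by (intro lin_mapI A.left_module_axioms)
      (auto simp: lin_def l_distr m_assoc assms)
  show ?thesis using z.f_lc[of n b x] assms by simp
qed

lemma lcA_J2:
  assumes "\<And>i. i < n \<Longrightarrow> b i \<in> J" "\<And>i. i < n \<Longrightarrow> c i \<in> J"
  shows "lc A n b c \<in> J2"
  by (rule A.lc_in_submodule[OF J2_submodule]) (use assms J2I in auto)

lemma kdual_left_module: "left_module R X \<Longrightarrow> left_module K (kdual X)"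
  by (rule scalar_ring.kmod_left_module[OF opp_scalar_ring dual_left_module])

lemma kfree_left_module: "left_module K (kfree n)"
  by (intro S.kmod_left_module pow_mod_left_module A.left_module_axioms)

lemma free_left_module: "left_module R (free_mod R n)"
  by (intro pow_mod_left_module A.left_module_axioms)

lemma ev_lin_map:
  assumes X: "left_module R X" and y: "\<And>i. i < m \<Longrightarrow> y i \<in> carrier X"
  shows "lin_map K (kdual X) (kfree m) (ev m y)"
proof (intro lin_mapI kdual_left_module[OF X] kfree_left_module)
  show "lin K (kdual X) (kfree m) (ev m y)"
    unfolding lin_def
  proof (intro conjI ballI funcsetI)
    fix f assume "f \<in> carrier (kdual X)"
    then show "ev m y f \<in> carrier (kfree m)" using y by (auto simp: ev_def lhom_regD)
  next
    fix f g
    show "ev m y (f \<oplus>\<^bsub>kdual X\<^esub> g) = ev m y f \<oplus>\<^bsub>kfree m\<^esub> ev m y g"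
      using y by (auto simp: ev_def fun_eq_iff)
  next
    fix c f assume c: "c \<in> carrier K" and f: "f \<in> carrier (kdual X)"
    then have "f (y i) \<otimes> \<sigma> c = \<sigma> c \<otimes> f (y i)" if "i < m" for i
      using \<sigma>_central[of c "f (y i)"] y[OF that] by (simp add: lhom_regD)
    then show "ev m y (c \<odot>\<^bsub>kdual X\<^esub> f) = c \<odot>\<^bsub>kfree m\<^esub> ev m y f"
      using y by (auto simp: ev_def fun_eq_iff)
  qed
qed

lemma ev_inj:
  assumes X: "left_module R X" and g: "gens R X m y" and f: "f \<in> lhom R X A" and 0: "ev m y f = (\<lambda>i\<in>{..<m}. \<zero>)"
  shows "f = (\<lambda>x\<in>carrier X. \<zero>)"
proof (rule lhom_eqI[OF X A.left_module_axioms g f])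
  interpret X: left_module R X by fact
  show "(\<lambda>x\<in>carrier X. \<zero>) \<in> lhom R X A" by (rule X.lhom_regI) auto
  show "f (y i) = (\<lambda>x\<in>carrier X. \<zero>) (y i)" if "i < m" for i
    using fun_cong[OF 0, of i] that gensD[OF g that] by (simp add: ev_def)
qed

text \<open>A homomorphism into the module \<open>A\<close> is determined by its values on generators, so a space of
  homomorphisms has the dimension of the set of values that it takes.\<close>
lemma dimK_ev:
  assumes X: "left_module R X" and g: "gens R X m y" and V: "submodule V K (kdual X)"
    and im: "ev m y ` V = W"
  shows "mod_length K (sub_mod (kdual X) V) = mod_length K (sub_mod (kfree m) W)"
proof -
  interpret ev: lin_map K "kdual X" "kfree m" "ev m y"
    by (rule ev_lin_map[OF X gensD[OF g]])
  have W: "submodule W K (kfree m)" using ev.image_submodule[OF V] im by simp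
  interpret e: lin_map K "sub_mod (kdual X) V" "sub_mod (kfree m) W" "ev m y"
    by (intro lin_mapI ev.X.sub_mod_left_module ev.Y.sub_mod_left_module V W
        lin_sub_mod ev.lin) (use ev.X.submoduleD(1)[OF V] im in auto)
  have "e.ker \<subseteq> {\<zero>\<^bsub>kdual X\<^esub>}"
    using ev_inj[OF X g] ev.X.submoduleD(1)[OF V] by auto
  then show ?thesis using e.length_inj im by simp
qed

end

locale coords = short_alg R J K \<sigma> e a
  for R :: "('a, 'r) ring_scheme" (structure) and J and K :: "('k, 's) ring_scheme" and \<sigma> and e a +
  fixes Y :: "('a, 'y) module" and n :: nat and \<iota> :: "nat \<Rightarrow> 'y \<Rightarrow> 'a"
  assumes Y: "left_module R Y"
    and \<iota>_hom: "i < n \<Longrightarrow> \<iota> i \<in> lhom R Y (reg_mod R)"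
begin

sublocale Y: left_module R Y by (rule Y)

lemma \<iota>_closed: "i < n \<Longrightarrow> y \<in> carrier Y \<Longrightarrow> \<iota> i y \<in> carrier R"
  using lhom_regD(1)[OF \<iota>_hom] .

abbreviation "\<rho> \<equiv> rho R n Y \<iota>"

lemma rho_apply: "y \<in> carrier Y \<Longrightarrow> \<rho> c y = lc A n (\<lambda>i. \<iota> i y) c"
  by (simp add: rho_def)

lemma rho_lhom:
  assumes c: "\<And>i. i < n \<Longrightarrow> c i \<in> carrier R"
  shows "\<rho> c \<in> lhom R Y A"
  unfolding rho_def
proof (rule Y.lhom_regI)
  note h = lhom_regD[OF \<iota>_hom]
  show "lc A n (\<lambda>i. \<iota> i y) c \<in> carrier R" if "y \<in> carrier Y" for y
    using c \<iota>_closed that by (intro lcA_closed) auto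
  fix y assume y: "y \<in> carrier Y"
  show "lc A n (\<lambda>i. \<iota> i (y \<oplus>\<^bsub>Y\<^esub> z)) c = lc A n (\<lambda>i. \<iota> i y) c \<oplus> lc A n (\<lambda>i. \<iota> i z) c" if z: "z \<in> carrier Y" for z
  proof -
    have "lc A n (\<lambda>i. \<iota> i (y \<oplus>\<^bsub>Y\<^esub> z)) c = lc A n (\<lambda>i. \<iota> i y \<oplus> \<iota> i z) c" using y z h by (intro lc_cong) auto
    then show ?thesis using A.lc_add[of n "\<lambda>i. \<iota> i y" "\<lambda>i. \<iota> i z" c] c \<iota>_closed y z by simp
  qed
  show "lc A n (\<lambda>i. \<iota> i (r \<odot>\<^bsub>Y\<^esub> y)) c = r \<otimes> lc A n (\<lambda>i. \<iota> i y) c" if r: "r \<in> carrier R" for r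
  proof -
    have "lc A n (\<lambda>i. \<iota> i (r \<odot>\<^bsub>Y\<^esub> y)) c = lc A n (\<lambda>i. r \<otimes> \<iota> i y) c" using y r h by (intro lc_cong) auto
    then show ?thesis using A.lc_smult[of r n "\<lambda>i. \<iota> i y" c] c \<iota>_closed y r by simp
  qed
qed

lemma rho_add:
  assumes "\<And>i. i < n \<Longrightarrow> c i \<in> carrier R" "\<And>i. i < n \<Longrightarrow> d i \<in> carrier R" "y \<in> carrier Y"
  shows "\<rho> (\<lambda>i. c i \<oplus> d i) y = \<rho> c y \<oplus> \<rho> d y"
  using assms A.lc_add_right[of n "\<lambda>i. \<iota> i y" c d] \<iota>_closed by (simp add: rho_apply)

lemma rho_lin_map: "lin_map K (kfree n) (kdual Y) \<rho>"
proof (intro lin_mapI kdual_left_module[OF Y] kfree_left_module)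
  show "lin K (kfree n) (kdual Y) \<rho>"
    unfolding lin_def
  proof (intro conjI ballI funcsetI)
    fix c assume "c \<in> carrier (kfree n)"
    then have c: "\<And>i. i < n \<Longrightarrow> c i \<in> carrier R" by auto
    then show "\<rho> c \<in> carrier (kdual Y)" using rho_lhom by simp
    fix d assume "d \<in> carrier (kfree n)"
    then have d: "\<And>i. i < n \<Longrightarrow> d i \<in> carrier R" by auto
    have "\<rho> (\<lambda>i\<in>{..<n}. c i \<oplus> d i) = \<rho> (\<lambda>i. c i \<oplus> d i)" by (auto simp: rho_def intro!: restrict_ext lc_cong)
    then show "\<rho> (c \<oplus>\<^bsub>kfree n\<^esub> d) = \<rho> c \<oplus>\<^bsub>kdual Y\<^esub> \<rho> d"
      using rho_add[of c d] c d by (auto simp: fun_eq_iff) (simp add: rho_def)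
  next
    fix r c assume r: "r \<in> carrier K" and "c \<in> carrier (kfree n)"
    then have c: "\<And>i. i < n \<Longrightarrow> c i \<in> carrier R" by auto
    have "\<rho> (\<lambda>i\<in>{..<n}. \<sigma> r \<otimes> c i) y = \<rho> c y \<otimes> \<sigma> r" if y: "y \<in> carrier Y" for y
    proof -
      have "lc A n (\<lambda>i. \<iota> i y) (\<lambda>i\<in>{..<n}. \<sigma> r \<otimes> c i) = lc A n (\<lambda>i. \<iota> i y) (\<lambda>i. c i \<otimes> \<sigma> r)"
        using r c \<sigma>_central by (intro lc_cong) auto
      then show ?thesis using lcA_rmult[of n "\<lambda>i. \<iota> i y" c "\<sigma> r"] \<iota>_closed y r c by (simp add: rho_apply)
    qed
    then show "\<rho> (r \<odot>\<^bsub>kfree n\<^esub> c) = r \<odot>\<^bsub>kdual Y\<^esub> \<rho> c"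
      by (auto simp: fun_eq_iff) (simp add: rho_def)
  qed
qed

lemma rho_restrict: "\<rho> (restrict c {..<n}) = \<rho> c"
  by (auto simp: rho_def intro!: restrict_ext lc_cong)

end

text \<open>The situation \<open>J\<^sup>2A\<^sup>n \<subseteq> Y \<subseteq> JA\<^sup>n\<close> with the extension property. No module \<open>X\<close> with syzygy \<open>Y\<close>
  occurs, so that the inclusion of \<open>J\<close> into \<open>A\<close> is an instance as well.\<close>
locale jac_approx = coords R J K \<sigma> e a Y n \<iota>
  for R :: "('a, 'r) ring_scheme" (structure) and J and K :: "('k, 's) ring_scheme" and \<sigma> and e a
    and Y :: "('a, 'y) module" and n :: nat and \<iota> :: "nat \<Rightarrow> 'y \<Rightarrow> 'a" +
  assumes \<iota>_J: "i < n \<Longrightarrow> y \<in> carrier Y \<Longrightarrow> \<iota> i y \<in> J"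
    and \<iota>_J2: "(\<And>i. i < n \<Longrightarrow> z i \<in> J2) \<Longrightarrow> \<exists>y\<in>carrier Y. \<forall>i<n. \<iota> i y = z i"
    and ext: "extends R n Y \<iota>"
begin

lemma ext_rho:
  assumes "f \<in> lhom R Y A"
  obtains c where "\<And>i. i < n \<Longrightarrow> c i \<in> carrier R" "f = \<rho> c"
proof -
  obtain c where c: "\<forall>i<n. c i \<in> carrier R" "\<forall>y\<in>carrier Y. f y = lc A n (\<lambda>i. \<iota> i y) c"
    using ext assms unfolding extends_def by blast
  have "f = \<rho> c"
    by (rule extensionalityI[of _ "carrier Y"]) (use assms c in \<open>auto simp: lhom_regD rho_def\<close>)
  then show thesis using that c by blast
qed

lemma rho_surj: "\<rho> ` carrier (kfree n) = carrier (kdual Y)"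
proof (intro equalityI subsetI)
  fix f assume "f \<in> carrier (kdual Y)"
  then obtain c where "\<And>i. i < n \<Longrightarrow> c i \<in> carrier R" "f = \<rho> c" using ext_rho by auto
  then show "f \<in> \<rho> ` carrier (kfree n)"
    by (intro image_eqI[of _ _ "restrict c {..<n}"]) (auto simp: rho_restrict)
qed (use rho_lhom in auto)

text \<open>The free direction of an invertible coefficient maps onto \<open>A\<close>. Elements \<open>z\<close> for which all multiples
  of \<open>z\<close> in this direction belong to \<open>Y\<close> are therefore values of the map of rank one, and these lie on
  the line through \<open>s\<close>.\<close>
lemma rank_one_unit:
  assumes y: "mingen R J Y m y" and s: "s \<in> carrier R" "\<And>j. j \<in> J \<Longrightarrow> j \<otimes> s = \<zero>" and k: "k < m"
    and f: "\<And>a. (\<And>i. i < m \<Longrightarrow> a i \<in> carrier R) \<Longrightarrow> f (lc Y m a y) = lc A m a (\<lambda>i. if i = k then s else \<zero>)"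
    and c: "\<And>i. i < n \<Longrightarrow> c i \<in> carrier R" "f = \<rho> c" and i: "i < n" "c i \<notin> J"
    and z: "z \<in> carrier R" "\<And>u. u \<in> carrier R \<Longrightarrow> \<exists>w\<in>carrier Y. \<forall>j<n. \<iota> j w = (if j = i then z \<otimes> u else \<zero>)"
  shows "\<exists>\<kappa>\<in>carrier K. z = \<sigma> \<kappa> \<otimes> s"
proof -
  obtain u where u: "u \<in> carrier R" "u \<otimes> c i = \<one>" using J_inv[OF c(1)[OF i(1)] i(2)] by blast
  obtain w where w: "w \<in> carrier Y" "\<forall>j<n. \<iota> j w = (if j = i then z \<otimes> u else \<zero>)"
    using z(2)[OF u(1)] by blast
  have "f w = lc A n (\<lambda>j. if j = i then z \<otimes> u else \<zero>) c"
    using w c(2) by (simp add: rho_apply cong: lc_cong)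
  also have "\<dots> = z \<otimes> u \<otimes> c i" using A.lc_unit[OF i(1), of "z \<otimes> u" c] z(1) u c by simp
  also have "\<dots> = z" using u z(1) c i by (simp add: m_assoc)
  finally have fz: "f w = z" .
  obtain b where b: "\<And>i. i < m \<Longrightarrow> b i \<in> carrier R" "w = lc Y m b y"
    using gensE[OF mingen_gens[OF y] w(1)] by blast
  then have "z = lc A m b (\<lambda>i. if i = k then s else \<zero>)" using fz f by simp
  also have "\<dots> = b k \<otimes> s"
    using A.lc_single[of k m b "\<lambda>i. if i = k then s else \<zero>"] b s k by simp
  finally have zb: "z = b k \<otimes> s" .
  obtain \<kappa> j where \<kappa>: "\<kappa> \<in> carrier K" "j \<in> J" "b k = \<sigma> \<kappa> \<oplus> j" using \<sigma>_split[OF b(1)[OF k]] by blast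
  then have "z = \<sigma> \<kappa> \<otimes> s" using zb s by (simp add: l_distr J_carr)
  then show ?thesis using \<kappa> by blast
qed

lemma J2_direction:
  assumes "z \<in> J2" "u \<in> carrier R"
  shows "\<exists>w\<in>carrier Y. \<forall>j<n. \<iota> j w = (if j = i then z \<otimes> u else \<zero>)"
  by (rule \<iota>_J2) (use assms J2_rmult J2_zero in auto)

lemma rank_one_exists:
  assumes y: "mingen R J Y m y" and s: "s \<in> carrier R" "\<And>j. j \<in> J \<Longrightarrow> j \<otimes> s = \<zero>"
  obtains f c where "f \<in> lhom R Y A" "\<And>i. i < m \<Longrightarrow> f (y i) = (if i = k then s else \<zero>)"
    "\<And>a. (\<And>i. i < m \<Longrightarrow> a i \<in> carrier R) \<Longrightarrow> f (lc Y m a y) = lc A m a (\<lambda>i. if i = k then s else \<zero>)"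
    "\<And>i. i < n \<Longrightarrow> c i \<in> carrier R" "f = \<rho> c"
proof -
  obtain f where f: "f \<in> lhom R Y A" "\<And>i. i < m \<Longrightarrow> f (y i) = (if i = k then s else \<zero>)"
    "\<And>a. (\<And>i. i < m \<Longrightarrow> a i \<in> carrier R) \<Longrightarrow> f (lc Y m a y) = lc A m a (\<lambda>i. if i = k then s else \<zero>)"
    by (rule socle_lhom[OF Y y, of "\<lambda>i. if i = k then s else \<zero>"]) (use s J_carr in auto)
  moreover obtain c where "\<And>i. i < n \<Longrightarrow> c i \<in> carrier R" "f = \<rho> c" using ext_rho[OF f(1)] by blast
  ultimately show thesis using that by blast
qed

text \<open>If all coefficients of the map with value \<open>s\<close> lie in \<open>J\<close>, its values lie in \<open>J\<^sup>2\<close>. Otherwise a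
  nonzero element of \<open>J\<^sup>2\<close> is a multiple of \<open>s\<close>, and the scalar can be inverted.\<close>
lemma socle_eq_J2:
  assumes y: "mingen R J Y m y" and m: "0 < m" and nz: "\<exists>z\<in>J2. z \<noteq> \<zero>"
    and s: "s \<in> carrier R" "\<And>j. j \<in> J \<Longrightarrow> j \<otimes> s = \<zero>"
  shows "s \<in> J2"
proof -
  obtain f c where f: "f \<in> lhom R Y A" "\<And>i. i < m \<Longrightarrow> f (y i) = (if i = 0 then s else \<zero>)"
    "\<And>a. (\<And>i. i < m \<Longrightarrow> a i \<in> carrier R) \<Longrightarrow> f (lc Y m a y) = lc A m a (\<lambda>i. if i = 0 then s else \<zero>)"
    and c: "\<And>i. i < n \<Longrightarrow> c i \<in> carrier R" "f = \<rho> c"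
    using rank_one_exists[OF y s, of 0] by blast
  have yY: "y 0 \<in> carrier Y" using gensD[OF mingen_gens[OF y] m] .
  show ?thesis
  proof (cases "\<forall>i<n. c i \<in> J")
    case True
    then have "lc A n (\<lambda>i. \<iota> i (y 0)) c \<in> J2" using \<iota>_J yY by (intro lcA_J2) auto
    then show ?thesis using f(2)[OF m] c(2) yY by (simp add: rho_apply)
  next
    case False
    then obtain i where i: "i < n" "c i \<notin> J" by blast
    obtain z where z: "z \<in> J2" "z \<noteq> \<zero>" using nz by blast
    obtain \<kappa> where \<kappa>: "\<kappa> \<in> carrier K" "z = \<sigma> \<kappa> \<otimes> s"
      using rank_one_unit[OF y s m f(3) c i J2_carr[OF z(1)] J2_direction[OF z(1)]] by blast
    then have "\<sigma> \<kappa> \<noteq> \<zero>" using z s by auto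
    then obtain d where d: "d \<in> carrier K" "\<sigma> d \<otimes> \<sigma> \<kappa> = \<one>" using \<sigma>_inv \<kappa>(1) by blast
    have "\<sigma> d \<otimes> z = s" using \<kappa> d s by (simp flip: m_assoc)
    then show ?thesis using J2_lmult[of "\<sigma> d" z] d z by simp
  qed
qed

end

text \<open>When \<open>J\<^sup>2\<close> is not contained in a line, maps of rank one into the socle have coefficients in \<open>J\<close>, by
  \<open>rank_one_unit\<close>.\<close>
locale wide_approx = jac_approx +
  fixes m y
  assumes J2_not_in_line: "\<not> (\<exists>s\<in>carrier R. \<forall>z\<in>J2. \<exists>\<kappa>\<in>carrier K. z = \<sigma> \<kappa> \<otimes> s)"
    and y: "mingen R J Y m y"
begin

lemma yY: "i < m \<Longrightarrow> y i \<in> carrier Y" using gensD[OF mingen_gens[OF y]] .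

lemma nz: "\<exists>z\<in>J2. z \<noteq> \<zero>"
proof (rule ccontr)
  assume "\<not> (\<exists>z\<in>J2. z \<noteq> \<zero>)"
  then have "\<forall>z\<in>J2. \<exists>\<kappa>\<in>carrier K. z = \<sigma> \<kappa> \<otimes> \<zero>" by (intro ballI bexI[of _ "\<zero>\<^bsub>K\<^esub>"]) (auto simp: \<sigma>_zero)
  then show False using J2_not_in_line zero_closed by blast
qed

text \<open>Every homomorphism into \<open>J\<^sup>2\<close> is a sum of maps of rank one, and by
  \<open>rank_one_unit\<close> these come from coefficients in the radical.\<close>
lemma rho_J_onto:
  assumes f: "f \<in> lhom R Y A" "\<And>i. i < m \<Longrightarrow> f (y i) \<in> J2"
  obtains c where "\<And>i. i < n \<Longrightarrow> c i \<in> J" "f = \<rho> c"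
proof -
  \<comment> \<open>correct the values on the generators one at a time\<close>
  have "\<exists>c. (\<forall>i<n. c i \<in> J) \<and> (\<forall>i<m. \<rho> c (y i) = (if i < k then f (y i) else \<zero>))" if "k \<le> m" for k
    using that
  proof (induction k)
    case 0
    have "\<rho> (\<lambda>i. \<zero>) (y i) = \<zero>" if "i < m" for i
      using A.lc_eq_zeroI[of n "\<lambda>j. \<iota> j (y i)" "\<lambda>_. \<zero>"] \<iota>_closed yY[OF that] by (simp add: rho_apply)
    then show ?case using J_zero by (intro exI[of _ "\<lambda>_. \<zero>"]) simp
  next
    case (Suc k)
    then obtain c where c: "\<forall>i<n. c i \<in> J" "\<forall>i<m. \<rho> c (y i) = (if i < k then f (y i) else \<zero>)" by auto
    have k: "k < m" using Suc by simp
    have s: "f (y k) \<in> carrier R" "\<And>j. j \<in> J \<Longrightarrow> j \<otimes> f (y k) = \<zero>"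
      using f(2)[OF k] J2_carr J_J2 by auto
    obtain g d where g: "g \<in> lhom R Y A" "\<And>i. i < m \<Longrightarrow> g (y i) = (if i = k then f (y k) else \<zero>)"
      "\<And>a. (\<And>i. i < m \<Longrightarrow> a i \<in> carrier R) \<Longrightarrow> g (lc Y m a y) = lc A m a (\<lambda>i. if i = k then f (y k) else \<zero>)"
      and d: "\<And>i. i < n \<Longrightarrow> d i \<in> carrier R" "g = \<rho> d"
      using rank_one_exists[OF y s, of k] by blast
    have dJ: "d i \<in> J" if i: "i < n" for i
    proof (rule ccontr)
      assume "d i \<notin> J"
      then have "\<forall>z\<in>J2. \<exists>\<kappa>\<in>carrier K. z = \<sigma> \<kappa> \<otimes> f (y k)"
        using rank_one_unit[OF y s k g(3) d i _ J2_carr J2_direction] by blast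
      then show False using J2_not_in_line s(1) by blast
    qed
    have "\<rho> (\<lambda>i. c i \<oplus> d i) (y i) = (if i < Suc k then f (y i) else \<zero>)" if i: "i < m" for i
    proof -
      have "\<rho> (\<lambda>i. c i \<oplus> d i) (y i) = \<rho> c (y i) \<oplus> \<rho> d (y i)"
        using c(1) dJ J_carr yY[OF i] by (intro rho_add) auto
      then show ?thesis using c(2) g(2)[OF i] d(2) i lhom_regD(1)[OF f(1) yY[OF i]] s by auto
    qed
    then show ?case using c(1) dJ J_add by (intro exI[of _ "\<lambda>i. c i \<oplus> d i"]) simp
  qed
  from this[of m] obtain c where c: "\<forall>i<n. c i \<in> J" "\<forall>i<m. \<rho> c (y i) = f (y i)" by auto
  have "f = \<rho> c"
    by (rule lhom_eqI[OF Y A.left_module_axioms mingen_gens[OF y] f(1) rho_lhom]) (use c J_carr in auto)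
  then show thesis using that c by blast
qed

definition "V = {f \<in> lhom R Y A. \<forall>w\<in>carrier Y. f w \<in> J2}"

lemma V_iff: "f \<in> V \<longleftrightarrow> f \<in> lhom R Y A \<and> (\<forall>i<m. f (y i) \<in> J2)"
proof safe
  assume f: "f \<in> lhom R Y A" and v: "\<forall>i<m. f (y i) \<in> J2"
  interpret f: lin_map R Y A f
    by (intro lin_mapI Y A.left_module_axioms lhom_lin f)
  have "f w \<in> J2" if w: "w \<in> carrier Y" for w
  proof -
    obtain b where b: "\<And>i. i < m \<Longrightarrow> b i \<in> carrier R" "w = lc Y m b y"
      using gensE[OF mingen_gens[OF y] w] by blast
    then have "f w = lc A m b (\<lambda>i. f (y i))" using yY by (simp add: f.f_lc)
    also have "\<dots> \<in> J2" by (rule A.lc_in_submodule[OF J2_submodule]) (use b v J2_lmult in auto)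
    finally show ?thesis .
  qed
  then show "f \<in> V" using f by (simp add: V_def)
qed (auto simp: V_def yY)

lemma V_submodule: "submodule V K (kdual Y)"
proof -
  interpret D: left_module K "kdual Y" by (rule kdual_left_module[OF Y])
  show ?thesis
  proof (rule D.submoduleI)
    show "V \<subseteq> carrier (kdual Y)" by (auto simp: V_def)
    then have VD: "f \<in> carrier (kdual Y)" if "f \<in> V" for f using that by blast
    show "\<zero>\<^bsub>kdual Y\<^esub> \<in> V" using D.M.zero_closed by (simp add: V_def J2_zero)
    show "f \<oplus>\<^bsub>kdual Y\<^esub> g \<in> V" if "f \<in> V" "g \<in> V" for f g
      using D.M.a_closed[OF VD[OF that(1)] VD[OF that(2)]] that by (simp add: V_def J2_add)
    show "c \<odot>\<^bsub>kdual Y\<^esub> f \<in> V" if "c \<in> carrier K" "f \<in> V" for c f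
      using D.smult_closed[OF that(1) VD[OF that(2)]] that by (simp add: V_def J2_rmult)
  qed
qed

lemma dim_V: "mod_length K (sub_mod (kdual Y) V) = enat (m * a)"
proof -
  have "ev m y ` V = {..<m} \<rightarrow>\<^sub>E J2"
  proof (intro equalityI subsetI)
    fix v assume v: "v \<in> {..<m} \<rightarrow>\<^sub>E J2"
    then have vJ: "v i \<in> J2" if "i < m" for i using that by auto
    obtain f where f: "f \<in> lhom R Y A" "\<And>i. i < m \<Longrightarrow> f (y i) = v i"
      by (rule socle_lhom[OF Y y, of v]) (use vJ J2_carr J_J2 in auto)
    then have "f \<in> V" using vJ by (simp add: V_iff)
    moreover have "v = ev m y f" using f v by (auto simp: ev_def fun_eq_iff PiE_iff extensional_def)
    ultimately show "v \<in> ev m y ` V" by blast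
  next
    fix v assume "v \<in> ev m y ` V"
    then obtain f where "f \<in> V" "v = ev m y f" by blast
    then show "v \<in> {..<m} \<rightarrow>\<^sub>E J2" by (simp add: V_iff ev_def)
  qed
  then have "mod_length K (sub_mod (kdual Y) V) = mod_length K (sub_mod (kfree m) ({..<m} \<rightarrow>\<^sub>E J2))"
    by (rule dimK_ev[OF Y mingen_gens[OF y] V_submodule])
  also have "\<dots> = dimK (pow_mod (sub_mod A J2) m)" by (simp add: sub_mod_kmod sub_mod_pow_mod)
  also have "\<dots> = enat (m * a)"
    using dimK_pow[OF A.sub_mod_left_module[OF J2_submodule]] by (simp add: dimK_J2)
  finally show ?thesis .
qed

lemma rho_V_iff:
  assumes c: "\<And>i. i < n \<Longrightarrow> c i \<in> carrier R"
  shows "\<rho> c \<in> V \<longleftrightarrow> (\<forall>i<n. c i \<in> J)"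
proof
  assume "\<forall>i<n. c i \<in> J"
  then have "\<rho> c w \<in> J2" if "w \<in> carrier Y" for w
    using \<iota>_J that unfolding rho_apply[OF that] by (intro lcA_J2) auto
  then show "\<rho> c \<in> V" using rho_lhom[OF c] by (simp add: V_def)
next
  assume "\<rho> c \<in> V"
  then obtain d where d: "\<And>i. i < n \<Longrightarrow> d i \<in> J" "\<rho> c = \<rho> d" using rho_J_onto[of "\<rho> c"] V_iff by blast
  show "\<forall>i<n. c i \<in> J"
  proof (intro allI impI, rule ccontr)
    fix i assume i: "i < n" "c i \<notin> J"
    have "c i = (c i \<ominus> d i) \<oplus> d i" using c[OF i(1)] d(1)[OF i(1)] A.mod_minus_add[of "c i" "d i"]
      by (simp add: J_carr a_minus_def a_assoc l_neg)
    then have "c i \<ominus> d i \<notin> J" using i J_add d(1) by metis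
    then obtain u where u: "u \<in> carrier R" "(c i \<ominus> d i) \<otimes> u = \<one>"
      using J_inv[of "c i \<ominus> d i"] c d i J_carr by auto
    \<comment> \<open>evaluate both maps at an element of \<open>J\<^sup>2\<close> in the \<open>i\<close>-th direction\<close>
    obtain z where z: "z \<in> J2" "z \<noteq> \<zero>" using nz by blast
    have "\<exists>w\<in>carrier Y. \<forall>j<n. \<iota> j w = (if j = i then z else \<zero>)"
      by (rule \<iota>_J2) (use z J2_zero in auto)
    then obtain w where w: "w \<in> carrier Y" "\<forall>j<n. \<iota> j w = (if j = i then z else \<zero>)" by blast
    have r: "\<rho> b w = z \<otimes> b i" if "\<And>i. i < n \<Longrightarrow> b i \<in> carrier R" for b
    proof -
      have "\<rho> b w = lc A n (\<lambda>j. if j = i then z else \<zero>) b" using w by (simp add: rho_apply cong: lc_cong)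
      then show ?thesis using A.lc_unit[OF i(1), of z b] z that by (simp add: J2_carr)
    qed
    have "z \<otimes> c i = z \<otimes> d i" using r[of c] r[of d] d c J_carr by simp
    then have "z \<otimes> (c i \<ominus> d i) = \<zero>"
      using z c d i by (simp add: J2_carr J_carr a_minus_def r_distr r_minus r_neg)
    then have "z \<otimes> ((c i \<ominus> d i) \<otimes> u) = \<zero>"
      using z c d i u J_carr J2_carr by (metis m_assoc l_null minus_closed)
    then show False using u z J2_carr by simp
  qed
qed

text \<open>The dual of \<open>Y\<close> is an extension of the homomorphisms into \<open>J\<^sup>2\<close> by an \<open>n\<close>-dimensional space,
  the residues of the coefficients.\<close>
lemma dim_dual: "dimK (dual R Y) = enat (n + m * a)"
proof -
  interpret \<rho>: lin_map K "kfree n" "kdual Y" \<rho> by (rule rho_lin_map)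
  have "{c \<in> carrier (kfree n). \<rho> c \<in> V} = {..<n} \<rightarrow>\<^sub>E J"
  proof -
    have "c \<in> carrier (kfree n) \<and> \<rho> c \<in> V \<longleftrightarrow> c \<in> {..<n} \<rightarrow>\<^sub>E J" for c
      using rho_V_iff[of c] by (auto simp: PiE_iff J_carr)
    then show ?thesis by blast
  qed
  then have "dimK (free_mod R n) + enat (m * a) = dimK (pow_mod (sub_mod A J) n) + dimK (dual R Y)"
    using \<rho>.length_vimage[OF rho_surj V_submodule] dim_V by (simp add: sub_mod_kmod sub_mod_pow_mod)
  then show ?thesis
    using dimK_pow[OF A.left_module_axioms, of n] dimK_pow[OF A.sub_mod_left_module[OF J_submodule], of n]
    by (cases "dimK (dual R Y)") (auto simp: dimK_A dimK_J algebra_simps)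
qed

text \<open>The coefficients in \<open>J\<close> map onto the homomorphisms into \<open>J\<^sup>2\<close>, and those in \<open>J\<^sup>2\<close> act as zero.\<close>
lemma growth_le: "m * a \<le> n * e"
proof -
  interpret \<rho>: lin_map K "kfree n" "kdual Y" \<rho> by (rule rho_lin_map)
  let ?J = "{..<n} \<rightarrow>\<^sub>E J" and ?J2 = "{..<n} \<rightarrow>\<^sub>E J2"
  have Js: "submodule ?J K (kfree n)" "submodule ?J2 K (kfree n)"
    using S.kmod_submodule[OF free_left_module] A.pow_submodule J_submodule J2_submodule by auto
  have im: "\<rho> ` ?J = V"
  proof (intro equalityI subsetI)
    fix f assume "f \<in> V"
    then obtain d where d: "\<And>i. i < n \<Longrightarrow> d i \<in> J" "f = \<rho> d" using rho_J_onto[of f] V_iff by blast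
    then show "f \<in> \<rho> ` ?J" by (intro image_eqI[of _ _ "restrict d {..<n}"]) (auto simp: rho_restrict)
  qed (use rho_V_iff J_carr in \<open>auto simp: PiE_iff\<close>)
  interpret r: lin_map K "sub_mod (kfree n) ?J" "sub_mod (kdual Y) V" \<rho>
    by (intro lin_mapI \<rho>.X.sub_mod_left_module \<rho>.Y.sub_mod_left_module V_submodule Js
        lin_sub_mod \<rho>.lin) (use \<rho>.X.submoduleD(1)[OF Js(1)] im in auto)
  have k: "?J2 \<subseteq> r.ker"
  proof
    fix c assume c: "c \<in> ?J2"
    then have "\<rho> c = (\<lambda>y\<in>carrier Y. \<zero>)"
      unfolding rho_def using A.lc_eq_zeroI[of n _ c] J_J2 \<iota>_J by (intro restrict_ext) (auto simp: PiE_iff)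
    then show "c \<in> r.ker" using c J2_J by (auto simp: PiE_iff)
  qed
  have ks: "submodule r.ker K (sub_mod (kfree n) ?J)" by (rule r.ker_submodule)
  interpret kk: left_module K "sub_mod (kfree n) r.ker"
    using r.X.sub_mod_left_module[OF ks] by simp
  have J2k: "submodule ?J2 K (sub_mod (kfree n) r.ker)"
    using k Js(2) ks \<rho>.X.submodule_sub_mod \<rho>.X.submodule_trans[OF Js(1) ks] by blast
  have "dimK (pow_mod (sub_mod A J2) n) \<le> mod_length K (sub_mod (kfree n) r.ker)"
    using kk.length_submodule_le[OF J2k] by (simp add: sub_mod_kmod sub_mod_pow_mod)
  then have 1: "enat (n * a) \<le> mod_length K (sub_mod (kfree n) r.ker)"
    using dimK_pow[OF A.sub_mod_left_module[OF J2_submodule], of n] by (simp add: dimK_J2)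
  have "mod_length K (sub_mod (kfree n) ?J) = mod_length K (sub_mod (kfree n) r.ker) + enat (m * a)"
    using r.length_surj im dim_V by simp
  moreover have "mod_length K (sub_mod (kfree n) ?J) = enat (n * (e + a))"
    using dimK_pow[OF A.sub_mod_left_module[OF J_submodule], of n] by (simp add: sub_mod_kmod sub_mod_pow_mod dimK_J)
  ultimately have "enat (n * a) + enat (m * a) \<le> enat (n * (e + a))"
    using add_right_mono[OF 1, of "enat (m * a)"] by simp
  then show ?thesis by (simp add: algebra_simps)
qed

end

section \<open>Dimensions along a syzygy\<close>

lemma syzD:
  assumes "syz R J X n x Y \<iota>"
  shows "left_module R X" "left_module R Y" "mingen R J X n x" "\<And>i. i < n \<Longrightarrow> \<iota> i \<in> lhom R Y (reg_mod R)"
    "\<And>y. y \<in> carrier Y \<Longrightarrow> (\<And>i. i < n \<Longrightarrow> \<iota> i y = \<zero>\<^bsub>R\<^esub>) \<Longrightarrow> y = \<zero>\<^bsub>Y\<^esub>"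
    "\<And>y. y \<in> carrier Y \<Longrightarrow> lc X n (\<lambda>i. \<iota> i y) x = \<zero>\<^bsub>X\<^esub>"
    "\<And>a. (\<And>i. i < n \<Longrightarrow> a i \<in> carrier R) \<Longrightarrow> lc X n a x = \<zero>\<^bsub>X\<^esub> \<Longrightarrow> \<exists>y\<in>carrier Y. \<forall>i<n. \<iota> i y = a i"
  using assms unfolding syz_def by blast+

context short_alg
begin

definition J2_not_in_line :: bool where
  "J2_not_in_line \<longleftrightarrow> \<not> (\<exists>s\<in>carrier R. \<forall>z\<in>J2. \<exists>\<kappa>\<in>carrier K. z = \<sigma> \<kappa> \<otimes> s)"

lemma loewy2_J2:
  assumes X: "left_module R X" and l: "loewy2 J X" and z: "z \<in> J2" and x: "x \<in> carrier X"
  shows "z \<odot>\<^bsub>X\<^esub> x = \<zero>\<^bsub>X\<^esub>"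
  using z
proof induction
  interpret X: left_module R X by fact
  case (prod i j)
  then show ?case using l x by (simp add: loewy2_def X.smult_assoc J_carr)
next
  interpret X: left_module R X by fact
  case (sum u v)
  then show ?case using x J2_carr by (simp add: X.smult_l_distr)
qed

lemma syz_J:
  assumes s: "syz R J X n x Y \<iota>" and i: "i < n" and y: "y \<in> carrier Y"
  shows "\<iota> i y \<in> J"
proof (rule mingenD[OF syzD(3)[OF s] _ _ i])
  show "\<iota> i y \<in> carrier R" if "i < n" for i using lhom_regD(1)[OF syzD(4)[OF s that] y] .
  show "lc X n (\<lambda>i. \<iota> i y) x = \<zero>\<^bsub>X\<^esub>" using syzD(6)[OF s y] .
qed

lemma syz_loewy2:
  assumes s: "syz R J X n x Y \<iota>"
  shows "loewy2 J Y"
  unfolding loewy2_def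
proof (intro ballI)
  fix i j y assume ij: "i \<in> J" "j \<in> J" and y: "y \<in> carrier Y"
  interpret Y: left_module R Y by (rule syzD(2)[OF s])
  have "\<iota> k (i \<odot>\<^bsub>Y\<^esub> (j \<odot>\<^bsub>Y\<^esub> y)) = i \<otimes> (j \<otimes> \<iota> k y)" if "k < n" for k
    using lhom_regD[OF syzD(4)[OF s that]] ij y by (simp add: J_carr)
  then show "i \<odot>\<^bsub>Y\<^esub> (j \<odot>\<^bsub>Y\<^esub> y) = \<zero>\<^bsub>Y\<^esub>"
    using ij y syz_J[OF s] by (intro syzD(5)[OF s]) (auto simp: J_carr J_cube)
qed

lemma syz_J2:
  assumes s: "syz R J X n x Y \<iota>" and l: "loewy2 J X" and z: "\<And>i. i < n \<Longrightarrow> z i \<in> J2"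
  shows "\<exists>y\<in>carrier Y. \<forall>i<n. \<iota> i y = z i"
proof (rule syzD(7)[OF s])
  interpret X: left_module R X by (rule syzD(1)[OF s])
  show "lc X n z x = \<zero>\<^bsub>X\<^esub>"
    using loewy2_J2[OF X.left_module_axioms l z] gensD[OF mingen_gens[OF syzD(3)[OF s]]] by (intro X.lc_eq_zeroI) simp
qed (use z J2_carr in auto)

lemma syz_approx:
  assumes s: "syz R J X n x Y \<iota>" and l: "loewy2 J X" and e: "extends R n Y \<iota>"
  shows "jac_approx R J K \<sigma> e a Y n \<iota>"
proof (intro jac_approx.intro jac_approx_axioms.intro coords.intro coords_axioms.intro short_alg_axioms)
  show "\<exists>y\<in>carrier Y. \<forall>i<n. \<iota> i y = z i" if "\<And>i. i < n \<Longrightarrow> z i \<in> J2" for z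
    using syz_J2[OF s l] that by blast
qed (use syzD(2,4)[OF s] syz_J[OF s] e in auto)

lemma syz_length:
  assumes s: "syz R J X n x Y \<iota>"
  shows "mod_length R Y + mod_length R X = enat (n * (1 + e + a))"
proof -
  interpret X: left_module R X by (rule syzD(1)[OF s])
  interpret Y: left_module R Y by (rule syzD(2)[OF s])
  have g: "gens R X n x" using mingen_gens[OF syzD(3)[OF s]] .
  interpret l: lin_map R "free_mod R n" X "\<lambda>c. lc X n c x" using gensD[OF g] by (rule X.lc_lin_map)
  let ?i = "\<lambda>y. \<lambda>i\<in>{..<n}. \<iota> i y"
  note h = lhom_regD[OF syzD(4)[OF s]]
  interpret i: lin_map R Y "free_mod R n" ?i
    by (intro lin_mapI Y.left_module_axioms free_left_module)
      (auto simp: lin_def h fun_eq_iff)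
  have "i.ker \<subseteq> {\<zero>\<^bsub>Y\<^esub>}"
  proof
    fix y assume "y \<in> i.ker"
    then have y: "y \<in> carrier Y" "?i y = (\<lambda>i\<in>{..<n}. \<zero>)" by auto
    have "\<iota> i y = \<zero>" if "i < n" for i using fun_cong[OF y(2), of i] that by simp
    then show "y \<in> {\<zero>\<^bsub>Y\<^esub>}" using syzD(5)[OF s y(1)] by simp
  qed
  then have "mod_length R Y = mod_length R (sub_mod (free_mod R n) (?i ` carrier Y))" by (rule i.length_inj)
  moreover have "?i ` carrier Y = l.ker"
  proof (intro equalityI subsetI)
    fix c assume "c \<in> ?i ` carrier Y"
    then obtain y where y: "y \<in> carrier Y" "c = ?i y" by blast
    have "lc X n c x = lc X n (\<lambda>i. \<iota> i y) x" using y by (intro lc_cong) auto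
    then show "c \<in> l.ker" using y syzD(6)[OF s y(1)] h by auto
  next
    fix c assume "c \<in> l.ker"
    then have c: "c \<in> {..<n} \<rightarrow>\<^sub>E carrier R" "lc X n c x = \<zero>\<^bsub>X\<^esub>" by auto
    then obtain y where y: "y \<in> carrier Y" "\<forall>i<n. \<iota> i y = c i" using syzD(7)[OF s, of c] by auto
    then have "c = ?i y" using c(1) by (auto simp: fun_eq_iff PiE_iff extensional_def)
    then show "c \<in> ?i ` carrier Y" using y by blast
  qed
  ultimately have "mod_length R (free_mod R n) = mod_length R Y + mod_length R X"
    using l.length_surj X.gens_image[OF g] by simp
  then show ?thesis using A.length_pow[of n] by (simp add: len_A)
qed

lemma mingen_length:
  assumes X: "left_module R X" and g: "mingen R J X n x"
  shows "mod_length R X = mod_length R (sub_mod X (rad X)) + enat n"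
  using left_module.length_quot[OF X rad_submodule[OF X]] length_top[OF X g fin] by simp

text \<open>The embedding maps \<open>JY\<close> into \<open>J\<^sup>2A\<^sup>n\<close>; it is onto when \<open>JY\<close> contains everything in \<open>Y\<close> with
  coordinates in \<open>J\<^sup>2\<close>.\<close>
lemma syz_rad_length:
  assumes s: "syz R J X n x Y \<iota>"
  shows "mod_length R (sub_mod Y (rad Y)) \<le> enat (n * a)"
    and "loewy2 J X \<Longrightarrow> (\<And>u. u \<in> carrier Y \<Longrightarrow> (\<And>i. i < n \<Longrightarrow> \<iota> i u \<in> J2) \<Longrightarrow> u \<in> rad Y)
      \<Longrightarrow> mod_length R (sub_mod Y (rad Y)) = enat (n * a)"
proof -
  let ?N = "rad Y"
  let ?J2 = "{..<n} \<rightarrow>\<^sub>E J2"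
  interpret Y: left_module R Y by (rule syzD(2)[OF s])
  have N: "submodule ?N R Y" by (rule rad_submodule[OF syzD(2)[OF s]])
  have NY: "?N \<subseteq> carrier Y" using Y.submoduleD(1)[OF N] .
  let ?i = "\<lambda>y. \<lambda>i\<in>{..<n}. \<iota> i y"
  note h = lhom_regD[OF syzD(4)[OF s]]
  interpret F: left_module R "free_mod R n" by (rule free_left_module)
  interpret i: lin_map R Y "free_mod R n" ?i
    by (intro lin_mapI Y.left_module_axioms free_left_module)
      (auto simp: lin_def h fun_eq_iff)
  have J2s: "submodule ?J2 R (free_mod R n)" by (rule A.pow_submodule[OF J2_submodule])
  have sub: "?N \<subseteq> {y \<in> carrier Y. ?i y \<in> ?J2}"
  proof (rule smult_J_least[OF Y.left_module_axioms i.vimage_submodule[OF J2s]])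
    fix j y assume "j \<in> J" "y \<in> carrier Y"
    then show "j \<odot>\<^bsub>Y\<^esub> y \<in> {y \<in> carrier Y. ?i y \<in> ?J2}"
      using h J2I syz_J[OF s] by (auto simp: J_carr)
  qed
  interpret r: lin_map R "sub_mod Y ?N" "sub_mod (free_mod R n) ?J2" ?i
    by (intro lin_mapI Y.sub_mod_left_module N F.sub_mod_left_module J2s
        lin_sub_mod[OF i.lin NY]) (use sub in blast)
  have "r.ker \<subseteq> {\<zero>\<^bsub>sub_mod Y ?N\<^esub>}"
  proof
    fix y assume "y \<in> r.ker"
    then have y: "y \<in> carrier Y" "?i y = (\<lambda>i\<in>{..<n}. \<zero>)" using NY by auto
    have "\<iota> i y = \<zero>" if "i < n" for i using fun_cong[OF y(2), of i] that by simp
    then show "y \<in> {\<zero>\<^bsub>sub_mod Y ?N\<^esub>}" using syzD(5)[OF s y(1)] by simp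
  qed
  then have eq: "mod_length R (sub_mod Y ?N) = mod_length R (sub_mod (sub_mod (free_mod R n) ?J2) (?i ` ?N))"
    using r.length_inj by simp
  have lJ: "mod_length R (sub_mod (free_mod R n) ?J2) = enat (n * a)"
    using left_module.length_pow[OF A.sub_mod_left_module[OF J2_submodule], of n]
    by (simp add: sub_mod_pow_mod len_J2)
  have im: "submodule (?i ` ?N) R (sub_mod (free_mod R n) ?J2)"
    using r.image_submodule[OF r.X.submodule_carrier] by simp
  show "mod_length R (sub_mod Y ?N) \<le> enat (n * a)"
    using eq r.Y.length_submodule_le[OF im] lJ by simp
  assume l: "loewy2 J X" and al: "\<And>u. u \<in> carrier Y \<Longrightarrow> (\<And>i. i < n \<Longrightarrow> \<iota> i u \<in> J2) \<Longrightarrow> u \<in> ?N"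
  have "?i ` ?N = ?J2"
  proof (intro equalityI subsetI)
    fix z assume z: "z \<in> ?J2"
    then have zJ: "z i \<in> J2" if "i < n" for i using that by auto
    then obtain u where u: "u \<in> carrier Y" "\<forall>i<n. \<iota> i u = z i" using syz_J2[OF s l] by blast
    then have "u \<in> ?N" using al zJ by simp
    moreover have "z = ?i u" using u(2) z by (auto simp: fun_eq_iff PiE_iff extensional_def)
    ultimately show "z \<in> ?i ` ?N" by blast
  qed (use sub in blast)
  then show "mod_length R (sub_mod Y ?N) = enat (n * a)" using eq lJ by simp
qed

lemma syz_coords: "syz R J X n x Y \<iota> \<Longrightarrow> coords R J K \<sigma> e a Y n \<iota>"
  by (intro coords.intro coords_axioms.intro short_alg_axioms) (auto dest: syzD(2,4))

text \<open>A map from \<open>X\<close> to \<open>A\<close> is a vector of values on the generators that respects the relations, that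
  is a vector of coefficients which vanishes on \<open>Y\<close>.\<close>
lemma syz_dual_ker:
  assumes s: "syz R J X n x Y \<iota>"
  shows "dimK (dual R X)
    = mod_length K (sub_mod (kfree n) {c \<in> carrier (kfree n). rho R n Y \<iota> c = \<zero>\<^bsub>dual R Y\<^esub>})"
proof -
  interpret ap: coords R J K \<sigma> e a Y n \<iota> by (rule syz_coords[OF s])
  interpret X: left_module R X by (rule syzD(1)[OF s])
  have g: "gens R X n x" using mingen_gens[OF syzD(3)[OF s]] .
  note xX = gensD[OF g]
  interpret \<rho>: lin_map K "kfree n" "kdual Y" ap.\<rho> by (rule ap.rho_lin_map)
  interpret D: left_module K "kdual X" by (rule kdual_left_module[OF X.left_module_axioms])
  have "ev n x ` lhom R X A = \<rho>.ker"
  proof (intro equalityI subsetI)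
    fix c assume "c \<in> ev n x ` lhom R X A"
    then obtain f where f: "f \<in> lhom R X A" "c = ev n x f" by blast
    interpret f: lin_map R X A f
      by (intro lin_mapI X.left_module_axioms A.left_module_axioms lhom_lin f)
    have "lc A n (\<lambda>i. \<iota> i y) c = \<zero>" if y: "y \<in> carrier Y" for y
    proof -
      have "lc A n (\<lambda>i. \<iota> i y) c = lc A n (\<lambda>i. \<iota> i y) (\<lambda>i. f (x i))" using f by (intro lc_cong) (auto simp: ev_def)
      also have "\<dots> = f (lc X n (\<lambda>i. \<iota> i y) x)" using ap.\<iota>_closed y xX by (subst f.f_lc) auto
      finally show ?thesis using syzD(6)[OF s y] by simp
    qed
    then show "c \<in> \<rho>.ker" using f(2) f.f_closed xX by (auto simp: rho_def ev_def)
  next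
    fix c assume "c \<in> \<rho>.ker"
    then have c: "c \<in> {..<n} \<rightarrow>\<^sub>E carrier R" "ap.\<rho> c = (\<lambda>y\<in>carrier Y. \<zero>)" by auto
    have z: "lc A n (\<lambda>i. \<iota> i y) c = \<zero>" if "y \<in> carrier Y" for y
      using fun_cong[OF c(2), of y] that by (simp add: rho_def)
    obtain f where f: "f \<in> lhom R X A" "\<And>i. i < n \<Longrightarrow> f (x i) = c i"
    proof (rule X.lhom_of_gens[OF A.left_module_axioms g, of c])
      fix b assume "\<And>i. i < n \<Longrightarrow> b i \<in> carrier R" "lc X n b x = \<zero>\<^bsub>X\<^esub>"
      then obtain y where y: "y \<in> carrier Y" "\<forall>i<n. \<iota> i y = b i" using syzD(7)[OF s] by blast
      have "lc A n b c = lc A n (\<lambda>i. \<iota> i y) c" using y by (intro lc_cong) auto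
      then show "lc A n b c = \<zero>\<^bsub>A\<^esub>" using z y by simp
    qed (use c(1) in auto)
    then have "c = ev n x f" using c(1) by (auto simp: ev_def fun_eq_iff PiE_iff extensional_def)
    then show "c \<in> ev n x ` lhom R X A" using f by blast
  qed
  then have "ev n x ` carrier (kdual X) = \<rho>.ker" by simp
  from dimK_ev[OF X.left_module_axioms g D.submodule_carrier this]
  have "dimK (dual R X) = mod_length K (sub_mod (kfree n) \<rho>.ker)"
    unfolding sub_mod_simps(6) .
  then show ?thesis by simp
qed

lemma syz_dual:
  assumes s: "syz R J X n x Y \<iota>" and ap: "jac_approx R J K \<sigma> e a Y n \<iota>"
  shows "dimK (dual R X) + dimK (dual R Y) = enat (n * (1 + e + a))"
proof -
  interpret ap: jac_approx R J K \<sigma> e a Y n \<iota> by (rule ap)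
  interpret \<rho>: lin_map K "kfree n" "kdual Y" ap.\<rho> by (rule ap.rho_lin_map)
  show ?thesis
    using syz_dual_ker[OF s] \<rho>.length_surj[OF ap.rho_surj] dimK_pow[OF A.left_module_axioms, of n] by (simp add: dimK_A)
qed

text \<open>The left ideal generated by a nonzero element of \<open>J\<^sup>2\<close> is a line, of length at least one.\<close>
lemma J2_not_in_line_ge_2:
  assumes w: J2_not_in_line
  shows "2 \<le> a"
proof (rule ccontr)
  assume "\<not> 2 \<le> a"
  then have a: "a \<le> 1" by simp
  interpret T: left_module R "sub_mod A J2" by (rule A.sub_mod_left_module[OF J2_submodule])
  obtain s where s: "s \<in> J2" "s \<noteq> \<zero>"
  proof (rule ccontr)
    assume "\<not> thesis"
    then have "\<forall>z\<in>J2. \<exists>\<kappa>\<in>carrier K. z = \<sigma> \<kappa> \<otimes> \<zero>"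
      using that by (intro ballI bexI[of _ "\<zero>\<^bsub>K\<^esub>"]) (auto simp: \<sigma>_zero)
    then show False using w zero_closed unfolding J2_not_in_line_def by blast
  qed
  let ?U = "(\<lambda>r. r \<otimes> s) ` carrier R"
  interpret r: lin_map R A "sub_mod A J2" "\<lambda>r. r \<otimes> s"
    by (intro lin_mapI A.left_module_axioms T.left_module_axioms)
      (use s J2_lmult J2_carr in \<open>auto simp: lin_def l_distr m_assoc\<close>)
  have U: "submodule ?U R (sub_mod A J2)" using r.image_submodule[OF A.submodule_carrier] by simp
  interpret U: left_module R "sub_mod (sub_mod A J2) ?U" by (rule T.sub_mod_left_module[OF U])
  have "\<one> \<otimes> s \<in> ?U" by blast
  then have "mod_length R (sub_mod (sub_mod A J2) ?U) \<noteq> 0"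
    using s J2_carr by (subst U.mod_length_eq_0_iff) auto
  then have "mod_length R (sub_mod A J2) \<le> mod_length R (sub_mod (sub_mod A J2) ?U)"
    using a by (cases "mod_length R (sub_mod (sub_mod A J2) ?U)") (auto simp: len_J2 zero_enat_def)
  then have "?U = J2" using T.length_submodule_eqD[OF U] by (simp add: len_J2)
  have "\<forall>z\<in>J2. \<exists>\<kappa>\<in>carrier K. z = \<sigma> \<kappa> \<otimes> s"
  proof
    fix z assume "z \<in> J2"
    then obtain r where r: "r \<in> carrier R" "z = r \<otimes> s" using \<open>?U = J2\<close> by blast
    obtain \<kappa> j where \<kappa>: "\<kappa> \<in> carrier K" "j \<in> J" "r = \<sigma> \<kappa> \<oplus> j" using \<sigma>_split[OF r(1)] by blast
    then have "z = \<sigma> \<kappa> \<otimes> s" using r s J_J2 J2_carr by (simp add: l_distr J_carr)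
    then show "\<exists>\<kappa>\<in>carrier K. z = \<sigma> \<kappa> \<otimes> s" using \<kappa> by blast
  qed
  then show False using w s J2_carr unfolding J2_not_in_line_def by blast
qed

lemma rad_J: "ideal_smult (sub_mod A J) J J = J2"
proof (intro equalityI subsetI)
  fix z assume "z \<in> ideal_smult (sub_mod A J) J J"
  then show "z \<in> J2" by induction (auto intro: J2I J2_add)
next
  fix z assume "z \<in> J2"
  then show "z \<in> ideal_smult (sub_mod A J) J J"
  proof induction
    case (prod i j)
    then show ?case using ideal_smult.smult[of i J j J "sub_mod A J"] by simp
  next
    case (sum x y)
    then show ?case using ideal_smult.add[of x "sub_mod A J" J J y] by simp
  qed
qed

text \<open>If all homomorphisms from \<open>J\<close> to \<open>A\<close> were right multiplications, that is \<open>Ext\<^sup>1(k, A) = 0\<close>,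
  then the inclusion of \<open>J\<close> into \<open>A\<close> would violate the growth inequality.\<close>
lemma J_not_extends:
  assumes w: J2_not_in_line
  shows "\<not> extends R 1 (sub_mod A J) (\<lambda>_. \<lambda>q\<in>J. q)"
proof
  assume ext: "extends R 1 (sub_mod A J) (\<lambda>_. \<lambda>q\<in>J. q)"
  interpret JJ: left_module R "sub_mod A J" by (rule A.sub_mod_left_module[OF J_submodule])
  have ap: "jac_approx R J K \<sigma> e a (sub_mod A J) 1 (\<lambda>_. \<lambda>q\<in>J. q)"
  proof (intro jac_approx.intro jac_approx_axioms.intro coords.intro coords_axioms.intro short_alg_axioms JJ.left_module_axioms ext)
    show "(\<lambda>q\<in>J. q) \<in> lhom R (sub_mod A J) A" using JJ.lhom_regI[of "\<lambda>q. q"] J_carr by simp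
    show "(\<lambda>q\<in>J. q) q \<in> J" if "q \<in> carrier (sub_mod A J)" for q using that by simp
    show "\<exists>y\<in>carrier (sub_mod A J). \<forall>i<1. (\<lambda>q\<in>J. q) y = z i" if "\<And>i. i < 1 \<Longrightarrow> z i \<in> J2" for z :: "nat \<Rightarrow> 'a"
      using that[of 0] J2_J by (intro bexI[of _ "z 0"]) auto
  qed
  have "mod_length R (sub_mod A J) \<noteq> \<infinity>" by (simp add: len_J)
  then obtain m0 x0 where "gens R (sub_mod A J) m0 x0" using JJ.finite_length_gens by blast
  then obtain m y where y: "mingen R J (sub_mod A J) m y" using mingen_exists[OF JJ.left_module_axioms] by blast
  interpret wa: wide_approx R J K \<sigma> e a "sub_mod A J" 1 "\<lambda>_. \<lambda>q\<in>J. q" m y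
    by (intro wide_approx.intro wide_approx_axioms.intro ap y) (use w in \<open>simp add: J2_not_in_line_def\<close>)
  have "m = e" using length_top[OF JJ.left_module_axioms y fin] by (simp add: rad_J len_J_J2)
  moreover have "m \<noteq> 0"
  proof
    assume "m = 0"
    then have "carrier (sub_mod A J) \<subseteq> {\<zero>}" using mingen_gens[OF y] by (auto simp: gens_def)
    then show False using wa.nz J2_J by auto
  qed
  ultimately show False using wa.growth_le J2_not_in_line_ge_2[OF w] by auto
qed

text \<open>An element of the socle of \<open>Y\<close> outside its radical spans a direct summand isomorphic to
  the residue field, which would inherit from \<open>Y\<close> the extension property excluded above.\<close>
lemma aligned:
  assumes s: "syz R J X n x Y \<iota>" and t: "syz R J Y m y W \<kappa>"
    and ext: "extends R m W \<kappa>" and w: J2_not_in_line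
    and u: "u \<in> carrier Y" "\<And>i. i < n \<Longrightarrow> \<iota> i u \<in> J2"
  shows "u \<in> rad Y"
proof (rule ccontr)
  assume nu: "u \<notin> rad Y"
  interpret Y: left_module R Y by (rule syzD(2)[OF s])
  interpret W: left_module R W by (rule syzD(2)[OF t])
  interpret JJ: left_module R "sub_mod A J" by (rule A.sub_mod_left_module[OF J_submodule])
  note y = syzD(3)[OF t]
  note yY = gensD[OF mingen_gens[OF y]]
  note \<kappa>h = lhom_regD[OF syzD(4)[OF t]]
  have Ju: "j \<odot>\<^bsub>Y\<^esub> u = \<zero>\<^bsub>Y\<^esub>" if "j \<in> J" for j
    using u that lhom_regD(3)[OF syzD(4)[OF s]] J_J2 by (intro syzD(5)[OF s]) (auto simp: J_carr)
  obtain b where b: "\<And>i. i < m \<Longrightarrow> b i \<in> carrier R" "u = lc Y m b y"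
    using gensE[OF mingen_gens[OF y] u(1)] by blast
  then obtain k where k: "k < m" "b k \<notin> J" using mingen_rad_iff[OF Y.left_module_axioms y, of b] nu by blast
  obtain v where v: "v \<in> carrier R" "b k \<otimes> v = \<one>" using J_inv[OF b(1)[OF k(1)] k(2)] by blast
  have "\<exists>c. (\<forall>i<1. c i \<in> carrier R) \<and> (\<forall>q\<in>carrier (sub_mod A J). g q = lc A 1 (\<lambda>i. (\<lambda>q\<in>J. q) q) c)"
    if g: "g \<in> lhom R (sub_mod A J) A" for g
  proof -
    note gh = lhom_regD[OF g, simplified]
    have \<kappa>J: "\<kappa> k z \<otimes> v \<in> J" if "z \<in> carrier W" for z using syz_J[OF t k(1) that] v by (simp add: J_rmult)
    \<comment> \<open>transport \<open>g\<close> to the syzygy \<open>W\<close> of \<open>Y\<close> along the generator \<open>k\<close>, normalised so that \<open>u\<close> has coefficient one there\<close>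
    have "(\<lambda>z\<in>carrier W. g (\<kappa> k z \<otimes> v)) \<in> lhom R W A"
    proof (rule W.lhom_regI)
      fix z assume z: "z \<in> carrier W"
      show "g (\<kappa> k z \<otimes> v) \<in> carrier R" using gh(1) \<kappa>J[OF z] .
      show "g (\<kappa> k (z \<oplus>\<^bsub>W\<^esub> z') \<otimes> v) = g (\<kappa> k z \<otimes> v) \<oplus> g (\<kappa> k z' \<otimes> v)" if z': "z' \<in> carrier W" for z'
        using \<kappa>h[OF k(1)] z z' v gh(2)[OF \<kappa>J[OF z] \<kappa>J[OF z']] by (simp add: l_distr)
      show "g (\<kappa> k (r \<odot>\<^bsub>W\<^esub> z) \<otimes> v) = r \<otimes> g (\<kappa> k z \<otimes> v)" if r: "r \<in> carrier R" for r
        using \<kappa>h[OF k(1)] z r v gh(3)[OF r \<kappa>J[OF z]] by (simp add: m_assoc)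
    qed
    then obtain c where c: "\<forall>i<m. c i \<in> carrier R"
      "\<forall>z\<in>carrier W. (\<lambda>z\<in>carrier W. g (\<kappa> k z \<otimes> v)) z = lc A m (\<lambda>i. \<kappa> i z) c"
      using ext unfolding extends_def by blast
    have bc: "lc A m b c \<in> carrier R" using b c by (intro lcA_closed) auto
    have "g q = q \<otimes> lc A m b c" if q: "q \<in> J" for q
    proof -
      \<comment> \<open>\<open>Ju = 0\<close> yields relations with coefficients \<open>q b\<^sub>i\<close>\<close>
      have "lc Y m (\<lambda>i. q \<otimes> b i) y = \<zero>\<^bsub>Y\<^esub>"
        using b q yY Ju[OF q] by (simp add: Y.lc_smult J_carr)
      then obtain z where z: "z \<in> carrier W" "\<forall>i<m. \<kappa> i z = q \<otimes> b i"
        using syzD(7)[OF t, of "\<lambda>i. q \<otimes> b i"] b q by (auto simp: J_carr)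
      have "g q = g (\<kappa> k z \<otimes> v)" using z k v b q by (simp add: m_assoc J_carr)
      also have "\<dots> = lc A m (\<lambda>i. \<kappa> i z) c" using c(2) z(1) by simp
      also have "\<dots> = lc A m (\<lambda>i. q \<otimes> b i) c" using z by (intro lc_cong) auto
      also have "\<dots> = q \<otimes> lc A m b c" using A.lc_smult[of q m b c] b c q by (simp add: J_carr)
      finally show ?thesis .
    qed
    then show ?thesis using bc J_carr by (intro exI[of _ "\<lambda>_. lc A m b c"]) simp
  qed
  then have "extends R 1 (sub_mod A J) (\<lambda>_. \<lambda>q\<in>J. q)" unfolding extends_def by blast
  then show False using J_not_extends[OF w] by blast
qed

text \<open>Coefficients in \<open>J\<close> act as zero on \<open>Y = JA\<^sup>n\<close>, so a map of rank one involves an invertible one. Its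
  direction carries \<open>J\<close>, which is the socle, into the line. If \<open>J = 0\<close>, the algebra itself is a line.\<close>
lemma semisimple_case:
  assumes s: "syz R J X n x Y \<iota>" and ext: "extends R n Y \<iota>" and n: "0 < n"
    and J0: "J2 = {\<zero>}" and X0: "\<And>j x. j \<in> J \<Longrightarrow> x \<in> carrier X \<Longrightarrow> j \<odot>\<^bsub>X\<^esub> x = \<zero>\<^bsub>X\<^esub>"
    and Yg: "mingen R J Y m y"
  shows "\<exists>s\<in>carrier R. \<forall>z\<in>carrier R. (\<forall>j\<in>J. j \<otimes> z = \<zero>) \<longrightarrow> (\<exists>\<kappa>\<in>carrier K. z = \<sigma> \<kappa> \<otimes> s)"
proof (cases "J = {\<zero>}")
  case True
  have "\<exists>\<kappa>\<in>carrier K. z = \<sigma> \<kappa> \<otimes> \<one>" if "z \<in> carrier R" for z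
    using \<sigma>_split[OF that] True by fastforce
  then show ?thesis by blast
next
  case False
  have JJ: "i \<otimes> j = \<zero>" if "i \<in> J" "j \<in> J" for i j using J2I[OF that] J0 by simp
  obtain s0 where s0: "s0 \<in> J" "s0 \<noteq> \<zero>" using False J_zero by blast
  interpret X: left_module R X by (rule syzD(1)[OF s])
  interpret ap: jac_approx R J K \<sigma> e a Y n \<iota>
    by (rule syz_approx[OF s _ ext]) (use X0 X.smult_closed J_carr in \<open>auto simp: loewy2_def\<close>)
  note xX = gensD[OF mingen_gens[OF syzD(3)[OF s]]]
  have dir: "\<exists>w\<in>carrier Y. \<forall>j<n. \<iota> j w = (if j = i then z else \<zero>)" if "z \<in> J" for i z
    using that X0 xX J_carr by (intro syzD(7)[OF s] X.lc_eq_zeroI) auto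
  have m: "0 < m"
  proof (rule ccontr)
    assume "\<not> 0 < m"
    then have Y0: "carrier Y \<subseteq> {\<zero>\<^bsub>Y\<^esub>}" using mingen_gens[OF Yg] by (auto simp: gens_def)
    obtain w where "w \<in> carrier Y" "\<forall>j<n. \<iota> j w = (if j = 0 then s0 else \<zero>)" using dir[OF s0(1)] by blast
    moreover have "\<iota> 0 \<zero>\<^bsub>Y\<^esub> = \<zero>"
      using ap.\<iota>_hom[OF n] lin_map.f_zero[OF lin_map.intro[OF ap.Y A.left_module_axioms lin_map_axioms.intro[OF lhom_lin]]]
      by fastforce
    ultimately show False using Y0 n s0 by auto
  qed
  have s0': "s0 \<in> carrier R" "\<And>j. j \<in> J \<Longrightarrow> j \<otimes> s0 = \<zero>" using s0 J_carr JJ by auto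
  obtain f c where f: "f \<in> lhom R Y A" "\<And>i. i < m \<Longrightarrow> f (y i) = (if i = 0 then s0 else \<zero>)"
    "\<And>a. (\<And>i. i < m \<Longrightarrow> a i \<in> carrier R) \<Longrightarrow> f (lc Y m a y) = lc A m a (\<lambda>i. if i = 0 then s0 else \<zero>)"
    and c: "\<And>i. i < n \<Longrightarrow> c i \<in> carrier R" "f = ap.\<rho> c"
    using ap.rank_one_exists[OF Yg s0', of 0] by blast
  have y0: "y 0 \<in> carrier Y" using gensD[OF mingen_gens[OF Yg] m] .
  obtain i where i: "i < n" "c i \<notin> J"
  proof (rule ccontr)
    assume "\<not> thesis"
    then have "lc A n (\<lambda>i. \<iota> i (y 0)) c \<in> J2" using that ap.\<iota>_J y0 by (intro lcA_J2) auto
    then show False using f(2)[OF m] c(2) y0 s0 J0 by (simp add: ap.rho_apply)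
  qed
  have "\<exists>\<kappa>\<in>carrier K. z = \<sigma> \<kappa> \<otimes> s0" if z: "z \<in> carrier R" "\<forall>j\<in>J. j \<otimes> z = \<zero>" for z
  proof -
    have "z \<in> J"
    proof (rule ccontr)
      assume "z \<notin> J"
      then obtain v where v: "v \<in> carrier R" "z \<otimes> v = \<one>" using J_inv z(1) by blast
      have "s0 = s0 \<otimes> (z \<otimes> v)" using v s0' by simp
      also have "\<dots> = (s0 \<otimes> z) \<otimes> v" using m_assoc[of s0 z v] v z s0' by simp
      also have "\<dots> = \<zero>" using z(2) s0(1) v(1) by simp
      finally show False using s0(2) by simp
    qed
    then show ?thesis
      using ap.rank_one_unit[OF Yg s0' m f(3) c i z(1)] dir J_rmult by blast
  qed
  then show ?thesis using s0' by blast
qed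

end

section \<open>Self-injectivity\<close>

lemma lhom_factor:
  assumes Y: "left_module R Y" and Z: "left_module R Z" and N: "submodule N R Y"
    and h: "h \<in> lhom R Y Z" "\<And>y. y \<in> N \<Longrightarrow> h y = \<zero>\<^bsub>Z\<^esub>"
  obtains g where "g \<in> lhom R (quot_mod Y N) Z" "\<And>y. y \<in> carrier Y \<Longrightarrow> g (N +>\<^bsub>Y\<^esub> y) = h y"
proof -
  interpret Y: left_module R Y by fact
  interpret h: lin_map R Y Z h by (intro lin_mapI Y Z lhom_lin h)
  define g where "g = (\<lambda>z\<in>carrier (quot_mod Y N). h (SOME y. y \<in> carrier Y \<and> z = N +>\<^bsub>Y\<^esub> y))"
  have g: "g (N +>\<^bsub>Y\<^esub> y) = h y" if y: "y \<in> carrier Y" for y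
  proof -
    define w where "w = (SOME w. w \<in> carrier Y \<and> N +>\<^bsub>Y\<^esub> y = N +>\<^bsub>Y\<^esub> w)"
    have w: "w \<in> carrier Y" "N +>\<^bsub>Y\<^esub> y = N +>\<^bsub>Y\<^esub> w"
      unfolding w_def using someI[of "\<lambda>w. w \<in> carrier Y \<and> N +>\<^bsub>Y\<^esub> y = N +>\<^bsub>Y\<^esub> w" y] y by auto
    then have "h (w \<ominus>\<^bsub>Y\<^esub> y) = \<zero>\<^bsub>Z\<^esub>" using Y.quot_eq_iff[OF N, of w y] y h(2) by simp
    then have "h w \<ominus>\<^bsub>Z\<^esub> h y = \<zero>\<^bsub>Z\<^esub>" using w y by (simp add: h.f_minus)
    then have "h w = h y" using h.Y.mod_minus_add[of "h w" "h y"] w y by simp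
    then show ?thesis using y by (simp add: g_def Y.quot_carrier w_def[symmetric])
  qed
  have "g \<in> lhom R (quot_mod Y N) Z"
    unfolding lhom_def
  proof (intro CollectI conjI ballI)
    have "g z \<in> carrier Z" if "z \<in> carrier (quot_mod Y N)" for z
      using that g by (auto simp: Y.quot_carrier)
    then show "g \<in> carrier (quot_mod Y N) \<rightarrow>\<^sub>E carrier Z" by (auto simp: g_def)
  next
    fix z w assume "z \<in> carrier (quot_mod Y N)" "w \<in> carrier (quot_mod Y N)"
    then show "g (z \<oplus>\<^bsub>quot_mod Y N\<^esub> w) = g z \<oplus>\<^bsub>Z\<^esub> g w"
      by (auto simp: Y.quot_carrier Y.quot_add[OF N] g h.f_add)
  next
    fix r z assume "r \<in> carrier R" "z \<in> carrier (quot_mod Y N)"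
    then show "g (r \<odot>\<^bsub>quot_mod Y N\<^esub> z) = r \<odot>\<^bsub>Z\<^esub> g z"
      by (auto simp: Y.quot_carrier Y.quot_smult[OF N] g h.f_smult)
  qed
  then show thesis using that g by blast
qed

context short_alg
begin

definition socle_in_line :: bool where
  "socle_in_line \<longleftrightarrow> (\<exists>s\<in>carrier R. \<forall>z\<in>carrier R. (\<forall>j\<in>J. j \<otimes> z = \<zero>) \<longrightarrow> (\<exists>\<kappa>\<in>carrier K. z = \<sigma> \<kappa> \<otimes> s))"

lemma precompose_lin_map:
  assumes Z: "left_module R Z" and Y: "left_module R Y" and i: "lin R Z Y i"
  shows "lin_map K (kdual Y) (kdual Z) (\<lambda>h. \<lambda>z\<in>carrier Z. h (i z))"
proof (intro lin_mapI kdual_left_module Y Z)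
  interpret i: lin_map R Z Y i by (intro lin_mapI Y Z i)
  show "lin K (kdual Y) (kdual Z) (\<lambda>h. \<lambda>z\<in>carrier Z. h (i z))"
    unfolding lin_def
  proof (intro conjI ballI funcsetI)
    fix h assume "h \<in> carrier (kdual Y)"
    then have "h \<in> lhom R Y A" by simp
    then show "(\<lambda>z\<in>carrier Z. h (i z)) \<in> carrier (kdual Z)"
      using lin_restrict[OF Z lin_comp[OF i.lin lhom_lin]] by simp
  qed (auto simp: fun_eq_iff)
qed

text \<open>Over itself the ground field has length one, and the line is an image of it.\<close>
lemma dimK_line:
  assumes s: "s \<in> carrier R"
  defines "L \<equiv> (\<lambda>\<kappa>. \<sigma> \<kappa> \<otimes> s) ` carrier K"
  shows "submodule L K (kmod \<sigma> A)" "mod_length K (sub_mod (kmod \<sigma> A) L) \<le> 1"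
proof -
  interpret KK: left_module K "reg_mod K" by (rule reg_mod_left_module[OF S.K.ring_axioms])
  interpret kA: left_module K "kmod \<sigma> A" by (rule S.kmod_left_module[OF A.left_module_axioms])
  interpret KF: field K by (rule K_field)
  interpret t: lin_map K "reg_mod K" "kmod \<sigma> A" "\<lambda>\<kappa>. \<sigma> \<kappa> \<otimes> s"
    by (intro lin_mapI KK.left_module_axioms kA.left_module_axioms)
      (use S.\<sigma>_hom s in \<open>auto simp: lin_def ring_hom_def l_distr m_assoc\<close>)
  interpret rK: rad_ring K "{\<zero>\<^bsub>K\<^esub>}"
  proof unfold_locales
    fix x assume "x \<in> carrier K" "x \<notin> {\<zero>\<^bsub>K\<^esub>}"
    then show "\<exists>y\<in>carrier K. y \<otimes>\<^bsub>K\<^esub> x = \<one>\<^bsub>K\<^esub> \<and> x \<otimes>\<^bsub>K\<^esub> y = \<one>\<^bsub>K\<^esub>"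
      by (intro bexI[of _ "inv\<^bsub>K\<^esub> x"]) (auto simp: KF.field_Units)
  qed auto
  have "mod_length K (sub_mod (reg_mod K) {\<zero>\<^bsub>K\<^esub>}) = 0"
    using left_module.mod_length_eq_0_iff[OF KK.sub_mod_left_module[OF KK.submodule_zero]] by simp
  then have "mod_length K (reg_mod K) = 1" using rK.length_R by simp
  then show "mod_length K (sub_mod (kmod \<sigma> A) L) \<le> 1"
    using t.length_image_le by (simp add: L_def)
  show "submodule L K (kmod \<sigma> A)" using t.image_submodule[OF KK.submodule_carrier] by (simp add: L_def)
qed

text \<open>Going down the radical series of \<open>Z\<close>, each top \<open>k\<^sup>n\<close> contributes at most the \<open>n\<close> values that the
  generators take in the socle.\<close>
lemma dual_length_le:
  assumes nw: socle_in_line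
  shows "left_module R Z \<Longrightarrow> mod_length R Z = enat l \<Longrightarrow> dimK (dual R Z) \<le> enat l"
proof (induction l arbitrary: Z rule: less_induct)
  case (less l)
  interpret Z: left_module R Z by (rule less.prems(1))
  interpret D: left_module K "kdual Z" by (rule kdual_left_module[OF less.prems(1)])
  have "mod_length R Z \<noteq> \<infinity>" using less.prems by simp
  then obtain n0 z0 where "gens R Z n0 z0" using Z.finite_length_gens by blast
  then obtain n z where z: "mingen R J Z n z" using mingen_exists[OF Z.left_module_axioms] by blast
  note g = mingen_gens[OF z]
  note zZ = gensD[OF g]
  show ?case
  proof (cases "n = 0")
    case True
    have "f = (\<lambda>x\<in>carrier Z. \<zero>)" if "f \<in> lhom R Z A" for f
    proof (rule ev_inj[OF Z.left_module_axioms g that])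
      show "ev n z f = (\<lambda>i\<in>{..<n}. \<zero>)" using True by (auto simp: ev_def)
    qed
    then have "lhom R Z A \<subseteq> {\<lambda>x\<in>carrier Z. \<zero>}" by blast
    moreover have "(\<lambda>x\<in>carrier Z. \<zero>) \<in> lhom R Z A" using D.M.zero_closed by simp
    ultimately have "lhom R Z A = {\<lambda>x\<in>carrier Z. \<zero>}" by blast
    then have "dimK (dual R Z) = 0"
      unfolding D.mod_length_eq_0_iff by (simp only: kmod_simps dual_simps)
    then show ?thesis by (simp only: zero_le)
  next
    case False
    let ?N = "rad Z"
    have N: "submodule ?N R Z" by (rule rad_submodule[OF Z.left_module_axioms])
    have NZ: "?N \<subseteq> carrier Z" by (rule Z.submoduleD(1)[OF N])
    have W: "left_module R (sub_mod Z ?N)" by (rule Z.sub_mod_left_module[OF N])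
    obtain w where w: "mod_length R (sub_mod Z ?N) = enat w" "w + n = l"
      using mingen_length[OF Z.left_module_axioms z] less.prems(2)
      by (cases "mod_length R (sub_mod Z ?N)") auto
    have IH: "dimK (dual R (sub_mod Z ?N)) \<le> enat w"
      by (rule less.IH[OF _ W w(1)]) (use w False in simp)
    have "lin R (sub_mod Z ?N) Z (\<lambda>x. x)" using NZ by (auto simp: lin_def)
    then interpret r: lin_map K "kdual Z" "kdual (sub_mod Z ?N)"
      "\<lambda>h. \<lambda>x\<in>carrier (sub_mod Z ?N). h x"
      by (rule precompose_lin_map[OF W Z.left_module_axioms])
    obtain s where s: "s \<in> carrier R" "\<forall>z\<in>carrier R. (\<forall>j\<in>J. j \<otimes> z = \<zero>) \<longrightarrow> (\<exists>\<kappa>\<in>carrier K. z = \<sigma> \<kappa> \<otimes> s)"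
      using nw unfolding socle_in_line_def by blast
    let ?L = "(\<lambda>\<kappa>. \<sigma> \<kappa> \<otimes> s) ` carrier K"
    let ?V = "ev n z ` r.ker"
    interpret kA: left_module K "kmod \<sigma> A" by (rule S.kmod_left_module[OF A.left_module_axioms])
    interpret kF: left_module K "kfree n" by (rule kfree_left_module)
    have kerlen: "mod_length K (sub_mod (kdual Z) r.ker) = mod_length K (sub_mod (kfree n) ?V)"
      by (rule dimK_ev[OF Z.left_module_axioms g r.ker_submodule refl])
    have Ls: "submodule ({..<n} \<rightarrow>\<^sub>E ?L) K (kfree n)"
      using kA.pow_submodule[OF dimK_line(1)[OF s(1)], of n] by (simp add: pow_mod_kmod)
    interpret ev: lin_map K "kdual Z" "kfree n" "ev n z"
      by (rule ev_lin_map[OF Z.left_module_axioms zZ])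
    have Vs: "submodule ?V K (kfree n)" by (rule ev.image_submodule[OF r.ker_submodule])
    have "?V \<subseteq> {..<n} \<rightarrow>\<^sub>E ?L"
    proof
      fix v assume "v \<in> ?V"
      then obtain f where f: "f \<in> lhom R Z A" "(\<lambda>x\<in>?N. f x) = (\<lambda>x\<in>?N. \<zero>)" "v = ev n z f" by auto
      have f0: "f x = \<zero>" if "x \<in> ?N" for x using fun_cong[OF f(2), of x] that by simp
      have "f (z i) \<in> ?L" if i: "i < n" for i
      proof -
        have "j \<otimes> f (z i) = \<zero>" if j: "j \<in> J" for j
          using lhom_regD(3)[OF f(1), of j "z i"] zZ[OF i] j f0[OF ideal_smult.smult[OF j zZ[OF i]]] J_carr by simp
        then show ?thesis using s(2) lhom_regD(1)[OF f(1) zZ[OF i]] by blast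
      qed
      then show "v \<in> {..<n} \<rightarrow>\<^sub>E ?L" using f(3) by (simp add: ev_def)
    qed
    then have "submodule ?V K (sub_mod (kfree n) ({..<n} \<rightarrow>\<^sub>E ?L))"
      using kF.submodule_sub_mod[OF Ls] Vs by blast
    from left_module.length_submodule_le[OF kF.sub_mod_left_module[OF Ls] this]
    have "mod_length K (sub_mod (kfree n) ?V)
        \<le> mod_length K (pow_mod (sub_mod (kmod \<sigma> A) ?L) n)"
      by (simp only: sub_mod_simps(5)) (simp only: pow_mod_kmod[symmetric] sub_mod_pow_mod)
    also have "\<dots> = enat n * mod_length K (sub_mod (kmod \<sigma> A) ?L)"
      by (rule left_module.length_pow[OF kA.sub_mod_left_module[OF dimK_line(1)[OF s(1)]]])
    also have "\<dots> \<le> enat n * 1" by (intro mult_left_mono dimK_line(2)[OF s(1)]) simp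
    finally have "mod_length K (sub_mod (kdual Z) r.ker) \<le> enat n" using kerlen by simp
    moreover have "mod_length K (sub_mod (kdual (sub_mod Z ?N))
        ((\<lambda>h. \<lambda>x\<in>carrier (sub_mod Z ?N). h x) ` carrier (kdual Z))) \<le> enat w"
      using r.Y.length_submodule_le[OF r.image_submodule[OF D.submodule_carrier]] IH by (rule order_trans)
    ultimately have "dimK (dual R Z) \<le> enat n + enat w"
      unfolding r.length_rank_nullity by (rule add_mono)
    then show ?thesis using w(2) by (simp add: add.commute)
  qed
qed

text \<open>Both \<open>Z\<close> and its syzygy satisfy the inequality, and for the free module in the middle
  equality holds, so there is no loss.\<close>
lemma dual_length_eq:
  assumes nw: socle_in_line and Z: "fl_module R Z"
  shows "dimK (dual R Z) = mod_length R Z"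
proof -
  obtain n x \<iota> where s: "syz R J Z n x (Omega R Z) \<iota>" using Omega_syz[OF Z] by blast
  have Zl: "left_module R Z" and Ol: "left_module R (Omega R Z)" using syzD(1,2)[OF s] by auto
  obtain z where z: "mod_length R Z = enat z" using Z by (auto simp: fl_module_def)
  obtain w where w: "mod_length R (Omega R Z) = enat w" using Omega_fl[OF Z] by (auto simp: fl_module_def)
  have zw: "w + z = n * (1 + e + a)" using syz_length[OF s] z w by simp
  interpret ap: coords R J K \<sigma> e a "Omega R Z" n \<iota> by (rule syz_coords[OF s])
  interpret \<rho>: lin_map K "kfree n" "kdual (Omega R Z)" ap.\<rho> by (rule ap.rho_lin_map)
  have "enat (n * (1 + e + a)) = dimK (dual R Z) + mod_length K (sub_mod (kdual (Omega R Z))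
      (ap.\<rho> ` carrier (kfree n)))"
    using \<rho>.length_rank_nullity syz_dual_ker[OF s] dimK_pow[OF A.left_module_axioms, of n]
    by (simp add: dimK_A)
  moreover have "mod_length K (sub_mod (kdual (Omega R Z))
      (ap.\<rho> ` carrier (kfree n))) \<le> enat w"
    using \<rho>.Y.length_submodule_le[OF \<rho>.image_submodule[OF \<rho>.X.submodule_carrier]] dual_length_le[OF nw Ol w]
    by (rule order_trans)
  moreover have "dimK (dual R Z) \<le> enat z" by (rule dual_length_le[OF nw Zl z])
  ultimately show ?thesis using zw z
    by (cases "dimK (dual R Z)"; cases "mod_length K (sub_mod (kdual (Omega R Z))
      (ap.\<rho> ` carrier (kfree n)))") auto
qed

text \<open>Restriction of maps from \<open>Y\<close> to a submodule \<open>Z\<close> has the dual of \<open>Y/Z\<close> as kernel. By the two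
  previous lemmas the lengths leave no room for a map on \<open>Z\<close> that does not extend.\<close>
theorem socle_in_line_self_injective:
  assumes nw: socle_in_line
  shows "self_injective R"
  unfolding self_injective_def injective_def
proof (intro conjI allI impI)
  show "fl_module R A" using A.left_module_axioms fin by (simp add: fl_module_def)
  fix Z Y :: "('a, nat \<Rightarrow> 'a) module" and i f
  assume H: "fl_module R Z \<and> fl_module R Y \<and> i \<in> lhom R Z Y \<and> inj_on i (carrier Z) \<and> f \<in> lhom R Z A"
  then have Z: "left_module R Z" and Y: "left_module R Y" by (auto simp: fl_module_def)
  obtain z where z: "mod_length R Z = enat z" using H by (auto simp: fl_module_def)
  obtain y where y: "mod_length R Y = enat y" using H by (auto simp: fl_module_def)
  interpret i: lin_map R Z Y i by (intro lin_mapI Z Y lhom_lin) (use H in blast)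
  let ?I = "i ` carrier Z"
  have I: "submodule ?I R Y" by (rule i.image_submodule[OF i.X.submodule_carrier])
  have "i.ker \<subseteq> {\<zero>\<^bsub>Z\<^esub>}"
  proof
    fix x assume x: "x \<in> i.ker"
    have "inj_on i (carrier Z)" using H by blast
    then have "x = \<zero>\<^bsub>Z\<^esub>" using x by (intro inj_onD[of i "carrier Z" x "\<zero>\<^bsub>Z\<^esub>"]) auto
    then show "x \<in> {\<zero>\<^bsub>Z\<^esub>}" by simp
  qed
  then have lI: "mod_length R (sub_mod Y ?I) = enat z" using i.length_inj z by simp
  interpret Q: left_module R "quot_mod Y ?I" by (rule i.Y.quot_left_module[OF I])
  obtain q where q: "mod_length R (quot_mod Y ?I) = enat q" "z + q = y"
    using i.Y.length_quot[OF I] lI y by (cases "mod_length R (quot_mod Y ?I)") auto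
  let ?p = "\<lambda>h. \<lambda>x\<in>carrier Z. h (i x)"
  interpret p: lin_map K "kdual Y" "kdual Z" ?p
    by (rule precompose_lin_map[OF Z Y i.lin])
  let ?c = "\<lambda>g. \<lambda>x\<in>carrier Y. g (?I +>\<^bsub>Y\<^esub> x)"
  interpret c: lin_map K "kdual (quot_mod Y ?I)" "kdual Y" ?c
    by (rule precompose_lin_map[OF Y Q.left_module_axioms i.Y.quot_lin[OF I]])
  let ?C = "?c ` carrier (kdual (quot_mod Y ?I))"
  have C: "submodule ?C K (kdual Y)" by (rule c.image_submodule[OF c.X.submodule_carrier])
  have "p.ker \<subseteq> ?C"
  proof
    fix h assume "h \<in> p.ker"
    then have h: "h \<in> lhom R Y A" "?p h = (\<lambda>x\<in>carrier Z. \<zero>)" by auto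
    have "h (i x) = \<zero>" if "x \<in> carrier Z" for x using fun_cong[OF h(2), of x] that by simp
    then have hI: "h y = \<zero>\<^bsub>A\<^esub>" if "y \<in> ?I" for y using that by auto
    obtain g where g: "g \<in> lhom R (quot_mod Y ?I) A" "\<And>x. x \<in> carrier Y \<Longrightarrow> g (?I +>\<^bsub>Y\<^esub> x) = h x"
      using lhom_factor[OF Y A.left_module_axioms I h(1) hI] by blast
    then have "h = ?c g" using lhom_regD(4)[OF h(1)] by (auto simp: fun_eq_iff extensional_def)
    then show "h \<in> ?C" using g by auto
  qed
  then have "submodule p.ker K (sub_mod (kdual Y) ?C)"
    using p.X.submodule_sub_mod[OF C] p.ker_submodule by blast
  from left_module.length_submodule_le[OF p.X.sub_mod_left_module[OF C] this]
  have "mod_length K (sub_mod (kdual Y) p.ker) \<le> mod_length K (sub_mod (kdual Y) ?C)"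
    by (simp only: sub_mod_simps(5))
  also have "\<dots> \<le> dimK (dual R (quot_mod Y ?I))"
    by (rule c.length_image_le)
  also have "\<dots> \<le> enat q" by (rule dual_length_le[OF nw Q.left_module_axioms q(1)])
  finally have kq: "mod_length K (sub_mod (kdual Y) p.ker) \<le> enat q" .
  let ?P = "?p ` carrier (kdual Y)"
  have P: "submodule ?P K (kdual Z)" by (rule p.image_submodule[OF p.X.submodule_carrier])
  have dZ: "dimK (dual R Z) = enat z" using dual_length_eq[OF nw, of Z] H z by simp
  have dY: "dimK (dual R Y) = enat y" using dual_length_eq[OF nw, of Y] H y by simp
  have "enat y = mod_length K (sub_mod (kdual Y) p.ker) + mod_length K (sub_mod (kdual Z) ?P)"
    using p.length_rank_nullity dY by (simp only:)
  then have "enat z \<le> mod_length K (sub_mod (kdual Z) ?P)"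
    using kq q(2) by (cases "mod_length K (sub_mod (kdual Y) p.ker)";
      cases "mod_length K (sub_mod (kdual Z) ?P)") auto
  then have "?P = carrier (kdual Z)"
    using p.Y.length_submodule_eqD[OF P] dZ by (simp only: enat.distinct not_False_eq_True)
  moreover have "f \<in> carrier (kdual Z)" using H by simp
  ultimately obtain h where "h \<in> lhom R Y A" "f = ?p h" by auto
  then show "\<exists>h\<in>lhom R Y A. compose (carrier Z) h i = f" by (auto simp: compose_def)
qed

end

section \<open>Minimal left approximations\<close>

context short_alg
begin

lemma lc_dual:
  assumes X: "left_module R X" and f: "\<And>i. i < n \<Longrightarrow> f i \<in> lhom R X A"
    and c: "\<And>i. i < n \<Longrightarrow> c i \<in> carrier R" and x: "x \<in> carrier X"
  shows "lc (dual R X) n c f x = lc A n (\<lambda>i. f i x) c"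
  using f c x by (induction n) auto

text \<open>Evaluation at generators embeds the dual into a space of finite dimension.\<close>
lemma dual_finite_length:
  assumes X: "fl_module R X"
  shows "mod_length (opp_ring R) (dual R X) \<noteq> \<infinity>"
proof -
  have Xl: "left_module R X" using X by (simp add: fl_module_def)
  obtain n x where g: "mingen R J X n x" using fl_mingen[OF X] .
  interpret D: left_module K "kdual X" by (rule kdual_left_module[OF Xl])
  interpret ev: lin_map K "kdual X" "kfree n" "ev n x"
    by (rule ev_lin_map[OF Xl gensD[OF mingen_gens[OF g]]])
  have "dimK (dual R X) = mod_length K (sub_mod (kfree n) (ev n x ` carrier (kdual X)))"
    using dimK_ev[OF Xl mingen_gens[OF g] D.submodule_carrier refl] unfolding sub_mod_simps(6) .
  also have "\<dots> \<le> dimK (free_mod R n)"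
    by (rule ev.Y.length_submodule_le[OF ev.image_submodule[OF D.submodule_carrier]])
  also have "\<dots> = enat (n * (1 + e + a))" using dimK_pow[OF A.left_module_axioms, of n] by (simp add: dimK_A)
  finally have "dimK (dual R X) \<le> enat (n * (1 + e + a))" .
  with scalar_ring.length_le_kmod[OF opp_scalar_ring dual_left_module[OF Xl]]
  have "mod_length (opp_ring R) (dual R X) \<le> enat (n * (1 + e + a))" by (rule order_trans)
  then show ?thesis by (auto dest: enat_ile)
qed

text \<open>A minimal generating set of the right module \<open>M\<^sup>*\<close>, read as a map to a free module, is a
  minimal left approximation.\<close>
lemma minimal_left_approx_exists:
  assumes M: "fl_module R M"
  shows "\<exists>(P :: ('a, nat \<Rightarrow> 'a) module) u. minimal_left_approx R M P u"
proof -
  have Ml: "left_module R M" using M by (simp add: fl_module_def)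
  interpret M: left_module R M by (rule Ml)
  interpret D: left_module "opp_ring R" "dual R M" by (rule dual_left_module[OF Ml])
  interpret opp: rad_ring "opp_ring R" J by (rule opp_rad_ring)
  obtain n0 f0 where "gens (opp_ring R) (dual R M) n0 f0" using D.finite_length_gens dual_finite_length[OF M] by blast
  then obtain n f where f: "mingen (opp_ring R) J (dual R M) n f"
    using opp.mingen_exists[OF D.left_module_axioms] by blast
  have fM: "f i \<in> lhom R M A" if "i < n" for i using gensD[OF mingen_gens[OF f] that] by simp
  note fD = lhom_regD[OF fM]
  have gen: "\<exists>c. (\<forall>i<n. c i \<in> carrier R) \<and> (\<forall>x\<in>carrier M. g x = lc A n (\<lambda>i. f i x) c)" if g: "g \<in> lhom R M A" for g
  proof -
    obtain c where c: "\<And>i. i < n \<Longrightarrow> c i \<in> carrier (opp_ring R)" "g = lc (dual R M) n c f"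
      using gensE[OF mingen_gens[OF f], of g] g by auto
    then show ?thesis using lc_dual[OF Ml, of n f c] fM by (intro exI[of _ c]) auto
  qed
  define u where "u = (\<lambda>x\<in>carrier M. \<lambda>i\<in>{..<n}. f i x)"
  have u: "u \<in> lhom R M (free_mod R n)"
    unfolding u_def by (rule lin_restrict[OF Ml]) (auto simp: lin_def fD fun_eq_iff)
  interpret F: left_module R "free_mod R n" by (rule free_left_module)
  have Fp: "projective R (free_mod R n)" using basis_projective[OF F.left_module_axioms free_basis fin] .
  have ue: "u x = lc (free_mod R n) n (\<lambda>i. f i x) (unit_vec R n)" if "x \<in> carrier M" for x
    using that fD by (simp add: lc_unit_vec u_def)
  \<comment> \<open>compare coordinates with respect to a basis of \<open>Q\<close>\<close>
  have "\<exists>h\<in>lhom R (free_mod R n) Q. compose (carrier M) h u = g"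
    if Q: "projective R (Q :: ('a, nat \<Rightarrow> 'a) module)" and g: "g \<in> lhom R M Q" for Q g
  proof -
    have Ql: "left_module R Q" using Q by (simp add: projective_def fl_module_def)
    interpret Q: left_module R Q by (rule Ql)
    interpret g: lin_map R M Q g by (intro lin_mapI Ml Ql lhom_lin g)
    obtain q b where b: "basis R Q q b" using projective_basis[OF Q fin] .
    have bQ: "b j \<in> carrier Q" if "j < q" for j using b that by (simp add: basis_def gens_def)
    obtain \<kappa> where \<kappa>: "\<And>i. i < q \<Longrightarrow> \<kappa> i \<in> lhom R Q A"
      "\<And>a i. (\<And>i. i < q \<Longrightarrow> a i \<in> carrier R) \<Longrightarrow> i < q \<Longrightarrow> \<kappa> i (lc Q q a b) = a i"
      "\<And>p. p \<in> carrier Q \<Longrightarrow> lc Q q (\<lambda>i. \<kappa> i p) b = p"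
      using basis_coordinates[OF Ql b] by metis
    have "\<exists>c. (\<forall>i<n. c i \<in> carrier R) \<and> (\<forall>x\<in>carrier M. \<kappa> j (g x) = lc A n (\<lambda>i. f i x) c)" if j: "j < q" for j
    proof -
      have "(\<lambda>x\<in>carrier M. \<kappa> j (g x)) \<in> lhom R M A"
        using lin_restrict[OF Ml lin_comp[OF g.lin lhom_lin[OF \<kappa>(1)[OF j]]]] .
      from gen[OF this] show ?thesis by auto
    qed
    then obtain c where c: "\<And>j i. j < q \<Longrightarrow> i < n \<Longrightarrow> c j i \<in> carrier R"
      "\<And>j x. j < q \<Longrightarrow> x \<in> carrier M \<Longrightarrow> \<kappa> j (g x) = lc A n (\<lambda>i. f i x) (c j)" by metis
    define w where "w i = lc Q q (\<lambda>j. c j i) b" for i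
    have wQ: "w i \<in> carrier Q" if "i < n" for i using c(1) that bQ by (simp add: w_def)
    obtain h where h: "h \<in> lhom R (free_mod R n) Q"
      "\<And>a. (\<And>i. i < n \<Longrightarrow> a i \<in> carrier R) \<Longrightarrow> h (lc (free_mod R n) n a (unit_vec R n)) = lc Q n a w"
      using basis_lhom[OF F.left_module_axioms Ql free_basis[of n], of w] wQ by metis
    have "h (u x) = g x" if x: "x \<in> carrier M" for x
    proof -
      have hx: "h (u x) = lc Q n (\<lambda>i. f i x) w" using h(2) fD(1) x by (simp add: ue)
      have hQ: "h (u x) \<in> carrier Q" unfolding hx using wQ fD(1) x by simp
      have "\<kappa> j (h (u x)) = \<kappa> j (g x)" if j: "j < q" for j
      proof -
        interpret k: lin_map R Q A "\<kappa> j"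
          by (intro lin_mapI Ql A.left_module_axioms lhom_lin \<kappa>(1) j)
        have "\<kappa> j (h (u x)) = lc A n (\<lambda>i. f i x) (\<lambda>i. \<kappa> j (w i))"
          unfolding hx using wQ fD(1) x by (intro k.f_lc) auto
        also have "\<dots> = lc A n (\<lambda>i. f i x) (c j)"
          unfolding w_def using \<kappa>(2) c(1) j by (intro lc_cong) auto
        finally show ?thesis using c(2)[OF j x] by simp
      qed
      then have "lc Q q (\<lambda>j. \<kappa> j (h (u x))) b = lc Q q (\<lambda>j. \<kappa> j (g x)) b" by (intro lc_cong) auto
      then show ?thesis using \<kappa>(3)[OF hQ] \<kappa>(3)[OF g.f_closed[OF x]] by simp
    qed
    then have "compose (carrier M) h u = g"
      using g by (auto simp: compose_def lhom_def PiE_iff extensional_def fun_eq_iff)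
    then show ?thesis using h(1) by blast
  qed
  moreover have "bij_betw h (carrier (free_mod R n)) (carrier (free_mod R n))"
    if h: "h \<in> lhom R (free_mod R n) (free_mod R n)" and hu: "compose (carrier M) h u = u" for h
  proof -
    interpret h: lin_map R "free_mod R n" "free_mod R n" h
      by (intro lin_mapI F.left_module_axioms lhom_lin h)
    let ?e = "unit_vec R n"
    have heF: "h (?e i) \<in> {..<n} \<rightarrow>\<^sub>E carrier R" for i using h.f_closed[of "?e i"] by simp
    have heR: "h (?e i) j \<in> carrier R" if "j < n" for i j using heF[of i] that by auto
    have eR: "?e i j \<in> carrier R" if "j < n" for i j using that by (simp add: unit_vec_def)
    have hv: "h v j = lc A n v (\<lambda>i. h (?e i) j)" if v: "v \<in> {..<n} \<rightarrow>\<^sub>E carrier R" and j: "j < n" for v j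
    proof -
      have "v = lc (free_mod R n) n v ?e" using v by (subst lc_unit_vec) (auto simp: PiE_iff extensional_restrict)
      then have "h v = h (lc (free_mod R n) n v ?e)" by (rule arg_cong)
      also have "\<dots> = lc (free_mod R n) n v (\<lambda>i. h (?e i))"
        by (rule h.f_lc) (use v in auto)
      finally show ?thesis using A.lc_pow[OF j] by simp
    qed
    \<comment> \<open>\<open>h\<close> is congruent to the identity modulo \<open>J\<close>, because the differences are coefficients of a relation between minimal generators\<close>
    have kJ: "?e i j \<ominus> h (?e i) j \<in> J" if i: "i < n" and j: "j < n" for i j
    proof -
      have "lc (dual R M) n (\<lambda>i. ?e i j \<ominus> h (?e i) j) f = \<zero>\<^bsub>dual R M\<^esub>"
      proof (rule extensionalityI[of _ "carrier M"])
        have "lc (dual R M) n (\<lambda>i. ?e i j \<ominus> h (?e i) j) f \<in> carrier (dual R M)"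
          using eR heR j fM by (intro D.lc_closed) auto
        then show "lc (dual R M) n (\<lambda>i. ?e i j \<ominus> h (?e i) j) f \<in> extensional (carrier M)"
          by (simp add: lhom_def PiE_iff)
        show "\<zero>\<^bsub>dual R M\<^esub> \<in> extensional (carrier M)" by simp
        fix x assume x: "x \<in> carrier M"
        have uF: "u x \<in> {..<n} \<rightarrow>\<^sub>E carrier R" using x fD(1) by (auto simp: u_def)
        have fu: "f i x = u x i" if "i < n" for i using x that by (simp add: u_def)
        have "h (u x) = u x" using fun_cong[OF hu, of x] x by (simp add: compose_def)
        then have 1: "lc A n (\<lambda>i. f i x) (\<lambda>i. h (?e i) j) = f j x"
          using hv[OF uF j] fu j by (simp cong: lc_cong)
        have 2: "lc A n (\<lambda>i. f i x) (\<lambda>i. ?e i j) = f j x"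
          using A.lc_single[of j n "\<lambda>i. f i x" "\<lambda>i. ?e i j"] fD(1) x j by (auto simp: unit_vec_def)
        have eq: "(?e i j \<ominus> h (?e i) j) \<oplus> h (?e i) j = ?e i j" for i
          using eR[OF j] heR[OF j] by (simp add: a_minus_def a_assoc l_neg)
        have "lc A n (\<lambda>i. f i x) (\<lambda>i. (?e i j \<ominus> h (?e i) j) \<oplus> h (?e i) j)
            = lc A n (\<lambda>i. f i x) (\<lambda>i. ?e i j \<ominus> h (?e i) j) \<oplus> lc A n (\<lambda>i. f i x) (\<lambda>i. h (?e i) j)"
          using A.lc_add_right[of n "\<lambda>i. f i x" "\<lambda>i. ?e i j \<ominus> h (?e i) j" "\<lambda>i. h (?e i) j"] fD(1) x eR heR j by simp
        then have "f j x = lc A n (\<lambda>i. f i x) (\<lambda>i. ?e i j \<ominus> h (?e i) j) \<oplus> f j x"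
          unfolding eq 1 2 .
        moreover have "lc A n (\<lambda>i. f i x) (\<lambda>i. ?e i j \<ominus> h (?e i) j) \<in> carrier R"
          using fD(1) x eR heR j by (intro lcA_closed) auto
        ultimately have "lc A n (\<lambda>i. f i x) (\<lambda>i. ?e i j \<ominus> h (?e i) j) = \<zero>"
          using fD(1)[OF j x] by (metis add.r_cancel_one)
        then show "lc (dual R M) n (\<lambda>i. ?e i j \<ominus> h (?e i) j) f x = \<zero>\<^bsub>dual R M\<^esub> x"
          using lc_dual[OF Ml fM _ x, where c = "\<lambda>i. ?e i j \<ominus> h (?e i) j"] eR heR j x by simp
      qed
      then show ?thesis using mingenD[OF f, of "\<lambda>i. ?e i j \<ominus> h (?e i) j" i] eR heR i j by simp
    qed
    let ?U = "h ` carrier (free_mod R n)"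
    have U: "submodule ?U R (free_mod R n)" by (rule h.image_submodule[OF F.submodule_carrier])
    have "?U = carrier (free_mod R n)"
    proof (rule nakayama[OF F.left_module_axioms U])
      fix v assume v: "v \<in> carrier (free_mod R n)"
      then have vR: "\<And>i. i < n \<Longrightarrow> v i \<in> carrier R" by auto
      let ?w = "v \<ominus>\<^bsub>free_mod R n\<^esub> h v"
      have w: "?w \<in> carrier (free_mod R n)" using v h.f_closed by (intro F.M.minus_closed) auto
      have sum: "?w \<oplus>\<^bsub>free_mod R n\<^esub> h v = v" using v h.f_closed by (intro F.mod_minus_add) auto
      have "?w j \<in> J" if j: "j < n" for j
      proof -
        have e1: "lc A n v (\<lambda>i. ?e i j \<ominus> h (?e i) j) \<oplus> h v j = v j"
        proof -
          have eq: "(?e i j \<ominus> h (?e i) j) \<oplus> h (?e i) j = ?e i j" for i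
            using eR[OF j] heR[OF j] by (simp add: a_minus_def a_assoc l_neg)
          have "lc A n v (\<lambda>i. ?e i j) = v j"
            using A.lc_single[of j n v "\<lambda>i. ?e i j"] vR j by (auto simp: unit_vec_def)
          then show ?thesis
            using A.lc_add_right[of n v "\<lambda>i. ?e i j \<ominus> h (?e i) j" "\<lambda>i. h (?e i) j"] vR eR heR j eq hv[of v j] v
            by simp
        qed
        have e2: "?w j \<oplus> h v j = v j" using fun_cong[OF sum, of j] j by simp
        have wj: "?w j \<in> carrier R" using w j by (simp only: pow_mod_simps reg_mod_simps) blast
        have hj: "h v j \<in> carrier R" using h.f_closed[OF v] j by auto
        have lj: "lc A n v (\<lambda>i. ?e i j \<ominus> h (?e i) j) \<in> carrier R"
          using j vR eR heR by (intro lcA_closed) auto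
        have "?w j = lc A n v (\<lambda>i. ?e i j \<ominus> h (?e i) j)"
          using add.right_cancel[OF hj wj lj] unfolding e1 e2 by (simp only: simp_thms)
        also have "\<dots> \<in> J" by (rule A.lc_in_submodule[OF J_submodule]) (use vR kJ j J_lmult in auto)
        finally show ?thesis .
      qed
      moreover have "?w = lc (free_mod R n) n ?w ?e"
        using w by (subst lc_unit_vec) (auto simp: PiE_iff extensional_restrict)
      ultimately have wr: "?w \<in> rad (free_mod R n)"
        using rad_gens_iff[OF F.left_module_axioms, of n ?e ?w] free_basis[of n] by (auto simp: basis_def)
      have "v = h v \<oplus>\<^bsub>free_mod R n\<^esub> ?w"
        using sum F.M.a_comm[OF w h.f_closed[OF v]] by simp
      then show "\<exists>u\<in>?U. \<exists>w\<in>rad (free_mod R n). v = u \<oplus>\<^bsub>free_mod R n\<^esub> w"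
        using v wr by blast
    qed
    moreover have "inj_on h (carrier (free_mod R n))"
    proof (rule h.inj_onI_ker)
      define l where "l = mod_length R (sub_mod (free_mod R n) h.ker)"
      have N: "mod_length R (free_mod R n) = enat (n * (1 + e + a))" using A.length_pow[of n] by (simp add: len_A)
      have "mod_length R (free_mod R n) = l + mod_length R (free_mod R n)"
        unfolding l_def by (rule h.length_surj[OF \<open>?U = carrier (free_mod R n)\<close>])
      then have "l = 0" unfolding N by (cases l) (auto simp: zero_enat_def)
      then have "carrier (sub_mod (free_mod R n) h.ker) = {\<zero>\<^bsub>sub_mod (free_mod R n) h.ker\<^esub>}"
        unfolding l_def left_module.mod_length_eq_0_iff[OF F.sub_mod_left_module[OF h.ker_submodule]] .
      then show "h.ker \<subseteq> {\<zero>\<^bsub>free_mod R n\<^esub>}" unfolding sub_mod_simps(1,2) by (rule equalityD1)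
    qed
    ultimately show ?thesis by (simp add: bij_betw_def)
  qed
  ultimately have "minimal_left_approx R M (free_mod R n) u"
    unfolding minimal_left_approx_def using Fp u by blast
  then show ?thesis by blast
qed

text \<open>A map with an invertible value splits, so \<open>M\<close> would be free of rank one.\<close>
lemma dual_into_J:
  assumes M: "left_module R M" and ind: "indecomposable R M" and np: "\<not> projective R M"
    and f: "f \<in> lhom R M A" and x: "x \<in> carrier M"
  shows "f x \<in> J"
proof (rule ccontr)
  assume "f x \<notin> J"
  interpret M: left_module R M by (rule M)
  interpret f: lin_map R M A f by (intro lin_mapI M A.left_module_axioms lhom_lin f)
  obtain v where v: "v \<in> carrier R" "v \<otimes> f x = \<one>" using J_inv[OF _ \<open>f x \<notin> J\<close>] f.f_closed[OF x] by auto
  define y where "y = v \<odot>\<^bsub>M\<^esub> x"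
  have y: "y \<in> carrier M" "f y = \<one>" using v x by (auto simp: y_def f.f_smult)
  interpret s: lin_map R A M "\<lambda>r. r \<odot>\<^bsub>M\<^esub> y"
    by (intro lin_mapI M A.left_module_axioms)
      (use y in \<open>auto simp: lin_def M.smult_l_distr M.smult_assoc\<close>)
  let ?V = "(\<lambda>r. r \<odot>\<^bsub>M\<^esub> y) ` carrier R"
  have V: "submodule ?V R M" using s.image_submodule[OF A.submodule_carrier] by simp
  have fr: "f (r \<odot>\<^bsub>M\<^esub> y) = r" if "r \<in> carrier R" for r using that y by (simp add: f.f_smult)
  have "f.ker \<inter> ?V = {\<zero>\<^bsub>M\<^esub>}"
  proof (intro equalityI subsetI)
    fix z assume "z \<in> f.ker \<inter> ?V"
    then obtain r where r: "r \<in> carrier R" "z = r \<odot>\<^bsub>M\<^esub> y" "f z = \<zero>" by auto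
    then have "r = \<zero>" using fr by simp
    then show "z \<in> {\<zero>\<^bsub>M\<^esub>}" using r y by simp
  qed (use M.submoduleD(2)[OF V] M.submoduleD(2)[OF f.ker_submodule] in auto)
  moreover have "f.ker <+>\<^bsub>M\<^esub> ?V = carrier M"
  proof (intro equalityI subsetI)
    fix z assume z: "z \<in> carrier M"
    have fz: "f z \<in> carrier R" using f.f_closed[OF z] by simp
    have k: "z \<ominus>\<^bsub>M\<^esub> (f z \<odot>\<^bsub>M\<^esub> y) \<in> f.ker"
      using z fz y fr A.mod_minus_self[of "f z"] by (simp add: f.f_minus)
    have "z = (z \<ominus>\<^bsub>M\<^esub> (f z \<odot>\<^bsub>M\<^esub> y)) \<oplus>\<^bsub>M\<^esub> (f z \<odot>\<^bsub>M\<^esub> y)"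
      using z fz y M.mod_minus_add by simp
    moreover have "f z \<odot>\<^bsub>M\<^esub> y \<in> ?V" using fz by blast
    ultimately show "z \<in> f.ker <+>\<^bsub>M\<^esub> ?V" using k unfolding set_add_def' by blast
  qed (use y in \<open>auto elim!: set_addE\<close>)
  ultimately have "f.ker = {\<zero>\<^bsub>M\<^esub>} \<or> ?V = {\<zero>\<^bsub>M\<^esub>}"
    using ind f.ker_submodule V unfolding indecomposable_def by blast
  moreover have "?V \<noteq> {\<zero>\<^bsub>M\<^esub>}"
  proof
    assume "?V = {\<zero>\<^bsub>M\<^esub>}"
    then have "\<one> \<odot>\<^bsub>M\<^esub> y = \<zero>\<^bsub>M\<^esub>" by blast
    then have "y = \<zero>\<^bsub>M\<^esub>" using y by simp
    then have "\<one> = \<zero>" using y(2) f.f_zero by simp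
    then show False using one_notin_J J_zero by simp
  qed
  ultimately have k0: "f.ker = {\<zero>\<^bsub>M\<^esub>}" by blast
  have "basis R M 1 (\<lambda>_. y)"
    unfolding basis_def gens_def
  proof (intro conjI allI impI ballI)
    fix z assume z: "z \<in> carrier M"
    have fz: "f z \<in> carrier R" using f.f_closed[OF z] by simp
    have "z \<ominus>\<^bsub>M\<^esub> (f z \<odot>\<^bsub>M\<^esub> y) \<in> f.ker"
      using z fz y fr A.mod_minus_self[of "f z"] by (simp add: f.f_minus)
    then have "z \<ominus>\<^bsub>M\<^esub> (f z \<odot>\<^bsub>M\<^esub> y) = \<zero>\<^bsub>M\<^esub>" using k0 by blast
    moreover have fy: "f z \<odot>\<^bsub>M\<^esub> y \<in> carrier M" using fz y by simp
    ultimately have "z = f z \<odot>\<^bsub>M\<^esub> y" using M.mod_minus_add[OF z fy] M.M.l_zero[OF fy] by metis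
    moreover have "lc M 1 (\<lambda>_. f z) (\<lambda>_. y) = f z \<odot>\<^bsub>M\<^esub> y" using fy by simp
    ultimately show "\<exists>a. (\<forall>i<1. a i \<in> carrier R) \<and> z = lc M 1 a (\<lambda>_. y)"
      using fz by (intro exI[of _ "\<lambda>_. f z"]) simp
  next
    fix b and i :: nat assume b: "(\<forall>i<1. b i \<in> carrier R) \<and> lc M 1 b (\<lambda>_. y) = \<zero>\<^bsub>M\<^esub>" and i: "i < 1"
    then have b0: "b 0 \<in> carrier R" by simp
    then have "b 0 \<odot>\<^bsub>M\<^esub> y = \<zero>\<^bsub>M\<^esub>" using b y M.M.l_zero[of "b 0 \<odot>\<^bsub>M\<^esub> y"] by simp
    then have "b 0 = \<zero>" using fr[of "b 0"] b f.f_zero by simp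
    then show "b i = \<zero>" using i by simp
  qed (use y in auto)
  then show False using basis_projective[OF M _ fin] np by blast
qed

text \<open>Let \<open>u : M \<rightarrow> P\<close> be the minimal approximation, with components \<open>f\<^sub>i\<close>. They generate \<open>M\<^sup>*\<close>, and by
  minimality of \<open>u\<close> they do so minimally. Hence a vector with entries in \<open>J\<^sup>2\<close> defines an element of
  \<open>M\<^sup>*\<^sup>*\<close>, because it annihilates all relations; by reflexivity it comes from \<open>M\<close>. So \<open>J\<^sup>2P \<subseteq> u(M)\<close>.\<close>
lemma mho_syz:
  assumes M: "fl_module R M" and ind: "indecomposable R M" and np: "\<not> projective R M" and refl: "reflexive R M"
  shows "\<exists>n x \<iota>. syz R J (mho R M) n x M \<iota> \<and> extends R n M \<iota> \<and> loewy2 J (mho R M)"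
proof -
  have Ml: "left_module R M" using M by (simp add: fl_module_def)
  interpret M: left_module R M by (rule Ml)
  define Pu where "Pu = (SOME (P :: ('a, nat \<Rightarrow> 'a) module, u). minimal_left_approx R M P u)"
  define P where "P = fst Pu"
  define u where "u = snd Pu"
  have "\<exists>Pu. case Pu of (P :: ('a, nat \<Rightarrow> 'a) module, u) \<Rightarrow> minimal_left_approx R M P u"
    using minimal_left_approx_exists[OF M] by blast
  then have "case Pu of (P, u) \<Rightarrow> minimal_left_approx R M P u" unfolding Pu_def by (rule someI_ex)
  then have mla: "minimal_left_approx R M P u" by (simp add: P_def u_def case_prod_beta)
  have mho: "mho R M = quot_mod P (u ` carrier M)"
    by (simp add: mho_def P_def u_def Pu_def case_prod_beta Let_def)
  have Pp: "projective R P" and u: "u \<in> lhom R M P"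
    and lift: "\<And>Q f. projective R (Q :: ('a, nat \<Rightarrow> 'a) module) \<Longrightarrow> f \<in> lhom R M Q \<Longrightarrow> \<exists>h\<in>lhom R P Q. compose (carrier M) h u = f"
    and min: "\<And>h. h \<in> lhom R P P \<Longrightarrow> compose (carrier M) h u = u \<Longrightarrow> bij_betw h (carrier P) (carrier P)"
    using mla unfolding minimal_left_approx_def by blast+
  have Pl: "left_module R P" using Pp by (simp add: projective_def fl_module_def)
  interpret u: lin_map R M P u by (intro lin_mapI Ml Pl lhom_lin u)
  obtain n b where b: "basis R P n b" using projective_basis[OF Pp fin] .
  then have gb: "gens R P n b" by (simp add: basis_def)
  note bP = gensD[OF gb]
  obtain \<kappa> where \<kappa>: "\<And>i. i < n \<Longrightarrow> \<kappa> i \<in> lhom R P A"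
    "\<And>a i. (\<And>i. i < n \<Longrightarrow> a i \<in> carrier R) \<Longrightarrow> i < n \<Longrightarrow> \<kappa> i (lc P n a b) = a i"
    "\<And>p. p \<in> carrier P \<Longrightarrow> lc P n (\<lambda>i. \<kappa> i p) b = p"
    using basis_coordinates[OF Pl b] by metis
  note \<kappa>D = lhom_regD[OF \<kappa>(1)]
  define f where "f i = (\<lambda>x\<in>carrier M. \<kappa> i (u x))" for i
  have fM: "f i \<in> lhom R M A" if "i < n" for i
    unfolding f_def using lin_restrict[OF Ml lin_comp[OF u.lin lhom_lin[OF \<kappa>(1)[OF that]]]] .
  note fD = lhom_regD[OF fM]
  have fu: "lc P n (\<lambda>i. f i x) b = u x" if x: "x \<in> carrier M" for x
    using \<kappa>(3)[OF u.f_closed[OF x]] x by (simp add: f_def)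
  have ext: "extends R n M f"
    unfolding extends_def
  proof
    fix g assume g: "g \<in> lhom R M A"
    interpret F: left_module R "free_mod R 1" by (rule free_left_module)
    have Fp: "projective R (free_mod R 1)" using basis_projective[OF F.left_module_axioms free_basis fin] .
    have "(\<lambda>x\<in>carrier M. \<lambda>i\<in>{..<1::nat}. g x) \<in> lhom R M (free_mod R 1)"
      by (rule lin_restrict[OF Ml]) (auto simp: lin_def lhom_regD[OF g] fun_eq_iff)
    from lift[OF Fp this] obtain h where h: "h \<in> lhom R P (free_mod R 1)"
      "compose (carrier M) h u = (\<lambda>x\<in>carrier M. \<lambda>i\<in>{..<1::nat}. g x)" by blast
    interpret h: lin_map R P "free_mod R 1" h
      by (intro lin_mapI Pl F.left_module_axioms lhom_lin h)
    have hb: "h (b i) 0 \<in> carrier R" if "i < n" for i using h.f_closed[OF bP[OF that]] by auto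
    have "g x = lc A n (\<lambda>i. f i x) (\<lambda>i. h (b i) 0)" if x: "x \<in> carrier M" for x
    proof -
      have "g x = h (u x) 0" using fun_cong[OF h(2), of x] x by (simp add: compose_def)
      also have "\<dots> = h (lc P n (\<lambda>i. f i x) b) 0" using fu[OF x] by simp
      also have "\<dots> = lc (free_mod R 1) n (\<lambda>i. f i x) (\<lambda>i. h (b i)) 0"
        using fD(1) x bP by (subst h.f_lc) auto
      also have "\<dots> = lc A n (\<lambda>i. f i x) (\<lambda>i. h (b i) 0)" by (rule A.lc_pow) simp
      finally show ?thesis .
    qed
    then show "\<exists>c. (\<forall>i<n. c i \<in> carrier R) \<and> (\<forall>y\<in>carrier M. g y = lc A n (\<lambda>i. f i y) c)"
      using hb by (intro exI[of _ "\<lambda>i. h (b i) 0"]) simp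
  qed
  let ?ev = "\<lambda>x. \<lambda>f\<in>carrier (dual R M). f x"
  have bij: "bij_betw ?ev (carrier M) (carrier (dual (opp_ring R) (dual R M)))"
    using refl by (simp add: reflexive_def)
  have torsionless: "x = \<zero>\<^bsub>M\<^esub>" if x: "x \<in> carrier M" and 0: "\<And>g. g \<in> lhom R M A \<Longrightarrow> g x = \<zero>" for x
  proof -
    have "g \<zero>\<^bsub>M\<^esub> = \<zero>" if g: "g \<in> lhom R M A" for g
      using lhom_zero[OF Ml A.left_module_axioms g] by simp
    then have "g x = g \<zero>\<^bsub>M\<^esub>" if "g \<in> carrier (dual R M)" for g using 0[of g] that by simp
    then have "?ev x = ?ev \<zero>\<^bsub>M\<^esub>" by (rule restrict_ext)
    then show ?thesis using bij x unfolding bij_betw_def by (metis inj_onD M.M.zero_closed)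
  qed
  let ?N = "u ` carrier M"
  have N: "submodule ?N R P" by (rule u.image_submodule[OF M.submodule_carrier])
  interpret q: lin_map R P "quot_mod P ?N" "\<lambda>p. ?N +>\<^bsub>P\<^esub> p" by (rule u.Y.quot_lin_map[OF N])
  define x where "x = (\<lambda>i. ?N +>\<^bsub>P\<^esub> b i)"
  have lcx: "lc (quot_mod P ?N) n c x = ?N +>\<^bsub>P\<^esub> lc P n c b" if "\<And>i. i < n \<Longrightarrow> c i \<in> carrier R" for c
    unfolding x_def using q.f_lc[of n c b] that bP by simp
  have lc0: "lc (quot_mod P ?N) n c x = \<zero>\<^bsub>quot_mod P ?N\<^esub> \<longleftrightarrow> lc P n c b \<in> ?N" if "\<And>i. i < n \<Longrightarrow> c i \<in> carrier R" for c
    using lcx[OF that] u.Y.quot_eq_zero_iff[OF N, of "lc P n c b"] that bP by simp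
  have rel: "\<exists>y\<in>carrier M. \<forall>i<n. f i y = c i"
    if c: "\<And>i. i < n \<Longrightarrow> c i \<in> carrier R" and c0: "lc (quot_mod P ?N) n c x = \<zero>\<^bsub>quot_mod P ?N\<^esub>" for c
  proof -
    obtain y where y: "y \<in> carrier M" "lc P n c b = u y" using lc0[OF c] c0 by auto
    have "f i y = c i" if "i < n" for i using \<kappa>(2)[of c i] c that y by (simp add: f_def)
    then show ?thesis using y by blast
  qed
  have gx: "gens R (quot_mod P ?N) n x"
    unfolding gens_def
  proof (intro conjI allI impI ballI)
    show "x i \<in> carrier (quot_mod P ?N)" if "i < n" for i using q.f_closed[OF bP[OF that]] by (simp add: x_def)
    fix y assume "y \<in> carrier (quot_mod P ?N)"
    then obtain p where p: "p \<in> carrier P" "y = ?N +>\<^bsub>P\<^esub> p" using u.Y.quot_carrier by auto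
    obtain c where c: "\<And>i. i < n \<Longrightarrow> c i \<in> carrier R" "p = lc P n c b" using gensE[OF gb p(1)] by blast
    then show "\<exists>c. (\<forall>i<n. c i \<in> carrier R) \<and> y = lc (quot_mod P ?N) n c x"
      using lcx[of c] p by (intro exI[of _ c]) simp
  qed
  have "mingen R J (quot_mod P ?N) n x"
    unfolding mingen_def
  proof (intro conjI gx allI impI)
    fix c i assume c: "(\<forall>i<n. c i \<in> carrier R) \<and> lc (quot_mod P ?N) n c x = \<zero>\<^bsub>quot_mod P ?N\<^esub>" and i: "i < n"
    then obtain y where "y \<in> carrier M" "\<forall>i<n. f i y = c i" using rel[of c] by blast
    then show "c i \<in> J" using dual_into_J[OF Ml ind np fM[OF i]] i by metis
  qed
  moreover have "y = \<zero>\<^bsub>M\<^esub>" if y: "y \<in> carrier M" and z: "\<forall>i<n. f i y = \<zero>" for y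
  proof (rule torsionless[OF y])
    fix g assume "g \<in> lhom R M A"
    then obtain c where c: "\<forall>i<n. c i \<in> carrier R" "\<forall>y\<in>carrier M. g y = lc A n (\<lambda>i. f i y) c"
      using ext unfolding extends_def by blast
    show "g y = \<zero>" using c y z A.lc_eq_zeroI[of n "\<lambda>i. f i y" c] by simp
  qed
  moreover have "lc (quot_mod P ?N) n (\<lambda>i. f i y) x = \<zero>\<^bsub>quot_mod P ?N\<^esub>" if y: "y \<in> carrier M" for y
    using lc0[of "\<lambda>i. f i y"] fD(1) y fu[OF y] by simp
  ultimately have syz: "syz R J (quot_mod P ?N) n x M f"
    unfolding syz_def using Ml q.Y.left_module_axioms fM rel by blast
  interpret D: left_module "opp_ring R" "dual R M" by (rule dual_left_module[OF Ml])
  have gf: "gens (opp_ring R) (dual R M) n f"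
    unfolding gens_def
  proof (intro conjI allI impI ballI)
    show "f i \<in> carrier (dual R M)" if "i < n" for i using fM[OF that] by simp
    fix g assume "g \<in> carrier (dual R M)"
    then have g: "g \<in> lhom R M A" by simp
    then obtain c where c: "\<forall>i<n. c i \<in> carrier R" "\<forall>y\<in>carrier M. g y = lc A n (\<lambda>i. f i y) c"
      using ext unfolding extends_def by blast
    have "lc (dual R M) n c f \<in> carrier (dual R M)" using c(1) fM by (intro D.lc_closed) auto
    then have "g = lc (dual R M) n c f"
      using c lhom_regD(4)[OF g] lc_dual[OF Ml, of n f c] fM
      by (intro extensionalityI[of g "carrier M"]) (auto simp: lhom_regD)
    then show "\<exists>c. (\<forall>i<n. c i \<in> carrier (opp_ring R)) \<and> g = lc (dual R M) n c f" using c(1) by auto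
  qed
  \<comment> \<open>a relation with an invertible coefficient would allow to project away one summand of \<open>P\<close> without changing \<open>u\<close>\<close>
  have relJ: "c j \<in> J" if c: "\<And>i. i < n \<Longrightarrow> c i \<in> carrier R" and c0: "lc (dual R M) n c f = \<zero>\<^bsub>dual R M\<^esub>" and j: "j < n" for c j
  proof (rule ccontr)
    assume "c j \<notin> J"
    then obtain w where w: "w \<in> carrier R" "c j \<otimes> w = \<one>" using J_inv[OF c[OF j]] by blast
    interpret co: coords R J K \<sigma> e a P n \<kappa>
      by (intro coords.intro coords_axioms.intro short_alg_axioms Pl \<kappa>(1))
    have bj: "b j = lc P n (\<lambda>i. if i = j then \<one> else \<zero>) b"
      using u.Y.lc_unit[OF j one_closed, of b] bP j by simp
    have \<kappa>b: "\<kappa> i (b j) = (if i = j then \<one> else \<zero>)" if "i < n" for i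
      by (subst bj) (rule \<kappa>(2), use that in auto)
    let ?t = "\<lambda>p. co.\<rho> c p \<otimes> w"
    note tD = lhom_regD[OF co.rho_lhom[OF c]]
    define h where "h = (\<lambda>p\<in>carrier P. p \<ominus>\<^bsub>P\<^esub> (?t p \<odot>\<^bsub>P\<^esub> b j))"
    have tR: "?t p \<in> carrier R" if "p \<in> carrier P" for p using tD(1) w that by simp
    have "h \<in> lhom R P P"
      unfolding h_def
    proof (rule lin_restrict[OF Pl])
      have "p \<oplus>\<^bsub>P\<^esub> p' \<ominus>\<^bsub>P\<^esub> (?t (p \<oplus>\<^bsub>P\<^esub> p') \<odot>\<^bsub>P\<^esub> b j) = (p \<ominus>\<^bsub>P\<^esub> (?t p \<odot>\<^bsub>P\<^esub> b j)) \<oplus>\<^bsub>P\<^esub> (p' \<ominus>\<^bsub>P\<^esub> (?t p' \<odot>\<^bsub>P\<^esub> b j))"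
        if p: "p \<in> carrier P" "p' \<in> carrier P" for p p'
        using p tD tR w bP[OF j]
        by (simp add: l_distr u.Y.smult_l_distr a_minus_def u.Y.M.minus_add u.Y.mod_a_ac)
      moreover have "r \<odot>\<^bsub>P\<^esub> p \<ominus>\<^bsub>P\<^esub> (?t (r \<odot>\<^bsub>P\<^esub> p) \<odot>\<^bsub>P\<^esub> b j) = r \<odot>\<^bsub>P\<^esub> (p \<ominus>\<^bsub>P\<^esub> (?t p \<odot>\<^bsub>P\<^esub> b j))"
        if p: "p \<in> carrier P" and r: "r \<in> carrier R" for p r
        using p r tD tR w bP[OF j]
        by (simp add: m_assoc u.Y.smult_assoc a_minus_def u.Y.smult_r_distr u.Y.smult_r_minus)
      ultimately show "lin R P P (\<lambda>p. p \<ominus>\<^bsub>P\<^esub> (?t p \<odot>\<^bsub>P\<^esub> b j))"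
        using tR bP[OF j] by (auto simp: lin_def)
    qed
    moreover have "compose (carrier M) h u = u"
    proof (rule extensionalityI[of _ "carrier M"])
      fix y assume y: "y \<in> carrier M"
      have "co.\<rho> c (u y) = lc A n (\<lambda>i. f i y) c"
        using y u.f_closed[OF y] by (simp add: co.rho_apply f_def)
      also have "\<dots> = \<zero>" using lc_dual[OF Ml, of n f c y] fM c c0 y by simp
      finally have "?t (u y) = \<zero>" using w by simp
      then have "h (u y) = u y" using u.f_closed[OF y] bP[OF j] by (simp add: h_def a_minus_def u.Y.mod_neg_zero)
      then show "compose (carrier M) h u y = u y" using y by (simp add: compose_def)
    qed (use u in \<open>auto simp: lhom_def PiE_iff\<close>)
    ultimately have "inj_on h (carrier P)" using min by (simp add: bij_betw_def)
    moreover have "h (b j) = h \<zero>\<^bsub>P\<^esub>"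
    proof -
      have "co.\<rho> c (b j) = lc A n (\<lambda>i. if i = j then \<one> else \<zero>) c"
        using bP[OF j] \<kappa>b by (simp add: co.rho_apply cong: lc_cong)
      also have "\<dots> = c j" using A.lc_unit[OF j one_closed, of c] c j by simp
      finally have "h (b j) = \<zero>\<^bsub>P\<^esub>" using w bP[OF j] by (simp add: h_def u.Y.mod_minus_self)
      moreover have "co.\<rho> c \<zero>\<^bsub>P\<^esub> = \<zero>"
        using lhom_zero[OF Pl A.left_module_axioms co.rho_lhom[OF c]] by simp
      then have "h \<zero>\<^bsub>P\<^esub> = \<zero>\<^bsub>P\<^esub>" using w bP[OF j] by (simp add: h_def u.Y.mod_minus_self)
      ultimately show ?thesis by simp
    qed
    ultimately have "b j = \<zero>\<^bsub>P\<^esub>" using bP[OF j] u.Y.M.zero_closed by (simp add: inj_onD)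
    then have "\<one> = \<zero>" using \<kappa>b[OF j] lhom_zero[OF Pl A.left_module_axioms \<kappa>(1)[OF j]] by simp
    then show False using one_notin_J J_zero by simp
  qed
  \<comment> \<open>the double dual vector with components \<open>z\<^sub>i\<close> is evaluation at an element of \<open>M\<close>\<close>
  have J2N: "lc P n z b \<in> ?N" if z: "\<And>i. i < n \<Longrightarrow> z i \<in> J2" for z
  proof -
    obtain F where F: "F \<in> lhom (opp_ring R) (dual R M) (reg_mod (opp_ring R))" "\<And>i. i < n \<Longrightarrow> F (f i) = z i"
    proof (rule D.lhom_of_gens[OF reg_mod_left_module[OF opp_ring] gf, of z])
      show "z i \<in> carrier (reg_mod (opp_ring R))" if "i < n" for i using z[OF that] J2_carr by simp
      fix c assume c: "\<And>i. i < n \<Longrightarrow> c i \<in> carrier (opp_ring R)" "lc (dual R M) n c f = \<zero>\<^bsub>dual R M\<^esub>"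
      then have "c i \<in> J" if "i < n" for i using relJ[of c i] that by simp
      then show "lc (reg_mod (opp_ring R)) n c z = \<zero>\<^bsub>reg_mod (opp_ring R)\<^esub>"
        using z J2_J_zero by (intro left_module.lc_eq_zeroI[OF reg_mod_left_module[OF opp_ring]]) simp
    qed blast
    have "F \<in> ?ev ` carrier M" using bij F(1) by (simp add: bij_betw_def)
    then obtain y where y: "y \<in> carrier M" "F = ?ev y" by blast
    have "f i y = z i" if "i < n" for i using F(2)[OF that] y fM[OF that] by simp
    then have "lc P n z b = u y" using fu[OF y(1)] by (simp cong: lc_cong)
    then show ?thesis using y by blast
  qed
  have "loewy2 J (quot_mod P ?N)"
    unfolding loewy2_def
  proof (intro ballI)
    fix i j y assume ij: "i \<in> J" "j \<in> J" and y: "y \<in> carrier (quot_mod P ?N)"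
    then obtain c where c: "\<And>i. i < n \<Longrightarrow> c i \<in> carrier R" "y = lc (quot_mod P ?N) n c x" using gensE[OF gx] by blast
    have z: "i \<otimes> (j \<otimes> c k) \<in> J2" if "k < n" for k using ij J_rmult[OF c(1)[OF that]] J2I by blast
    have "i \<odot>\<^bsub>quot_mod P ?N\<^esub> (j \<odot>\<^bsub>quot_mod P ?N\<^esub> y) = lc (quot_mod P ?N) n (\<lambda>k. i \<otimes> (j \<otimes> c k)) x"
      using c ij gensD[OF gx] by (simp add: q.Y.lc_smult J_carr)
    also have "\<dots> = \<zero>\<^bsub>quot_mod P ?N\<^esub>" using lc0[of "\<lambda>k. i \<otimes> (j \<otimes> c k)"] z J2N[of "\<lambda>k. i \<otimes> (j \<otimes> c k)"] J2_carr by blast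
    finally show "i \<odot>\<^bsub>quot_mod P ?N\<^esub> (j \<odot>\<^bsub>quot_mod P ?N\<^esub> y) = \<zero>\<^bsub>quot_mod P ?N\<^esub>" .
  qed
  then show ?thesis using syz ext unfolding mho by blast
qed

end

section \<open>The dimension vectors\<close>

text \<open>Here \<open>r, q, p, n2\<close> are the numbers of generators along the sequence and \<open>s2\<close> is the length of the
  radical of the last module. Comparing \<open>dual0\<close> with \<open>len0\<close> gives \<open>r = p\<close>. The bound on \<open>s2\<close>, \<open>len1\<close> and \<open>dual1\<close> give
  \<open>p e \<le> (a + 1) q\<close>; together with \<open>q e = (a + 1) p\<close> this is \<open>e\<^sup>2 \<le> (a + 1)\<^sup>2\<close>, while \<open>growth\<close> gives
  \<open>a (a + 1) \<le> e\<^sup>2\<close>. So \<open>e = a + 1\<close>.\<close>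
lemma dimension_recursion:
  fixes e a r q p n2 s2 :: nat
  assumes a: "2 \<le> a" and q: "0 < q"
    and dual0: "r + p * a = q * e" and dual1: "q + n2 * a = p * e" and growth: "q * a \<le> r * e"
    and len0: "p + r * a = q * e" and len1: "s2 + n2 + (q * a + p) = p * (1 + e + a)" and s2: "s2 \<le> p * a"
  shows "e = a + 1 \<and> r = q \<and> p = q \<and> n2 = q \<and> s2 = a * q"
proof -
  obtain b where b: "a = Suc (Suc b)" using a by (metis add_2_eq_Suc le_Suc_ex)
  have "r + p * a = p + r * a" using dual0 len0 by simp
  then have "p * Suc b = r * Suc b" unfolding b by simp
  then have rp: "r = p" by (metis mult_cancel2 nat.distinct(1))
  have qe: "q * e = p * (a + 1)" using len0 rp by simp
  have pe1: "p * e \<le> q * a + n2" using len1 s2 by (simp add: algebra_simps)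
  have "p * e * a \<le> q * a * a + n2 * a" using mult_le_mono1[OF pe1, of a] by (simp add: algebra_simps)
  then have "p * e * a + q \<le> q * a * a + p * e" using dual1 by simp
  then have "(p * e) * Suc b \<le> ((a + 1) * q) * Suc b" unfolding b by (simp add: algebra_simps)
  then have pe2: "p * e \<le> (a + 1) * q" by (simp only: mult_le_cancel2)
  have p0: "0 < p"
  proof (rule ccontr)
    assume "\<not> 0 < p"
    then have "q * a = 0" using growth rp by simp
    then show False using q a by simp
  qed
  have "p * (e * e) \<le> (a + 1) * (q * e)" using mult_le_mono1[OF pe2, of e] by (simp add: algebra_simps)
  also have "\<dots> = p * ((a + 1) * (a + 1))" unfolding qe by (simp only: ac_simps)
  finally have ee: "e * e \<le> (a + 1) * (a + 1)" using p0 by (simp only: mult_le_cancel1)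
  have e1: "e \<le> a + 1"
  proof (rule ccontr)
    assume "\<not> e \<le> a + 1"
    then have "(a + 1) * (a + 1) < e * e" by (intro mult_strict_mono) auto
    then show False using ee by simp
  qed
  have "p * (a * (a + 1)) = (q * e) * a" unfolding qe by (simp only: ac_simps)
  also have "\<dots> = (q * a) * e" by (simp only: ac_simps)
  also have "\<dots> \<le> p * e * e" using growth rp by (intro mult_le_mono1) simp
  finally have "p * (a * (a + 1)) \<le> p * (e * e)" by (simp only: ac_simps)
  then have e2: "a * (a + 1) \<le> e * e" using p0 by (simp only: mult_le_cancel1)
  have "\<not> e \<le> a"
  proof
    assume "e \<le> a"
    then have "e * e \<le> a * a" by (intro mult_le_mono)
    then show False using e2 a by simp
  qed
  then have e: "e = a + 1" using e1 by simp
  have pq: "p = q" using qe unfolding e by (metis mult_cancel2 add_is_0 one_neq_zero)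
  have "n2 * a = q * a" using dual1 unfolding e pq by simp
  then have n2: "n2 = q" using a by simp
  have "s2 = a * q" using len1 unfolding e pq n2 by (simp add: algebra_simps)
  then show ?thesis using e rp pq n2 by simp
qed

context short_alg
begin

definition dim_vec :: "('a, 'm) module \<Rightarrow> nat \<Rightarrow> nat \<Rightarrow> bool" where
  "dim_vec X p s \<longleftrightarrow> left_module R X \<and> loewy2 J X \<and>
     mod_length R (quot_mod X (rad X)) = enat p \<and>
     mod_length R (sub_mod X (rad X)) = enat s"

text \<open>If \<open>J\<^sup>2\<close> were contained in a line, then so would be the socle, which is \<open>J\<^sup>2\<close> unless \<open>J\<^sup>2 = 0\<close>.\<close>
lemma socle_not_in_line_J2:
  assumes nn: "\<not> socle_in_line" and s: "syz R J X n x Y \<iota>" and ext: "extends R n Y \<iota>" and n: "0 < n"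
    and l: "loewy2 J X" and y: "mingen R J Y m y"
    and ss: "J2 = {\<zero>} \<Longrightarrow> (\<And>j x. j \<in> J \<Longrightarrow> x \<in> carrier X \<Longrightarrow> j \<odot>\<^bsub>X\<^esub> x = \<zero>\<^bsub>X\<^esub>)"
  shows J2_not_in_line
proof -
  have nz: "\<exists>z\<in>J2. z \<noteq> \<zero>"
  proof (rule ccontr)
    assume "\<not> (\<exists>z\<in>J2. z \<noteq> \<zero>)"
    then have 0: "J2 = {\<zero>}" using J2_zero by blast
    have socle_in_line unfolding socle_in_line_def by (rule semisimple_case[OF s ext n 0 ss[OF 0] y])
    then show False using nn by simp
  qed
  interpret ap: jac_approx R J K \<sigma> e a Y n \<iota> by (rule syz_approx[OF s l ext])
  have m: "0 < m"
  proof (rule ccontr)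
    assume "\<not> 0 < m"
    then have Y0: "carrier Y \<subseteq> {\<zero>\<^bsub>Y\<^esub>}" using mingen_gens[OF y] by (auto simp: gens_def)
    obtain z where z: "z \<in> J2" "z \<noteq> \<zero>" using nz by blast
    obtain w where "w \<in> carrier Y" "\<forall>i<n. \<iota> i w = z" using ap.\<iota>_J2[of "\<lambda>_. z"] z by blast
    then have "\<iota> 0 \<zero>\<^bsub>Y\<^esub> = z" using Y0 n by auto
    then show False using lhom_zero[OF ap.Y A.left_module_axioms ap.\<iota>_hom[OF n]] z by simp
  qed
  show J2_not_in_line
    unfolding J2_not_in_line_def
  proof
    assume "\<exists>s\<in>carrier R. \<forall>z\<in>J2. \<exists>\<kappa>\<in>carrier K. z = \<sigma> \<kappa> \<otimes> s"
    then obtain s where s: "s \<in> carrier R" "\<forall>z\<in>J2. \<exists>\<kappa>\<in>carrier K. z = \<sigma> \<kappa> \<otimes> s" by blast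
    have "z \<in> J2" if "z \<in> carrier R" "\<forall>j\<in>J. j \<otimes> z = \<zero>" for z
      using ap.socle_eq_J2[OF y m nz that(1)] that(2) by blast
    then have socle_in_line using s unfolding socle_in_line_def by blast
    then show False using nn by simp
  qed
qed

theorem syzygy_dimensions:
  assumes M: "fl_module R M" and ind: "indecomposable R M" and refl: "reflexive R M" and np: "\<not> projective R M"
    and nsi: "\<not> self_injective R"
    and ext1: "Ext_vanishes R 1 M (reg_mod R)" and ext2: "Ext_vanishes R 2 M (reg_mod R)"
  shows "2 \<le> a \<and> e = a + 1 \<and> (\<exists>t. dim_vec M t (a * t) \<and> dim_vec (Omega R M) t (a * t) \<and>
    dim_vec (Omega R (Omega R M)) t (a * t) \<and> dim_vec (mho R M) t (a * t))"
proof -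
  have nn: "\<not> socle_in_line" using socle_in_line_self_injective nsi by blast
  obtain r v \<beta> where S: "syz R J (mho R M) r v M \<beta>" and Se: "extends R r M \<beta>" and Sl: "loewy2 J (mho R M)"
    using mho_syz[OF M ind np refl] by blast
  obtain q x \<iota> where S0: "syz R J M q x (Omega R M) \<iota>" and S0e: "extends R q (Omega R M) \<iota>"
    using Omega_syz[OF M] ext1 by blast
  obtain p y \<kappa> where S1: "syz R J (Omega R M) p y (Omega R (Omega R M)) \<kappa>"
    and S1e: "extends R p (Omega R (Omega R M)) \<kappa>"
    using Omega2_syz[OF M] ext2 by blast
  obtain n2 z where z: "mingen R J (Omega R (Omega R M)) n2 z" using fl_mingen[OF Omega_fl[OF Omega_fl[OF M]]] .
  note l0 = syz_loewy2[OF S] and l1 = syz_loewy2[OF S0] and l2 = syz_loewy2[OF S1]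
  note x = syzD(3)[OF S0] and y = syzD(3)[OF S1] and v = syzD(3)[OF S]
  have lM: "left_module R M" and lO: "left_module R (Omega R M)" and lOO: "left_module R (Omega R (Omega R M))"
    and lm: "left_module R (mho R M)" using syzD(1,2)[OF S] syzD(1,2)[OF S1] by auto
  interpret M: left_module R M by (rule lM)
  have q: "0 < q"
  proof (rule ccontr)
    assume "\<not> 0 < q"
    then have "carrier M \<subseteq> {\<zero>\<^bsub>M\<^esub>}" using mingen_gens[OF x] by (auto simp: gens_def)
    then show False using ind M.M.zero_closed unfolding indecomposable_def by blast
  qed
  have J2_not_in_line
  proof (rule socle_not_in_line_J2[OF nn S0 S0e q l0 y])
    \<comment> \<open>the coordinates of \<open>M\<close> in the cover of \<open>\<mho>M\<close> lie in \<open>J\<close>\<close>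
    fix j w assume J0: "J2 = {\<zero>}" and j: "j \<in> J" and w: "w \<in> carrier M"
    have "\<beta> i (j \<odot>\<^bsub>M\<^esub> w) = \<zero>" if "i < r" for i
      using lhom_regD(3)[OF syzD(4)[OF S that], of j w] J2I[OF j syz_J[OF S that w]] J0 j w by (simp add: J_carr)
    then show "j \<odot>\<^bsub>M\<^esub> w = \<zero>\<^bsub>M\<^esub>" using j w by (intro syzD(5)[OF S]) (simp_all add: J_carr)
  qed
  then have a2: "2 \<le> a" by (rule J2_not_in_line_ge_2)
  note w = \<open>J2_not_in_line\<close>[unfolded J2_not_in_line_def]
  interpret W: wide_approx R J K \<sigma> e a M r \<beta> q x
    by (intro wide_approx.intro wide_approx_axioms.intro syz_approx[OF S Sl Se] w x)
  interpret W0: wide_approx R J K \<sigma> e a "Omega R M" q \<iota> p y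
    by (intro wide_approx.intro wide_approx_axioms.intro syz_approx[OF S0 l0 S0e] w y)
  interpret W1: wide_approx R J K \<sigma> e a "Omega R (Omega R M)" p \<kappa> n2 z
    by (intro wide_approx.intro wide_approx_axioms.intro syz_approx[OF S1 l1 S1e] w z)
  have d0: "r + p * a = q * e"
    using syz_dual[OF S0 W0.jac_approx_axioms] W.dim_dual W0.dim_dual by (simp add: algebra_simps)
  have d1: "q + n2 * a = p * e"
    using syz_dual[OF S1 W1.jac_approx_axioms] W0.dim_dual W1.dim_dual by (simp add: algebra_simps)
  have s0: "mod_length R (sub_mod M (rad M)) = enat (r * a)"
    using syz_rad_length(2)[OF S Sl] aligned[OF S S0 S0e \<open>J2_not_in_line\<close>] by blast
  have s1: "mod_length R (sub_mod (Omega R M) (rad (Omega R M))) = enat (q * a)"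
    using syz_rad_length(2)[OF S0 l0] aligned[OF S0 S1 S1e \<open>J2_not_in_line\<close>] by blast
  obtain s2 where s2: "mod_length R (sub_mod (Omega R (Omega R M)) (rad (Omega R (Omega R M)))) = enat s2"
    "s2 \<le> p * a"
    using syz_rad_length(1)[OF S1] by (metis enat_ile enat_ord_simps(1))
  have len0: "p + r * a = q * e"
    using syz_length[OF S0] mingen_length[OF lM x] mingen_length[OF lO y] s0 s1 by (simp add: algebra_simps)
  have len1: "s2 + n2 + (q * a + p) = p * (1 + e + a)"
    using syz_length[OF S1] mingen_length[OF lO y] mingen_length[OF lOO z] s1 s2 by (simp add: algebra_simps)
  have eqs: "e = a + 1" "r = q" "p = q" "n2 = q" "s2 = a * q"
    using dimension_recursion[OF a2 q d0 d1 W.growth_le len0 len1 s2(2)] by auto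
  have sm: "mod_length R (sub_mod (mho R M) (rad (mho R M))) = enat (a * q)"
    using syz_length[OF S] mingen_length[OF lM x] mingen_length[OF lm v] s0 eqs
    by (cases "mod_length R (sub_mod (mho R M) (rad (mho R M)))")
      (auto simp: algebra_simps)
  have "dim_vec M q (a * q) \<and> dim_vec (Omega R M) q (a * q) \<and> dim_vec (Omega R (Omega R M)) q (a * q) \<and> dim_vec (mho R M) q (a * q)"
    unfolding dim_vec_def
    using lM lO lOO lm l0 l1 l2 Sl s0 s1 s2(1) sm eqs length_top[OF lM x fin] length_top[OF lO y fin]
      length_top[OF lOO z fin] length_top[OF lm v fin]
    by (simp add: mult.commute)
  then show ?thesis using a2 eqs(1) by blast
qed

end

section \<open>The radical of a short local algebra\<close>

text \<open>The only maximal left ideal is the intersection of all of them.\<close>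
lemma local_algebra_radical:
  assumes "local_algebra K (A :: ('k, 'a) module)"
  shows "submodule (jrad A) A (reg_mod A)" "\<one>\<^bsub>A\<^esub> \<notin> jrad A"
proof -
  have fd: "fd_algebra K A" and ex: "\<exists>!L. maximal_left_ideal A L" using assms by (auto simp: local_algebra_def)
  interpret A: ring A using fd by (simp add: fd_algebra_def)
  interpret RA: left_module A "reg_mod A" by (rule reg_mod_left_module[OF A.ring_axioms])
  obtain L where L: "maximal_left_ideal A L" "\<And>L'. maximal_left_ideal A L' \<Longrightarrow> L' = L" using ex by blast
  have sub: "submodule L A (reg_mod A)" and ne: "L \<noteq> carrier A"
    using L(1) unfolding maximal_left_ideal_def by blast+
  have LA: "L \<subseteq> carrier A" using RA.submoduleD(1)[OF sub] by simp
  then have "jrad A = L" using L unfolding jrad_def by blast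
  then show "submodule (jrad A) A (reg_mod A)" using sub by simp
  have "carrier A \<subseteq> L" if "\<one>\<^bsub>A\<^esub> \<in> L"
  proof
    fix x assume x: "x \<in> carrier A"
    then show "x \<in> L" using RA.submoduleD(4)[OF sub, of x "\<one>\<^bsub>A\<^esub>"] that by simp
  qed
  then show "\<one>\<^bsub>A\<^esub> \<notin> jrad A" using \<open>jrad A = L\<close> LA ne by blast
qed

text \<open>The scalars are central and together with \<open>J\<close> span \<open>A\<close>, so the left ideal \<open>J\<close> is two-sided, and an
  element outside \<open>J\<close> is a nonzero multiple of some \<open>1 + x\<close> with \<open>x\<close> in \<open>J\<close>, which is inverted by the
  geometric series.\<close>
lemma short_local_algebra_short_alg:
  assumes sh: "short_local_algebra K (A :: ('k, 'a) module)" and ht: "hilbert_type A e a"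
  shows "short_alg A (jrad A) K (\<lambda>c. c \<odot>\<^bsub>A\<^esub> \<one>\<^bsub>A\<^esub>) e a"
proof -
  let ?J = "jrad A" and ?\<sigma> = "\<lambda>c. c \<odot>\<^bsub>A\<^esub> \<one>\<^bsub>A\<^esub>"
  have la: "local_algebra K A" using sh by (simp add: short_local_algebra_def)
  then have fd: "fd_algebra K A" by (simp add: local_algebra_def)
  then have Kf: "field K" and Ar: "ring A" and KA: "Module.module K A"
    and ml: "\<And>c x y. c \<in> carrier K \<Longrightarrow> x \<in> carrier A \<Longrightarrow> y \<in> carrier A \<Longrightarrow> (c \<odot>\<^bsub>A\<^esub> x) \<otimes>\<^bsub>A\<^esub> y = c \<odot>\<^bsub>A\<^esub> (x \<otimes>\<^bsub>A\<^esub> y)"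
    and mr: "\<And>c x y. c \<in> carrier K \<Longrightarrow> x \<in> carrier A \<Longrightarrow> y \<in> carrier A \<Longrightarrow> x \<otimes>\<^bsub>A\<^esub> (c \<odot>\<^bsub>A\<^esub> y) = c \<odot>\<^bsub>A\<^esub> (x \<otimes>\<^bsub>A\<^esub> y)"
    by (auto simp: fd_algebra_def)
  interpret K: field K by (rule Kf)
  interpret A: ring A by (rule Ar)
  interpret KA: Module.module K A by (rule KA)
  interpret RA: left_module A "reg_mod A" by (rule reg_mod_left_module[OF Ar])
  note J = RA.submoduleD[OF local_algebra_radical(1)[OF la], simplified]
  have Jc: "x \<in> carrier A" if "x \<in> ?J" for x using J(1) that by blast
  have s\<sigma>: "?\<sigma> c \<in> carrier A" if "c \<in> carrier K" for c using that by simp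
  have \<sigma>m: "?\<sigma> c \<otimes>\<^bsub>A\<^esub> x = c \<odot>\<^bsub>A\<^esub> x" "x \<otimes>\<^bsub>A\<^esub> ?\<sigma> c = c \<odot>\<^bsub>A\<^esub> x" if "c \<in> carrier K" "x \<in> carrier A" for c x
    using that ml[of c "\<one>\<^bsub>A\<^esub>" x] mr[of c x "\<one>\<^bsub>A\<^esub>"] by auto
  have bij: "bij_betw (\<lambda>c. ?J +>\<^bsub>A\<^esub> ?\<sigma> c) (carrier K) (a_rcosets\<^bsub>A\<^esub> ?J)"
    using la by (simp add: local_algebra_def ring_iso_def FactRing_def)
  have split: "\<exists>c\<in>carrier K. \<exists>j\<in>?J. x = ?\<sigma> c \<oplus>\<^bsub>A\<^esub> j" if x: "x \<in> carrier A" for x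
  proof -
    have "?J +>\<^bsub>A\<^esub> x \<in> a_rcosets\<^bsub>A\<^esub> ?J" using x by (auto simp: A_RCOSETS_def')
    then obtain c where c: "c \<in> carrier K" "?J +>\<^bsub>A\<^esub> x = ?J +>\<^bsub>A\<^esub> ?\<sigma> c" using bij unfolding bij_betw_def by blast
    have "\<zero>\<^bsub>A\<^esub> \<oplus>\<^bsub>A\<^esub> x \<in> ?J +>\<^bsub>A\<^esub> x" unfolding a_r_coset_def' using J(2) by blast
    then have "x \<in> ?J +>\<^bsub>A\<^esub> ?\<sigma> c" using x c by simp
    then obtain j where "j \<in> ?J" "x = j \<oplus>\<^bsub>A\<^esub> ?\<sigma> c" unfolding a_r_coset_def' by blast
    then show ?thesis using c Jc by (metis A.a_comm s\<sigma>)
  qed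
  have rad: "rad_ring A ?J"
  proof (rule rad_ring.intro[OF Ar], unfold_locales)
    show "r \<otimes>\<^bsub>A\<^esub> x \<in> ?J" if "r \<in> carrier A" "x \<in> ?J" for r x using J(4) that by simp
    show "x \<otimes>\<^bsub>A\<^esub> r \<in> ?J" if r: "r \<in> carrier A" and x: "x \<in> ?J" for r x
    proof -
      obtain c j where c: "c \<in> carrier K" "j \<in> ?J" "r = ?\<sigma> c \<oplus>\<^bsub>A\<^esub> j" using split[OF r] by blast
      have "x \<otimes>\<^bsub>A\<^esub> r = ?\<sigma> c \<otimes>\<^bsub>A\<^esub> x \<oplus>\<^bsub>A\<^esub> x \<otimes>\<^bsub>A\<^esub> j"
        using c x Jc \<sigma>m s\<sigma> by (simp add: A.r_distr)
      then show ?thesis using c x Jc s\<sigma> J(3,4) by simp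
    qed
    show cube: "x \<otimes>\<^bsub>A\<^esub> (y \<otimes>\<^bsub>A\<^esub> z) = \<zero>\<^bsub>A\<^esub>" if "x \<in> ?J" "y \<in> ?J" "z \<in> ?J" for x y z
      using ideal_prod.prod[OF that(1) ideal_prod.prod[OF that(2,3), of A], of A] sh
      by (simp add: short_local_algebra_def)
    show "\<exists>y\<in>carrier A. y \<otimes>\<^bsub>A\<^esub> x = \<one>\<^bsub>A\<^esub> \<and> x \<otimes>\<^bsub>A\<^esub> y = \<one>\<^bsub>A\<^esub>" if x: "x \<in> carrier A" "x \<notin> ?J" for x
    proof -
      obtain c j where c: "c \<in> carrier K" "j \<in> ?J" "x = ?\<sigma> c \<oplus>\<^bsub>A\<^esub> j" using split[OF x(1)] by blast
      have "c \<noteq> \<zero>\<^bsub>K\<^esub>" using c x(2) Jc by auto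
      then have d: "inv\<^bsub>K\<^esub> c \<in> carrier K" "inv\<^bsub>K\<^esub> c \<otimes>\<^bsub>K\<^esub> c = \<one>\<^bsub>K\<^esub>" using c(1) by (auto simp: K.field_Units)
      define d where "d = inv\<^bsub>K\<^esub> c"
      define k where "k = d \<odot>\<^bsub>A\<^esub> j"
      have jc: "j \<in> carrier A" using Jc c by blast
      have dK: "d \<in> carrier K" "d \<otimes>\<^bsub>K\<^esub> c = \<one>\<^bsub>K\<^esub>" using d by (auto simp: d_def)
      have kJ: "k \<in> ?J" using J(4)[of "?\<sigma> d" j] c dK \<sigma>m jc by (simp add: k_def)
      then have kc: "k \<in> carrier A" using Jc by blast
      have dx: "d \<odot>\<^bsub>A\<^esub> x = \<one>\<^bsub>A\<^esub> \<oplus>\<^bsub>A\<^esub> k"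
        using c dK jc by (simp add: KA.smult_r_distr k_def flip: KA.smult_assoc1)
      have sq: "(\<one>\<^bsub>A\<^esub> \<oplus>\<^bsub>A\<^esub> z) \<otimes>\<^bsub>A\<^esub> (\<one>\<^bsub>A\<^esub> \<ominus>\<^bsub>A\<^esub> z) = \<one>\<^bsub>A\<^esub> \<ominus>\<^bsub>A\<^esub> z \<otimes>\<^bsub>A\<^esub> z"
        "(\<one>\<^bsub>A\<^esub> \<ominus>\<^bsub>A\<^esub> z) \<otimes>\<^bsub>A\<^esub> (\<one>\<^bsub>A\<^esub> \<oplus>\<^bsub>A\<^esub> z) = \<one>\<^bsub>A\<^esub> \<ominus>\<^bsub>A\<^esub> z \<otimes>\<^bsub>A\<^esub> z" if "z \<in> carrier A" for z
        using that by (simp_all add: a_minus_def A.l_distr A.r_distr A.l_minus A.r_minus A.minus_add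
            A.a_assoc A.r_neg1 A.r_neg2)
      let ?k2 = "k \<otimes>\<^bsub>A\<^esub> k"
      have k4: "?k2 \<otimes>\<^bsub>A\<^esub> ?k2 = \<zero>\<^bsub>A\<^esub>"
        using cube[OF kJ kJ kJ] kc by (simp add: A.m_assoc)
      \<comment> \<open>\<open>(1 - k)(1 + k\<^sup>2)\<close> is the truncated geometric series; the two orders give a right and a left inverse\<close>
      define w where "w = (\<one>\<^bsub>A\<^esub> \<ominus>\<^bsub>A\<^esub> k) \<otimes>\<^bsub>A\<^esub> (\<one>\<^bsub>A\<^esub> \<oplus>\<^bsub>A\<^esub> ?k2)"
      define w' where "w' = (\<one>\<^bsub>A\<^esub> \<oplus>\<^bsub>A\<^esub> ?k2) \<otimes>\<^bsub>A\<^esub> (\<one>\<^bsub>A\<^esub> \<ominus>\<^bsub>A\<^esub> k)"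
      have wc: "w \<in> carrier A" "w' \<in> carrier A" using kc by (simp_all add: w_def w'_def)
      have "(\<one>\<^bsub>A\<^esub> \<oplus>\<^bsub>A\<^esub> k) \<otimes>\<^bsub>A\<^esub> w = ((\<one>\<^bsub>A\<^esub> \<oplus>\<^bsub>A\<^esub> k) \<otimes>\<^bsub>A\<^esub> (\<one>\<^bsub>A\<^esub> \<ominus>\<^bsub>A\<^esub> k)) \<otimes>\<^bsub>A\<^esub> (\<one>\<^bsub>A\<^esub> \<oplus>\<^bsub>A\<^esub> ?k2)"
        using kc by (simp add: w_def A.m_assoc)
      also have "\<dots> = \<one>\<^bsub>A\<^esub>" using sq(1)[OF kc] sq(2)[of ?k2] k4 kc by (simp add: a_minus_def)
      finally have r: "(\<one>\<^bsub>A\<^esub> \<oplus>\<^bsub>A\<^esub> k) \<otimes>\<^bsub>A\<^esub> w = \<one>\<^bsub>A\<^esub>" .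
      have "w' \<otimes>\<^bsub>A\<^esub> (\<one>\<^bsub>A\<^esub> \<oplus>\<^bsub>A\<^esub> k) = (\<one>\<^bsub>A\<^esub> \<oplus>\<^bsub>A\<^esub> ?k2) \<otimes>\<^bsub>A\<^esub> ((\<one>\<^bsub>A\<^esub> \<ominus>\<^bsub>A\<^esub> k) \<otimes>\<^bsub>A\<^esub> (\<one>\<^bsub>A\<^esub> \<oplus>\<^bsub>A\<^esub> k))"
        using kc by (simp add: w'_def A.m_assoc)
      also have "\<dots> = \<one>\<^bsub>A\<^esub>" using sq(2)[OF kc] sq(1)[of ?k2] k4 kc by (simp add: a_minus_def)
      finally have l: "w' \<otimes>\<^bsub>A\<^esub> (\<one>\<^bsub>A\<^esub> \<oplus>\<^bsub>A\<^esub> k) = \<one>\<^bsub>A\<^esub>" .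
      have "w' = (w' \<otimes>\<^bsub>A\<^esub> (\<one>\<^bsub>A\<^esub> \<oplus>\<^bsub>A\<^esub> k)) \<otimes>\<^bsub>A\<^esub> w" using r wc kc by (simp add: A.m_assoc)
      then have "w' = w" using l wc by simp
      then have w1: "w \<otimes>\<^bsub>A\<^esub> (d \<odot>\<^bsub>A\<^esub> x) = \<one>\<^bsub>A\<^esub>" "(d \<odot>\<^bsub>A\<^esub> x) \<otimes>\<^bsub>A\<^esub> w = \<one>\<^bsub>A\<^esub>" using l r dx by auto
      show ?thesis
        using w1 ml[of d w x] mr[of d w x] ml[of d x w] mr[of d x w] dK wc x(1)
        by (intro bexI[of _ "d \<odot>\<^bsub>A\<^esub> w"]) auto
    qed
    show "\<one>\<^bsub>A\<^esub> \<notin> ?J" by (rule local_algebra_radical(2)[OF la])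
  qed (use J Jc in auto)
  have len: "mod_length A (quot_mod (sub_mod (reg_mod A) ?J) (ideal_prod A ?J ?J)) = enat e"
    "mod_length A (sub_mod (reg_mod A) (ideal_prod A ?J ?J)) = enat a"
    using ht by (auto simp: hilbert_type_def Let_def)
  interpret rad: rad_ring A ?J by (rule rad)
  interpret JJ: left_module A "sub_mod (reg_mod A) ?J" by (rule RA.sub_mod_left_module[OF rad.J_submodule])
  have "ideal_prod A ?J ?J \<subseteq> ?J"
  proof
    fix z assume "z \<in> ideal_prod A ?J ?J"
    then show "z \<in> ?J" by induction (auto simp: rad.J_lmult Jc rad.J_add)
  qed
  moreover have "submodule (ideal_prod A ?J ?J) A (reg_mod A)"
  proof (rule RA.submoduleI)
    show "ideal_prod A ?J ?J \<subseteq> carrier (reg_mod A)" using \<open>ideal_prod A ?J ?J \<subseteq> ?J\<close> Jc by auto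
    then have cl: "z \<in> carrier A" if "z \<in> ideal_prod A ?J ?J" for z using that by auto
    show "\<zero>\<^bsub>reg_mod A\<^esub> \<in> ideal_prod A ?J ?J" using ideal_prod.prod[OF rad.J_zero rad.J_zero, of A] by simp
    show "x \<oplus>\<^bsub>reg_mod A\<^esub> y \<in> ideal_prod A ?J ?J" if "x \<in> ideal_prod A ?J ?J" "y \<in> ideal_prod A ?J ?J" for x y
      using ideal_prod.sum[OF that] by simp
    show "r \<odot>\<^bsub>reg_mod A\<^esub> z \<in> ideal_prod A ?J ?J" if r: "r \<in> carrier A" and z: "z \<in> ideal_prod A ?J ?J" for r z
      using z
    proof induction
      case (prod i j)
      then have "r \<otimes>\<^bsub>A\<^esub> (i \<otimes>\<^bsub>A\<^esub> j) = (r \<otimes>\<^bsub>A\<^esub> i) \<otimes>\<^bsub>A\<^esub> j" using r Jc by (simp add: A.m_assoc)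
      then show ?case using ideal_prod.prod[OF rad.J_lmult[of r i] prod(2), of A] prod r by simp
    next
      case (sum x y)
      then show ?case using r cl ideal_prod.sum[of "r \<otimes>\<^bsub>A\<^esub> x" A ?J ?J "r \<otimes>\<^bsub>A\<^esub> y"] by (simp add: A.r_distr)
    qed
  qed
  ultimately have "submodule (ideal_prod A ?J ?J) A (sub_mod (reg_mod A) ?J)"
    using RA.submodule_sub_mod[OF rad.J_submodule] by blast
  from JJ.length_quot[OF this] have fin: "mod_length A (reg_mod A) \<noteq> \<infinity>"
    using rad.length_R len by (simp add: one_enat_def)
  have hom: "?\<sigma> \<in> ring_hom K A"
    by (rule ring_hom_memI) (auto simp: KA.smult_l_distr \<sigma>m(1) KA.smult_assoc1)
  show ?thesis
    by (intro short_alg.intro short_alg_axioms.intro artin_rad_ring.intro artin_rad_ring_axioms.intro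
        scalar_ring.intro scalar_ring_axioms.intro rad fin hom Kf Ar K.ring_axioms)
      (use split len \<sigma>m in auto)
qed

lemma (in short_alg) dim_vec_has_dim_vector:
  assumes "J = jrad R" and d: "dim_vec X t (a * t)"
  shows "has_dim_vector R X (enat t, enat a * enat t)" "top_length R X = enat t"
proof -
  interpret X: left_module R X using d by (simp add: dim_vec_def)
  have "ideal_smult X J (rad X) \<subseteq> {\<zero>\<^bsub>X\<^esub>}"
  proof (rule smult_J_least[OF X.left_module_axioms X.submodule_zero])
    fix j x assume j: "j \<in> J" and x: "x \<in> rad X"
    show "j \<odot>\<^bsub>X\<^esub> x \<in> {\<zero>\<^bsub>X\<^esub>}"
      using x
    proof induction
      case (smult i x)
      then show ?case using j d by (simp add: dim_vec_def loewy2_def)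
    next
      case (add x y)
      then show ?case using j X.submoduleD(1)[OF rad_submodule[OF X.left_module_axioms]]
        by (simp add: X.smult_r_distr J_carr subset_iff)
    qed
  qed
  moreover have "submodule (ideal_smult X J (rad X)) R X"
    using X.submoduleD[OF rad_submodule[OF X.left_module_axioms]]
    by (intro smult_J_submodule X.left_module_axioms) auto
  ultimately have "ideal_smult X J (rad X) = {\<zero>\<^bsub>X\<^esub>}"
    using X.submoduleD(2) by blast
  then show "has_dim_vector R X (enat t, enat a * enat t)" "top_length R X = enat t"
    using d[unfolded dim_vec_def]
    unfolding has_dim_vector_def loewy_length_le2_def top_length_def rad_mod_def assms(1)[symmetric] by simp_all
qed

theorem theorem1p2:
  fixes K :: "'k ring" and A :: "('k, 'a) module" and M :: "('a, 'm) module"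
    and e a :: nat
  assumes "short_local_algebra K A"
    and "hilbert_type A e a"
    and "\<not> self_injective A"
    and "fl_module A M"
    and "indecomposable A M"
    and "reflexive A M"
    and "\<not> projective A M"
    and "\<And>i. i \<in> {1, 2} \<Longrightarrow> Ext_vanishes A i M (reg_mod A)"
  shows "2 \<le> a \<and> a = e - 1 \<and>
    (let t = top_length A M in
       has_dim_vector A (Omega A (Omega A M)) (t, enat a * t) \<and>
       has_dim_vector A (Omega A M) (t, enat a * t) \<and>
       has_dim_vector A M (t, enat a * t) \<and>
       has_dim_vector A (mho A M) (t, enat a * t))"
proof -
  interpret A: short_alg A "jrad A" K "\<lambda>c. c \<odot>\<^bsub>A\<^esub> \<one>\<^bsub>A\<^esub>" e a
    by (rule short_local_algebra_short_alg[OF assms(1,2)])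
  have "Ext_vanishes A 1 M (reg_mod A)" "Ext_vanishes A 2 M (reg_mod A)" using assms(8) by simp_all
  with A.syzygy_dimensions[OF assms(4,5,6,7,3)]
  obtain t where a: "2 \<le> a" "e = a + 1" and t: "A.dim_vec M t (a * t)" "A.dim_vec (Omega A M) t (a * t)"
    "A.dim_vec (Omega A (Omega A M)) t (a * t)" "A.dim_vec (mho A M) t (a * t)" by blast
  show ?thesis
    using a t[THEN A.dim_vec_has_dim_vector(1)[OF refl]] A.dim_vec_has_dim_vector(2)[OF refl t(1)]
    by (simp add: Let_def)
qed

end
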